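(* Let $\Omega\subset\mathbb{R}^N$ be a bounded open set with Lipschitz boundary and let $k\in\mathbb{N}$. For every $\xi\in\mathbb{Z}^N$ let $f^\xi:\mathbb{Z}^N\times S^{N-1}_\otimes\times S^{N-1}_\otimes\to\mathbb{R}$ be such that $f^\xi(\cdot,Q_1,Q_2)$ is $[0,k]^N$-periodic for all $Q_1,Q_2\in S^{N-1}_\otimes$, and extend $f^\xi$ by $f^\xi(\alpha,Q_1,Q_2)=+\infty$ if $(Q_1,Q_2)\notin S^{N-1}_\otimes\times S^{N-1}_\otimes$. Assume that (1) $f^\xi(\alpha,Q_1,Q_2)=f^{-\xi}(\alpha+\xi,Q_2,Q_1)$ for all $\alpha,\xi\in\mathbb{Z}^N$ and $Q_1,Q_2\in S^{N-1}_\otimes$; (2) for every $\xi$ there exists $C^\xi\ge0$ such that $|f^\xi(\alpha,Q_1,Q_2)|\le C^\xi$ for all $\alpha\in\mathbb{Z}^N$ and $Q_1,Q_2\in S^{N-1}_\otimes$, and $\sum_{\xi\in\mathbb{Z}^N}C^\xi<\infty$. Let $F_\varepsilon:L^\infty(\Omega;\mathbb{M}^{N\times N}_{sym})\to(-\infty,+\infty]$ be $$F_\varepsilon(Q)=\sum_{\xi\in\mathbb{Z}^N}\ \sum_{\alpha\in R^\xi_\varepsilon(\Omega)}\varepsilon^N f^\xi(\alpha,Q(\varepsilon\alpha),Q(\varepsilon\alpha+\varepsilon\xi))\quad\text{if }Q\in C_\varepsilon(\Omega;S^{N-1}_\otimes),$$ and $F_\varepsilon(Q)=+\infty$ otherwise.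 Then, as $\varepsilon\to0$, $F_\varepsilon$ $\Gamma$-converge with respect to the $L^\infty$-weak$^*$ topology to the functional $F_{\rm hom}:L^\infty(\Omega;\mathbb{M}^{N\times N}_{sym})\to(-\infty,+\infty]$ defined by $$F_{\rm hom}(Q)=\int_\Omega f_{\rm hom}(Q(x))\,dx\ \text{ if }Q\in L^\infty(\Omega;K),\qquad F_{\rm hom}(Q)=+\infty\ \text{ otherwise,}$$ where $K=\{Q\in\mathbb{M}^{N\times N}_{sym}:Q\ge0,\ \mathrm{tr}\,Q=1\}$ and, for $\bar Q\in K$, $f_{\rm hom}$ is given by the homogenization formula $$f_{\rm hom}(\bar Q)=\lim_{\rho\to0}\ \lim_{h\to+\infty}\frac1{h^N}\inf\Bigl\{\sum_{\xi\in\mathbb{Z}^N}\ \sum_{\beta\in R^\xi_1(hW_N)}f^\xi(\beta,Q(\beta),Q(\beta+\xi)):\ \langle Q\rangle^{d,1}_{hW_N}\in\overline B(\bar Q,\rho)\Bigr\},$$ the infimum being over functions $Q:\mathbb{Z}^N\cap hW_N\to S^{N-1}_\otimes$.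
   Context: $\mathbb{M}^{N\times N}_{sym}$ is the space of symmetric $N\times N$ real matrices with the Frobenius norm; $\overline B(\bar Q,\rho)$ is the closed ball of radius $\rho$ centered at $\bar Q$ in it. $S^{N-1}_\otimes=\{v\otimes v:\ v\in S^{N-1}\}$. $\mathbb{Z}_\varepsilon(A)=\{i\in\mathbb{Z}^N:\varepsilon i\in A\}$ and $R^\xi_\varepsilon(A)=\{\alpha\in\mathbb{Z}_\varepsilon(A):\alpha+\xi\in\mathbb{Z}_\varepsilon(A)\}$. $W_N=[-\frac12,\frac12)^N$, and $$C_\varepsilon(\Omega;S^{N-1}_\otimes)=\{Q:\Omega\to S^{N-1}_\otimes:\ Q(x)=Q(\varepsilon i)\text{ if }x\in\varepsilon\{i+W_N\},\ i\in\mathbb{Z}_\varepsilon(\Omega)\}.$$ The discrete average is $\langle Q\rangle^{d,\varepsilon}_A=\frac{1}{\#(\varepsilon\mathbb{Z}^N\cap A)}\sum_{\alpha\in\varepsilon\mathbb{Z}^N\cap A}Q(\alpha)$. A function on $\mathbb{Z}^N$ is $[0,k]^N$-periodic if it is $k$-periodic in each coordinate direction. *)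

theory Defs
  imports "HOL-Analysis.Analysis"
begin

section \<open>Matrices\<close>

text \<open>The inherited norm and inner product of \<^typ>\<open>real^'n^'n\<close> are the Frobenius ones.\<close>

definition sym_matrices :: "(real^'n^'n) set" where
  "sym_matrices = {Q. transpose Q = Q}"

definition tensor :: "real^'n \<Rightarrow> real^'n \<Rightarrow> real^'n^'n" where
  "tensor v w = (\<chi> i j. v $ i * w $ j)"

definition sphere_tensor :: "(real^'n^'n) set" where
  "sphere_tensor = {tensor v v |v. v \<in> sphere 0 1}"

definition K_set :: "(real^'n^'n) set" where
  "K_set = {Q \<in> sym_matrices. (\<forall>v. 0 \<le> v \<bullet> (Q *v v)) \<and> trace Q = 1}"


section \<open>Lattices and discrete functions\<close>

definition lat :: "int^'n \<Rightarrow> real^'n" where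
  "lat i = (\<chi> j. real_of_int (i $ j))"

definition Z_eps :: "real \<Rightarrow> (real^'n) set \<Rightarrow> (int^'n) set" where
  "Z_eps \<epsilon> A = {i. \<epsilon> *\<^sub>R lat i \<in> A}"

definition R_eps :: "real \<Rightarrow> int^'n \<Rightarrow> (real^'n) set \<Rightarrow> (int^'n) set" where
  "R_eps \<epsilon> \<xi> A = {\<alpha> \<in> Z_eps \<epsilon> A. \<alpha> + \<xi> \<in> Z_eps \<epsilon> A}"

definition W_cube :: "(real^'n) set" where
  "W_cube = {x. \<forall>i. - 1/2 \<le> x $ i \<and> x $ i < 1/2}"

definition C_eps :: "real \<Rightarrow> (real^'n) set \<Rightarrow> (real^'n \<Rightarrow> real^'n^'n) set" where
  "C_eps \<epsilon> \<Omega> = {Q. (\<forall>x\<in>\<Omega>. Q x \<in> sphere_tensor) \<and>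
     (\<forall>i\<in>Z_eps \<epsilon> \<Omega>. \<forall>x \<in> \<Omega> \<inter> (\<lambda>w. \<epsilon> *\<^sub>R (lat i + w)) ` W_cube. Q x = Q (\<epsilon> *\<^sub>R lat i))}"

definition scaled_lattice :: "real \<Rightarrow> (real^'n) set" where
  "scaled_lattice \<epsilon> = range (\<lambda>i. \<epsilon> *\<^sub>R lat i)"

definition disc_avg :: "real \<Rightarrow> (real^'n) set \<Rightarrow> (real^'n \<Rightarrow> real^'n^'n) \<Rightarrow> real^'n^'n" where
  "disc_avg \<epsilon> A Q =
     (1 / real (card (scaled_lattice \<epsilon> \<inter> A))) *\<^sub>R (\<Sum>\<alpha> \<in> scaled_lattice \<epsilon> \<inter> A. Q \<alpha>)"


section \<open>The spaces of essentially bounded functions and the weak* topology\<close>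

text \<open>
  Functions are total on \<^typ>\<open>real^'n\<close>; only their values on \<open>\<Omega>\<close> matter. They are not
  quotiented by a.e. equality: the topology below does not separate a.e. equal functions, and
  the functionals defined later take equal values on them.
\<close>

definition Linf :: "(real^'n) set \<Rightarrow> (real^'n^'n) set \<Rightarrow> (real^'n \<Rightarrow> real^'n^'n) set" where
  "Linf \<Omega> S = {Q \<in> borel_measurable (lebesgue_on \<Omega>).
     (\<exists>B. AE x in lebesgue_on \<Omega>. norm (Q x) \<le> B) \<and> (AE x in lebesgue_on \<Omega>. Q x \<in> S)}"

definition L1 :: "(real^'n) set \<Rightarrow> (real^'n^'n) set \<Rightarrow> (real^'n \<Rightarrow> real^'n^'n) set" where
  "L1 \<Omega> S = {\<phi>. integrable (lebesgue_on \<Omega>) \<phi> \<and> (AE x in lebesgue_on \<Omega>. \<phi> x \<in> S)}"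

text \<open>
  The coarsest topology on \<open>L\<^sup>\<infinity>(\<Omega>; M\<^sub>s\<^sub>y\<^sub>m)\<close> that makes \<open>Q \<mapsto> \<integral>\<^sub>\<Omega> \<phi> : Q dx\<close>
  continuous for every \<open>\<phi>\<close> in \<open>L\<^sup>1(\<Omega>; M\<^sub>s\<^sub>y\<^sub>m)\<close>.
\<close>

definition weak_star :: "(real^'n) set \<Rightarrow> (real^'n \<Rightarrow> real^'n^'n) topology" where
  "weak_star \<Omega> = pullback_topology (Linf \<Omega> sym_matrices)
     (\<lambda>Q. \<lambda>\<phi>\<in>L1 \<Omega> sym_matrices. LINT x|lebesgue_on \<Omega>. \<phi> x \<bullet> Q x)
     (product_topology (\<lambda>_. euclideanreal) (L1 \<Omega> sym_matrices))"


section \<open>Gamma-convergence on a topological space, along a filter of parameters\<close>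

definition Gamma_liminf ::
  "'a topology \<Rightarrow> ('i \<Rightarrow> 'a \<Rightarrow> ereal) \<Rightarrow> 'i filter \<Rightarrow> 'a \<Rightarrow> ereal" where
  "Gamma_liminf T f F x = (SUP U \<in> {U. openin T U \<and> x \<in> U}. Liminf F (\<lambda>i. INF y\<in>U. f i y))"

definition Gamma_limsup ::
  "'a topology \<Rightarrow> ('i \<Rightarrow> 'a \<Rightarrow> ereal) \<Rightarrow> 'i filter \<Rightarrow> 'a \<Rightarrow> ereal" where
  "Gamma_limsup T f F x = (SUP U \<in> {U. openin T U \<and> x \<in> U}. Limsup F (\<lambda>i. INF y\<in>U. f i y))"

definition Gamma_converges ::
  "'a topology \<Rightarrow> ('i \<Rightarrow> 'a \<Rightarrow> ereal) \<Rightarrow> ('a \<Rightarrow> ereal) \<Rightarrow> 'i filter \<Rightarrow> bool" where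
  "Gamma_converges T f g F \<longleftrightarrow>
     (\<forall>x\<in>topspace T. Gamma_liminf T f F x = g x \<and> Gamma_limsup T f F x = g x)"


section \<open>Lipschitz boundary\<close>

text \<open>
  Near each boundary point, \<open>\<Omega>\<close> is the strict subgraph, in some direction \<open>\<nu>\<close>, of a Lipschitz
  function on the hyperplane orthogonal to \<open>\<nu>\<close>.
\<close>

definition lipschitz_boundary :: "(real^'n) set \<Rightarrow> bool" where
  "lipschitz_boundary \<Omega> \<longleftrightarrow> (\<forall>x\<in>frontier \<Omega>. \<exists>r>0. \<exists>\<nu> L g. norm \<nu> = 1 \<and>
     L-lipschitz_on {z. z \<bullet> \<nu> = 0} (g :: real^'n \<Rightarrow> real) \<and>
     \<Omega> \<inter> ball x r = {y \<in> ball x r. y \<bullet> \<nu> < g (y - (y \<bullet> \<nu>) *\<^sub>R \<nu>)})"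


section \<open>The energies\<close>

text \<open>An interaction takes \<open>\<xi>\<close>, \<open>\<alpha>\<close>, \<open>Q\<^sub>1\<close>, \<open>Q\<^sub>2\<close>, in this order.\<close>

type_synonym 'n interaction =
  "int^'n \<Rightarrow> int^'n \<Rightarrow> real^'n^'n \<Rightarrow> real^'n^'n \<Rightarrow> real"

definition f_ext ::
  "'n interaction \<Rightarrow> int^'n \<Rightarrow> int^'n \<Rightarrow> real^'n^'n \<Rightarrow> real^'n^'n \<Rightarrow> ereal" where
  "f_ext f \<xi> \<alpha> Q1 Q2 =
     (if Q1 \<in> sphere_tensor \<and> Q2 \<in> sphere_tensor then ereal (f \<xi> \<alpha> Q1 Q2) else \<infinity>)"

text \<open>For bounded \<open>A\<close> and \<open>\<epsilon> > 0\<close> all but finitely many terms of the outer sum vanish.\<close>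

definition disc_energy ::
  "'n interaction \<Rightarrow> real \<Rightarrow> (real^'n) set \<Rightarrow> (real^'n \<Rightarrow> real^'n^'n) \<Rightarrow> ereal" where
  "disc_energy f \<epsilon> A Q = (\<Sum>\<^sub>\<infinity>\<xi>\<in>UNIV. \<Sum>\<alpha>\<in>R_eps \<epsilon> \<xi> A.
     ereal (\<epsilon> ^ CARD('n)) *
       f_ext f \<xi> \<alpha> (Q (\<epsilon> *\<^sub>R lat \<alpha>)) (Q (\<epsilon> *\<^sub>R lat \<alpha> + \<epsilon> *\<^sub>R lat \<xi>)))"

text \<open>
  Membership of a class of a.e. equal functions in \<open>C\<^sub>\<epsilon>\<close> means that it has a representative
  there. All such representatives have the same energy, see \<open>F_eps_eq\<close> below, so the infimum
  just evaluates it; it is \<open>\<infinity>\<close> if there is no representative.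
\<close>

definition F_eps ::
  "'n interaction \<Rightarrow> (real^'n) set \<Rightarrow> real \<Rightarrow> (real^'n \<Rightarrow> real^'n^'n) \<Rightarrow> ereal" where
  "F_eps f \<Omega> \<epsilon> Q =
     (INF Q' \<in> {Q' \<in> C_eps \<epsilon> \<Omega>. AE x in lebesgue_on \<Omega>. Q' x = Q x}. disc_energy f \<epsilon> \<Omega> Q')"

text \<open>
  The rescaled infimum on the cube \<open>h W\<^sub>N\<close>. The competitors are total functions of which only
  the values at the points of \<open>\<int>\<^sup>N \<inter> h W\<^sub>N\<close> enter; the infimum over no competitor is \<open>\<infinity>\<close>.
\<close>

definition cell_inf :: "'n interaction \<Rightarrow> real^'n^'n \<Rightarrow> real \<Rightarrow> real \<Rightarrow> ereal" where
  "cell_inf f Qbar \<rho> h = ereal (1 / h ^ CARD('n)) *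
     (INF Q \<in> {Q. (\<forall>x \<in> scaled_lattice 1 \<inter> (*\<^sub>R) h ` W_cube. Q x \<in> sphere_tensor) \<and>
                  disc_avg 1 ((*\<^sub>R) h ` W_cube) Q \<in> cball Qbar \<rho>}.
        disc_energy f 1 ((*\<^sub>R) h ` W_cube) Q)"

text \<open>All the limits exist, and the iterated limit is the real number \<open>l\<close>.\<close>

definition has_hom_limit :: "'n interaction \<Rightarrow> real^'n^'n \<Rightarrow> real \<Rightarrow> bool" where
  "has_hom_limit f Qbar l \<longleftrightarrow> (\<exists>m :: real \<Rightarrow> ereal.
     (\<forall>\<rho>>0. (cell_inf f Qbar \<rho> \<longlongrightarrow> m \<rho>) at_top) \<and> (m \<longlongrightarrow> ereal l) (at_right 0))"

definition f_hom :: "'n interaction \<Rightarrow> real^'n^'n \<Rightarrow> real" where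
  "f_hom f Qbar = (THE l. has_hom_limit f Qbar l)"

definition F_hom ::
  "'n interaction \<Rightarrow> (real^'n) set \<Rightarrow> (real^'n \<Rightarrow> real^'n^'n) \<Rightarrow> ereal" where
  "F_hom f \<Omega> Q =
     (if Q \<in> Linf \<Omega> K_set then ereal (LINT x|lebesgue_on \<Omega>. f_hom f (Q x)) else \<infinity>)"


section \<open>Sanity checks\<close>

lemma topspace_weak_star: "topspace (weak_star \<Omega>) = Linf \<Omega> sym_matrices"
  unfolding weak_star_def topspace_pullback_topology by auto

lemma has_hom_limit_unique:
  assumes "has_hom_limit f Q l" "has_hom_limit f Q l'"
  shows "l = l'"
proof -
  obtain m m' where m: "\<forall>\<rho>>0. (cell_inf f Q \<rho> \<longlongrightarrow> m \<rho>) at_top" "(m \<longlongrightarrow> ereal l) (at_right 0)"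
    and m': "\<forall>\<rho>>0. (cell_inf f Q \<rho> \<longlongrightarrow> m' \<rho>) at_top" "(m' \<longlongrightarrow> ereal l') (at_right 0)"
    using assms unfolding has_hom_limit_def by blast
  have "m \<rho> = m' \<rho>" if "\<rho> > 0" for \<rho>
    using tendsto_unique[OF _ m(1)[rule_format, OF that] m'(1)[rule_format, OF that]] by simp
  then have "\<forall>\<^sub>F \<rho> in at_right 0. m \<rho> = m' \<rho>"
    unfolding eventually_at_right_field by (intro exI[of _ 1]) auto
  then have "(m' \<longlongrightarrow> ereal l) (at_right 0)"
    using m(2) tendsto_cong by blast
  then have "ereal l = ereal l'"
    using m'(2) tendsto_unique trivial_limit_at_right_real by blast
  then show ?thesis by simp
qed

lemma C_eps_AE_eq:
  assumes "open \<Omega>" "\<epsilon> > 0" and Q: "Q \<in> C_eps \<epsilon> \<Omega>" "Q' \<in> C_eps \<epsilon> \<Omega>"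
    and ae: "AE x in lebesgue_on \<Omega>. Q' x = Q x" and i: "i \<in> Z_eps \<epsilon> \<Omega>"
  shows "Q' (\<epsilon> *\<^sub>R lat i) = Q (\<epsilon> *\<^sub>R lat i)"
proof (rule ccontr)
  assume ne: "Q' (\<epsilon> *\<^sub>R lat i) \<noteq> Q (\<epsilon> *\<^sub>R lat i)"
  let ?p = "\<epsilon> *\<^sub>R lat i"
  have "?p \<in> \<Omega>" using i by (simp add: Z_eps_def)
  then obtain r where r: "r > 0" "ball ?p r \<subseteq> \<Omega>"
    using \<open>open \<Omega>\<close> open_contains_ball by blast
  let ?s = "min r (\<epsilon> / 2)"
  have sub: "ball ?p ?s \<subseteq> {x \<in> \<Omega>. Q' x \<noteq> Q x}"
  proof
    fix x assume x: "x \<in> ball ?p ?s"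
    have xO: "x \<in> \<Omega>" using x r by auto
    define w where "w = (1/\<epsilon>) *\<^sub>R (x - ?p)"
    have nw: "norm (x - ?p) < \<epsilon> / 2" using x by (simp add: dist_norm norm_minus_commute)
    have "norm w = norm (x - ?p) / \<epsilon>" using \<open>\<epsilon> > 0\<close> unfolding w_def norm_scaleR by simp
    also have "\<dots> < 1/2" using nw \<open>\<epsilon> > 0\<close> by (simp add: divide_less_eq)
    finally have nw2: "norm w < 1/2" .
    have "- 1/2 \<le> w $ j \<and> w $ j < 1/2" for j
      using component_le_norm_cart[of w j] nw2 by linarith
    then have "w \<in> W_cube" unfolding W_cube_def by blast
    moreover have "x = \<epsilon> *\<^sub>R (lat i + w)"
      using \<open>\<epsilon> > 0\<close> by (simp add: w_def scaleR_add_right)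
    ultimately have "x \<in> \<Omega> \<inter> (\<lambda>w. \<epsilon> *\<^sub>R (lat i + w)) ` W_cube" using xO by blast
    then have "Q x = Q ?p" "Q' x = Q' ?p" using Q i unfolding C_eps_def by blast+
    then show "x \<in> {x \<in> \<Omega>. Q' x \<noteq> Q x}" using xO ne by simp
  qed
  have Om: "\<Omega> \<in> sets lebesgue" using \<open>open \<Omega>\<close> by (simp add: borel_open)
  have "AE x in lebesgue. x \<in> \<Omega> \<longrightarrow> Q' x = Q x"
    using ae Om by (simp add: AE_restrict_space_iff)
  then obtain N where N: "N \<in> null_sets lebesgue"
      "{x \<in> space lebesgue. \<not> (x \<in> \<Omega> \<longrightarrow> Q' x = Q x)} \<subseteq> N"
    unfolding eventually_ae_filter by blast
  have "{x \<in> \<Omega>. Q' x \<noteq> Q x} \<subseteq> N" using N(2) by auto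
  then have "negligible (ball ?p ?s)"
    using sub N(1) negligible_iff_null_sets negligible_subset by blast
  then show False
    using open_not_negligible[of "ball ?p ?s"] r \<open>\<epsilon> > 0\<close> by simp
qed

lemma F_eps_eq:
  assumes "open \<Omega>" "\<epsilon> > 0" "Q \<in> C_eps \<epsilon> \<Omega>"
  shows "F_eps f \<Omega> \<epsilon> Q = disc_energy f \<epsilon> \<Omega> Q"
proof -
  have eq: "disc_energy f \<epsilon> \<Omega> Q' = disc_energy f \<epsilon> \<Omega> Q"
    if "Q' \<in> C_eps \<epsilon> \<Omega>" "AE x in lebesgue_on \<Omega>. Q' x = Q x" for Q'
  proof -
    have *: "Q' (\<epsilon> *\<^sub>R lat i) = Q (\<epsilon> *\<^sub>R lat i)" if "i \<in> Z_eps \<epsilon> \<Omega>" for i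
      using C_eps_AE_eq assms \<open>Q' \<in> C_eps \<epsilon> \<Omega>\<close> \<open>AE x in lebesgue_on \<Omega>. Q' x = Q x\<close> that by blast
    have l: "\<epsilon> *\<^sub>R lat a + \<epsilon> *\<^sub>R lat b = \<epsilon> *\<^sub>R lat (a + b)" for a b :: "int^'a"
      by (simp add: lat_def vec_eq_iff algebra_simps)
    show ?thesis
      unfolding disc_energy_def l
      by (intro infsum_cong sum.cong) (auto simp: R_eps_def *)
  qed
  show ?thesis
    unfolding F_eps_def
  proof (rule antisym)
    show "(INF Q' \<in> {Q' \<in> C_eps \<epsilon> \<Omega>. AE x in lebesgue_on \<Omega>. Q' x = Q x}. disc_energy f \<epsilon> \<Omega> Q')
        \<le> disc_energy f \<epsilon> \<Omega> Q"
      by (rule INF_lower) (simp add: assms(3))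
    show "disc_energy f \<epsilon> \<Omega> Q
        \<le> (INF Q' \<in> {Q' \<in> C_eps \<epsilon> \<Omega>. AE x in lebesgue_on \<Omega>. Q' x = Q x}. disc_energy f \<epsilon> \<Omega> Q')"
    proof (rule INF_greatest)
      fix Q' assume "Q' \<in> {Q' \<in> C_eps \<epsilon> \<Omega>. AE x in lebesgue_on \<Omega>. Q' x = Q x}"
      then have "disc_energy f \<epsilon> \<Omega> Q' = disc_energy f \<epsilon> \<Omega> Q" by (intro eq) simp_all
      then show "disc_energy f \<epsilon> \<Omega> Q \<le> disc_energy f \<epsilon> \<Omega> Q'" by simp
    qed
  qed
qed

end

(* A configuration on a finite set A of lattice points is an S-valued function, S being the set of
   the tensors v (x) v, and its energy is a sum over pairs of points. As the coefficients C are
   summable, the energies of disjoint large cubes are additive up to an error that is small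
   relative to their volume, and a change at m points costs at most a multiple of m.
   Given a configuration on a large cube whose average lies in the ball B(P, rho), translates of it by
   multiples of the period tile every much larger cube; the points left over are labelled
   greedily so that their average is close to P too, and the average of the whole stays
   in the ball by convexity. Hence the minimal energy densities are almost decreasing in the size
   of the cube and converge to a limit m(rho, P), which is also the limit of cell_inf, and
   f_hom(P) = sup_rho m(rho, P).
   Both Gamma-inequalities compare F_eps with sum_z r^N m(rho, Q_z), where Q_z is the average of Q
   on the cubes z of a fixed grid of size r. Since m(rho', P') <= m(rho, P) for
   rho + |P - P'| <= rho', this sum is estimated by integrals of m(., Q(x)) with an error
   controlled by the oscillation sum_z int_z |Q - Q_z|, which vanishes as r -> 0. The parameter rho
   thus replaces both the convexity and any continuity of f_hom. The regularity of the boundary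
   only enters through its being a null set. *)

theory Submission
  imports Defs
begin

section \<open>Symmetric matrices and tensors\<close>

text \<open>Three obstacles shape the details. Labellings may be copied only along multiples of
  \<open>k\<close>, so copies cannot be packed tightly: the tiling period is a multiple of
  \<open>k\<close> strictly larger than the side, and the strips in between hold the free points.
  These must be numerous, for their average to be adjustable, and yet a small fraction of the
  volume. The comparison with integrals costs a multiple of \<open>M / \<rho>\<close> times the
  oscillation, which is harmless only because \<open>\<rho>\<close> is fixed before
  \<open>r\<close>, and \<open>r\<close> before \<epsilon>. The topology is handled through
  neighbourhoods, not sequences. Averages over finitely many grid cubes are the link: they are
  continuous in the weak-star topology, and conversely, for small \<open>r\<close>, they control the
  pairing with finitely many test functions. The first direction serves the lower bound, the second
  one the upper bound. The greedy labelling rests on the tensors having \<open>K_set\<close> as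
  convex hull; this is obtained by elimination of rows, without eigenvectors.\<close>

lemma inner_tensor: "X \<bullet> tensor v v = v \<bullet> (X *v v)"
  by (simp add: tensor_def inner_vec_def matrix_vector_mult_def sum_distrib_left mult_ac)

lemma trace_tensor: "trace (tensor v v) = (norm v)\<^sup>2"
  by (simp add: trace_def tensor_def power2_norm_eq_inner inner_vec_def)

lemma trace_scaleR: "trace (c *\<^sub>R A) = c * trace (A :: real^'n^'n)"
  by (simp add: trace_def sum_distrib_left)

lemma norm_tensor: "norm (tensor v v) = (norm v)\<^sup>2"
proof -
  have "(norm (tensor v v))\<^sup>2 = ((norm v)\<^sup>2)\<^sup>2"
    unfolding power2_norm_eq_inner
    by (simp add: tensor_def inner_vec_def sum_distrib_left sum_distrib_right power2_eq_square mult_ac)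
  then show ?thesis by (metis norm_ge_zero power2_eq_imp_eq zero_le_power2)
qed

lemma tensor_scaleR: "tensor (c *\<^sub>R v) (c *\<^sub>R v) = (c * c) *\<^sub>R tensor v v"
  by (simp add: tensor_def vec_eq_iff)

text \<open>Elimination step of a Cholesky factorization: \<open>w\<close> is the column of index
  \<open>i\<close> and \<open>R\<close> a Schur complement. The form of \<open>R\<close> at v is the
  minimum over t of the form of \<open>P\<close> at v - t e_i, hence nonnegative. Since 0 <= R_jj <=
  P_jj and R_ii = 0, the number of nonzero diagonal entries drops, which drives the induction
  below.\<close>

lemma psd_remove_row:
  fixes P :: "real^'n^'n"
  assumes sym: "transpose P = P" and psd: "\<And>v. 0 \<le> v \<bullet> (P *v v)" and p: "P $ i $ i \<noteq> 0"
  defines "w \<equiv> P *v axis i 1"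
  defines "R \<equiv> P - (1 / P $ i $ i) *\<^sub>R tensor w w"
  shows "P $ i $ i > 0" "transpose R = R" "\<And>v. 0 \<le> v \<bullet> (R *v v)" 
    "{j. R $ j $ j \<noteq> 0} \<subset> {j. P $ j $ j \<noteq> 0}"
proof -
  have symc: "P $ a $ b = P $ b $ a" for a b
    using sym by (metis transpose_def vec_lambda_beta)
  have w: "w $ j = P $ j $ i" for j
    unfolding w_def by (simp add: matrix_vector_mul_component inner_axis)
  have pa: "axis j 1 \<bullet> (A *v axis j 1) = A $ j $ j" for A :: "real^'n^'n" and j
    by (simp add: inner_axis_axis matrix_vector_mul_component inner_axis' inner_axis)
  have "0 \<le> P $ i $ i" using psd[of "axis i 1"] pa[of i P] by simp
  then show pos: "P $ i $ i > 0" using p by simp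
  show symR: "transpose R = R"
    using symc by (simp add: R_def tensor_def transpose_def vec_eq_iff mult_ac)
  have tv: "v \<bullet> (tensor w w *v v) = (v \<bullet> w)\<^sup>2" for v
    unfolding inner_tensor[symmetric]
    by (simp add: tensor_def inner_vec_def power2_eq_square sum_distrib_left sum_distrib_right mult_ac)
  show psdR: "0 \<le> v \<bullet> (R *v v)" for v
  proof -
    define t where "t = (v \<bullet> w) / P $ i $ i"
    have sa: "axis i 1 \<bullet> (P *v v) = v \<bullet> w"
      unfolding w_def by (metis sym dot_lmul_matrix inner_commute transpose_matrix_vector)
    have "0 \<le> (v - t *\<^sub>R axis i 1) \<bullet> (P *v (v - t *\<^sub>R axis i 1))" by (rule psd)
    also have "\<dots> = v \<bullet> (P *v v) - 2 * t * (v \<bullet> w) + t\<^sup>2 * P $ i $ i"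
      using sa pa[of i P]
      by (simp add: w_def matrix_vector_mult_diff_distrib inner_diff_left inner_diff_right
          matrix_vector_mult_scaleR power2_eq_square algebra_simps)
    also have "\<dots> = v \<bullet> (P *v v) - (v \<bullet> w)\<^sup>2 / P $ i $ i"
      using pos by (simp add: t_def power2_eq_square field_simps)
    also have "\<dots> = v \<bullet> (R *v v)"
      by (simp add: R_def matrix_vector_mult_diff_rdistrib inner_diff_right tv
          scaleR_matrix_vector_assoc[symmetric])
    finally show ?thesis .
  qed
  have R: "R $ j $ j = P $ j $ j - (P $ j $ i)\<^sup>2 / P $ i $ i" for j
    by (simp add: R_def tensor_def w power2_eq_square)
  have "R $ i $ i = 0" using pos by (simp add: R power2_eq_square)
  moreover have "P $ j $ j \<noteq> 0" if "R $ j $ j \<noteq> 0" for j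
  proof
    assume "P $ j $ j = 0"
    then have "R $ j $ j \<le> 0" using pos by (simp add: R)
    moreover have "R $ j $ j \<ge> 0" using psdR[of "axis j 1"] pa[of j R] by simp
    ultimately show False using that by simp
  qed
  ultimately show "{j. R $ j $ j \<noteq> 0} \<subset> {j. P $ j $ j \<noteq> 0}" using p by blast
qed

text \<open>Repeated elimination writes \<open>P\<close> as a sum of positive multiples of
  \<open>tensor w w\<close>; for each of them the inequality follows from \<open>c\<close> after
  scaling \<open>w\<close> to unit length. This takes the place of a spectral decomposition.\<close>

lemma psd_inner_ge:
  fixes P :: "real^'n^'n"
  assumes "transpose P = P" "\<And>v. 0 \<le> v \<bullet> (P *v v)"
    and c: "\<And>v. norm v = 1 \<Longrightarrow> c \<le> X \<bullet> tensor v v"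
  shows "c * trace P \<le> X \<bullet> P"
  using assms(1,2)
proof (induction "card {i. P $ i $ i \<noteq> 0}" arbitrary: P rule: less_induct)
  case (less P)
  show ?case
  proof (cases "\<exists>i. P $ i $ i \<noteq> 0")
    case True
    then obtain i where i: "P $ i $ i \<noteq> 0" by blast
    define w where "w = P *v axis i 1"
    define R where "R = P - (1 / P $ i $ i) *\<^sub>R tensor w w"
    note step = psd_remove_row[OF less.prems i, folded w_def, folded R_def]
    have IH: "c * trace R \<le> X \<bullet> R"
      using less.hyps[of R] step by (simp add: psubset_card_mono)
    have "c * (norm w)\<^sup>2 \<le> X \<bullet> tensor w w"
    proof (cases "w = 0")
      case False
      have "c \<le> X \<bullet> tensor ((1 / norm w) *\<^sub>R w) ((1 / norm w) *\<^sub>R w)"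
        using False by (intro c) simp
      then show ?thesis
        using False unfolding tensor_scaleR by (simp add: field_simps power2_eq_square)
    qed (simp add: tensor_def flip: zero_vec_def)
    then have "c * ((1 / P $ i $ i) * (norm w)\<^sup>2) \<le> (1 / P $ i $ i) * (X \<bullet> tensor w w)"
      using step(1) by (simp add: field_simps)
    moreover have "P = R + (1 / P $ i $ i) *\<^sub>R tensor w w" by (simp add: R_def)
    then have "trace P = trace R + (1 / P $ i $ i) * (norm w)\<^sup>2"
      "X \<bullet> P = X \<bullet> R + (1 / P $ i $ i) * (X \<bullet> tensor w w)"
      by (metis trace_add trace_tensor trace_scaleR, metis inner_add_right inner_scaleR_right)
    ultimately show ?thesis using IH by (simp add: algebra_simps)
  next
    case False
    \<comment> \<open>With a vanishing diagonal the form at e_a + t e_b is 2 t P_ab; it is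
      nonnegative for t = 1 and for t = -1.\<close>
    have "P $ a $ b = 0" for a b
    proof -
      have sym: "P $ a $ b = P $ b $ a"
        using less.prems(1) by (metis transpose_def vec_lambda_beta)
      have e: "axis a 1 \<bullet> (P *v axis b 1) = P $ a $ b" for a b
        by (simp add: matrix_vector_mul_component inner_axis' inner_axis)
      have "0 \<le> (axis a 1 + t *\<^sub>R axis b 1) \<bullet> (P *v (axis a 1 + t *\<^sub>R axis b 1))" for t
        by (rule less.prems)
      then have "0 \<le> 2 * t * P $ a $ b" for t
        using False sym
        by (simp add: matrix_vector_right_distrib inner_add_left inner_add_right
          matrix_vector_mult_scaleR e algebra_simps)
      from this[of 1] this[of "-1"] show ?thesis by simp
    qed
    then have "P = 0" by (simp add: vec_eq_iff)
    then show ?thesis by (simp add: trace_def)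
  qed
qed

section \<open>The tensors of unit vectors and their convex hull\<close>

lemma sphere_tensor_iff: "s \<in> sphere_tensor \<longleftrightarrow> (\<exists>v. norm v = 1 \<and> s = tensor v v)"
  by (auto simp: sphere_tensor_def)

lemma norm_sphere_tensor: "s \<in> sphere_tensor \<Longrightarrow> norm s = 1"
  by (auto simp: sphere_tensor_iff norm_tensor)

lemma sphere_tensor_nonempty: "(sphere_tensor :: (real^'n^'n) set) \<noteq> {}"
proof -
  have "tensor (axis undefined 1) (axis undefined 1) \<in> (sphere_tensor :: (real^'n^'n) set)"
    unfolding sphere_tensor_iff using norm_axis_1 by blast
  then show ?thesis by blast
qed

lemma compact_sphere_tensor: "compact (sphere_tensor :: (real^'n^'n) set)"
proof -
  have "sphere_tensor = (\<lambda>v::real^'n. tensor v v) ` sphere 0 1"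
    by (auto simp: sphere_tensor_def)
  moreover have "continuous_on UNIV (\<lambda>v::real^'n. tensor v v)"
    unfolding tensor_def by (intro continuous_intros)
  ultimately show ?thesis
    by (metis compact_continuous_image compact_sphere continuous_on_subset subset_UNIV)
qed

lemma tensor_in_K_set: "norm v = 1 \<Longrightarrow> tensor v v \<in> K_set"
proof -
  assume v: "norm v = 1"
  have "w \<bullet> (tensor v v *v w) = (v \<bullet> w)\<^sup>2" for w
    unfolding inner_tensor[symmetric]
    by (simp add: tensor_def inner_vec_def power2_eq_square sum_distrib_left sum_distrib_right mult_ac)
  moreover have "transpose (tensor v v) = tensor v v"
    by (simp add: tensor_def transpose_def vec_eq_iff mult_ac)
  ultimately show ?thesis using v by (simp add: K_set_def sym_matrices_def trace_tensor)
qed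

lemma sphere_tensor_subset_K_set: "sphere_tensor \<subseteq> K_set"
  by (auto simp: sphere_tensor_iff tensor_in_K_set)

text \<open>Dual form of the fact that \<open>K_set\<close> is the convex hull of the tensors: a
  linear function attains its minimum on the compact set of tensors, and no point of
  \<open>K_set\<close> lies below that minimum. With the accumulated error as \<open>X\<close> it
  supplies the greedy choice.\<close>

lemma K_set_exists_sphere_tensor_le:
  assumes "P \<in> K_set"
  shows "\<exists>s\<in>sphere_tensor. X \<bullet> s \<le> X \<bullet> P"
proof -
  have "continuous_on sphere_tensor (\<lambda>s. X \<bullet> s)" by (intro continuous_intros)
  then obtain s where s: "s \<in> sphere_tensor" "\<And>t. t \<in> sphere_tensor \<Longrightarrow> X \<bullet> s \<le> X \<bullet> t"
    using continuous_attains_inf[OF compact_sphere_tensor sphere_tensor_nonempty] by blast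
  have "(X \<bullet> s) * trace P \<le> X \<bullet> P"
    using assms s by (intro psd_inner_ge) (auto simp: K_set_def sym_matrices_def sphere_tensor_iff)
  then show ?thesis using assms s by (auto simp: K_set_def)
qed

text \<open>Taking \<open>- P\<close> for \<open>X\<close> yields a tensor \<open>s\<close> with
  |P|^2 <= P . s <= |P|, because |s| = 1.\<close>

lemma norm_K_set_le: "P \<in> K_set \<Longrightarrow> norm P \<le> 1"
proof -
  assume P: "P \<in> K_set"
  obtain s where s: "s \<in> sphere_tensor" "- P \<bullet> s \<le> - P \<bullet> P"
    using K_set_exists_sphere_tensor_le[OF P, of "- P"] by auto
  then have "norm P * norm P \<le> P \<bullet> s" by (simp add: power2_norm_eq_inner[symmetric] power2_eq_square)
  also have "\<dots> \<le> norm P * norm s" by (rule norm_cauchy_schwarz)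
  finally show ?thesis using norm_sphere_tensor[OF s(1)]
    by (metis mult_le_cancel_left_pos mult.right_neutral norm_le_zero_iff not_le order.trans zero_le_one)
qed

text \<open>Closedness and convexity can be read off from this form, and the same linear conditions
  later serve as weak-star tests that detect values outside \<open>K_set\<close>.\<close>

lemma K_set_eq_halfspaces:
  "(K_set :: (real^'n^'n) set) = {P. transpose P = P} \<inter> (\<Inter>v. {P. 0 \<le> P \<bullet> tensor v v}) \<inter> {P. P \<bullet> mat 1 = 1}"
proof -
  have "P \<bullet> mat 1 = trace P" for P :: "real^'n^'n"
    by (simp add: trace_def inner_vec_def mat_def if_distrib cong: if_cong)
  then have "(K_set :: (real^'n^'n) set) = {P. transpose P = P} \<inter> (\<Inter>v. {P. 0 \<le> P \<bullet> tensor v v}) \<inter> {P. trace P = 1}"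
    "{P :: real^'n^'n. P \<bullet> mat 1 = 1} = {P. trace P = 1}"
    by (auto simp: K_set_def sym_matrices_def inner_tensor)
  then show ?thesis by simp
qed

lemma closed_sym: "closed {P :: real^'n^'n. transpose P = P}"
proof -
  have "continuous_on UNIV (transpose :: real^'n^'n \<Rightarrow> _)"
    unfolding transpose_def by (intro continuous_intros)
  then show ?thesis by (intro closed_Collect_eq) (auto intro: continuous_intros)
qed

lemma closed_K_set: "closed K_set"
  unfolding K_set_eq_halfspaces
  by (intro closed_Int closed_sym closed_INT ballI closed_Collect_le closed_Collect_eq continuous_intros)

lemma convex_K_set: "convex (K_set :: (real^'n^'n) set)"
proof (rule convexI)
  fix P Q :: "real^'n^'n" and u v :: real
  assume *: "P \<in> K_set" "Q \<in> K_set" "0 \<le> u" "0 \<le> v" "u + v = 1"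
  have "transpose (u *\<^sub>R P + v *\<^sub>R Q) = u *\<^sub>R transpose P + v *\<^sub>R transpose Q"
    by (simp add: transpose_def vec_eq_iff)
  then show "u *\<^sub>R P + v *\<^sub>R Q \<in> K_set"
    using * by (auto simp: K_set_eq_halfspaces inner_add_left)
qed

text \<open>The values are chosen greedily: each one has nonpositive inner product with the error made
  so far, relative to \<open>P\<close>.\<close>

lemma exists_balanced_labelling:
  assumes "P \<in> K_set" "finite F"
  shows "\<exists>w. (\<forall>i. w i \<in> sphere_tensor) \<and> (norm ((\<Sum>i\<in>F. w i) - real (card F) *\<^sub>R P))\<^sup>2 \<le> 4 * card F"
  using assms(2)
proof (induction F)
  case empty
  then show ?case using sphere_tensor_nonempty by (auto intro: exI[of _ "\<lambda>_. SOME s. s \<in> sphere_tensor"] some_in_eq[THEN iffD2])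
next
  case (insert a F)
  then obtain w where w: "\<And>i. w i \<in> sphere_tensor"
    "(norm ((\<Sum>i\<in>F. w i) - real (card F) *\<^sub>R P))\<^sup>2 \<le> 4 * card F" by blast
  define X where "X = (\<Sum>i\<in>F. w i) - real (card F) *\<^sub>R P"
  obtain s where s: "s \<in> sphere_tensor" "X \<bullet> s \<le> X \<bullet> P"
    using K_set_exists_sphere_tensor_le[OF assms(1)] by blast
  have "(\<Sum>i\<in>insert a F. (w(a := s)) i) = s + (\<Sum>i\<in>F. w i)"
    using insert by (auto intro!: sum.cong)
  then have eq: "(\<Sum>i\<in>insert a F. (w(a := s)) i) - real (card (insert a F)) *\<^sub>R P = X + (s - P)"
    using insert by (simp add: X_def algebra_simps)
  have "norm (s - P) \<le> 2"
    using norm_triangle_ineq4[of s P] norm_K_set_le[OF assms(1)] norm_sphere_tensor[OF s(1)] by simp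
  then have "(norm (s - P))\<^sup>2 \<le> 2\<^sup>2" by (intro power_mono) auto
  moreover have "(norm (X + (s - P)))\<^sup>2 = (norm X)\<^sup>2 + 2 * (X \<bullet> s - X \<bullet> P) + (norm (s - P))\<^sup>2"
    by (simp add: power2_norm_eq_inner inner_add_left inner_add_right inner_diff_right inner_diff_left
        inner_commute algebra_simps)
  ultimately have "(norm (X + (s - P)))\<^sup>2 \<le> 4 * card (insert a F)"
    using w(2) s(2) insert by (simp add: X_def[symmetric])
  then show ?case using eq w(1) s(1) by (intro exI[of _ "w(a := s)"]) auto
qed

section \<open>Energies on integer cubes\<close>

definition ibox :: "int^'n \<Rightarrow> nat \<Rightarrow> (int^'n) set" where
  "ibox a L = {i. \<forall>j. a $ j \<le> i $ j \<and> i $ j < a $ j + int L}"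

lemma ibox_eq_image: "ibox a L = vec_lambda ` (\<Pi>\<^sub>E j\<in>UNIV. {a $ j..<a $ j + int L})"
proof
  show "ibox a L \<subseteq> vec_lambda ` (\<Pi>\<^sub>E j\<in>UNIV. {a $ j..<a $ j + int L})"
  proof
    fix i assume "i \<in> ibox a L"
    then have "vec_nth i \<in> (\<Pi>\<^sub>E j\<in>UNIV. {a $ j..<a $ j + int L})" "i = vec_lambda (vec_nth i)"
      by (auto simp: ibox_def)
    then show "i \<in> vec_lambda ` (\<Pi>\<^sub>E j\<in>UNIV. {a $ j..<a $ j + int L})" by blast
  qed
  show "vec_lambda ` (\<Pi>\<^sub>E j\<in>UNIV. {a $ j..<a $ j + int L}) \<subseteq> ibox a L"
    by (auto simp: ibox_def Pi_iff)
qed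

lemma finite_ibox [simp]: "finite (ibox a L)"
  unfolding ibox_eq_image by (intro finite_imageI finite_PiE) auto

lemma card_ibox [simp]: "card (ibox (a :: int^'n) L) = L ^ CARD('n)"
proof -
  have "inj_on vec_lambda (\<Pi>\<^sub>E j\<in>UNIV. {a $ j..<a $ j + int L})"
    by (metis inj_onI vec_lambda_inject UNIV_I)
  then show ?thesis
    unfolding ibox_eq_image by (simp add: card_image card_PiE)
qed

definition energy :: "'n interaction \<Rightarrow> (int^'n) set \<Rightarrow> (int^'n \<Rightarrow> real^'n^'n) \<Rightarrow> real" where
  "energy f A u = (\<Sum>\<alpha>\<in>A. \<Sum>\<beta>\<in>A. f (\<beta> - \<alpha>) \<alpha> (u \<alpha>) (u \<beta>))"

lemma energy_cong: "(\<And>i. i \<in> A \<Longrightarrow> u i = v i) \<Longrightarrow> energy f A u = energy f A v"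
  unfolding energy_def by (intro sum.cong) auto

lemma lat_add: "lat (a + b) = lat a + lat b"
  by (simp add: lat_def vec_eq_iff)

lemma inj_lat: "inj lat"
  by (auto simp: inj_def lat_def vec_eq_iff)

text \<open>The substitution of (\<alpha>, \<alpha> + \<xi>) for (\<xi>, \<alpha>) turns the sum
  over all \<xi> into a finite real sum over pairs of points: a \<xi> outside the difference set
  \<open>D\<close> has an empty inner sum, and the value \<infinity> of \<open>f_ext\<close> never
  occurs for tensor-valued \<open>Q\<close>.\<close>

lemma disc_energy_eq_energy:
  fixes f :: "'n::finite interaction"
  assumes fin: "finite (Z_eps \<epsilon> A)" and S: "\<And>i. i \<in> Z_eps \<epsilon> A \<Longrightarrow> Q (\<epsilon> *\<^sub>R lat i) \<in> sphere_tensor"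
  shows "disc_energy f \<epsilon> A Q = ereal (\<epsilon> ^ CARD('n) * energy f (Z_eps \<epsilon> A) (\<lambda>i. Q (\<epsilon> *\<^sub>R lat i)))"
proof -
  let ?Z = "Z_eps \<epsilon> A"
  let ?u = "\<lambda>i. Q (\<epsilon> *\<^sub>R lat i)"
  define D where "D = (\<lambda>(\<alpha>, \<beta>). \<beta> - \<alpha>) ` (?Z \<times> ?Z)"
  have finD: "finite D" using fin by (simp add: D_def)
  have R: "R_eps \<epsilon> \<xi> A = {\<alpha> \<in> ?Z. \<alpha> + \<xi> \<in> ?Z}" for \<xi> by (simp add: R_eps_def)
  have finR: "finite (R_eps \<epsilon> \<xi> A)" for \<xi> using fin by (simp add: R)
  have shift: "\<epsilon> *\<^sub>R lat \<alpha> + \<epsilon> *\<^sub>R lat \<xi> = \<epsilon> *\<^sub>R lat (\<alpha> + \<xi>)" for \<alpha> \<xi> :: "int^'n"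
    by (simp add: lat_add scaleR_add_right)
  have inner: "(\<Sum>\<alpha>\<in>R_eps \<epsilon> \<xi> A. ereal (\<epsilon> ^ CARD('n)) *
       f_ext f \<xi> \<alpha> (Q (\<epsilon> *\<^sub>R lat \<alpha>)) (Q (\<epsilon> *\<^sub>R lat \<alpha> + \<epsilon> *\<^sub>R lat \<xi>))) =
     ereal (\<Sum>\<alpha>\<in>R_eps \<epsilon> \<xi> A. \<epsilon> ^ CARD('n) * f \<xi> \<alpha> (?u \<alpha>) (?u (\<alpha> + \<xi>)))" for \<xi>
    unfolding shift sum_ereal[symmetric]
    by (intro sum.cong) (auto simp: f_ext_def R S)
  have zero: "R_eps \<epsilon> \<xi> A = {}" if "\<xi> \<notin> D" for \<xi>
  proof (rule ccontr)
    assume "R_eps \<epsilon> \<xi> A \<noteq> {}"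
    then obtain \<alpha> where "\<alpha> \<in> ?Z" "\<alpha> + \<xi> \<in> ?Z" by (auto simp: R)
    then have "(\<lambda>(\<alpha>, \<beta>). \<beta> - \<alpha>) (\<alpha>, \<alpha> + \<xi>) \<in> D" unfolding D_def by blast
    then show False using that by simp
  qed
  have "disc_energy f \<epsilon> A Q =
      (\<Sum>\<^sub>\<infinity>\<xi>\<in>UNIV. ereal (\<Sum>\<alpha>\<in>R_eps \<epsilon> \<xi> A. \<epsilon> ^ CARD('n) * f \<xi> \<alpha> (?u \<alpha>) (?u (\<alpha> + \<xi>))))"
    unfolding disc_energy_def inner ..
  also have "\<dots> = (\<Sum>\<^sub>\<infinity>\<xi>\<in>D. ereal (\<Sum>\<alpha>\<in>R_eps \<epsilon> \<xi> A. \<epsilon> ^ CARD('n) * f \<xi> \<alpha> (?u \<alpha>) (?u (\<alpha> + \<xi>))))"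
    by (rule infsum_cong_neutral) (auto simp: zero)
  also have "\<dots> = ereal (\<Sum>\<xi>\<in>D. \<Sum>\<alpha>\<in>R_eps \<epsilon> \<xi> A. \<epsilon> ^ CARD('n) * f \<xi> \<alpha> (?u \<alpha>) (?u (\<alpha> + \<xi>)))"
    using finD by simp
  also have "(\<Sum>\<xi>\<in>D. \<Sum>\<alpha>\<in>R_eps \<epsilon> \<xi> A. \<epsilon> ^ CARD('n) * f \<xi> \<alpha> (?u \<alpha>) (?u (\<alpha> + \<xi>))) =
     (\<Sum>(\<xi>, \<alpha>)\<in>(SIGMA \<xi>:D. R_eps \<epsilon> \<xi> A). \<epsilon> ^ CARD('n) * f \<xi> \<alpha> (?u \<alpha>) (?u (\<alpha> + \<xi>)))"
    using finD finR by (simp add: sum.Sigma)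
  also have "\<dots> = (\<Sum>(\<alpha>, \<beta>)\<in>?Z \<times> ?Z. \<epsilon> ^ CARD('n) * f (\<beta> - \<alpha>) \<alpha> (?u \<alpha>) (?u \<beta>))"
  proof (rule sum.reindex_bij_witness[where i="\<lambda>(\<alpha>, \<beta>). (\<beta> - \<alpha>, \<alpha>)" and j="\<lambda>(\<xi>, \<alpha>). (\<alpha>, \<alpha> + \<xi>)"])
    fix b assume b: "b \<in> ?Z \<times> ?Z"
    have "(\<lambda>(\<alpha>, \<beta>). \<beta> - \<alpha>) b \<in> D" unfolding D_def using b by (rule imageI)
    then show "(\<lambda>(\<alpha>, \<beta>). (\<beta> - \<alpha>, \<alpha>)) b \<in> (SIGMA \<xi>:D. R_eps \<epsilon> \<xi> A)"
      using b by (auto simp: R split: prod.splits)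
  qed (auto simp: R)
  also have "\<dots> = \<epsilon> ^ CARD('n) * energy f ?Z ?u"
    using fin by (simp add: energy_def sum.cartesian_product sum_distrib_left case_prod_unfold)
  finally show ?thesis .
qed

section \<open>Consequences of summability and periodicity\<close>

locale periodic_interaction =
  fixes f :: "'a::finite interaction" and k :: nat and C :: "int^'a \<Rightarrow> real"
  assumes k_pos: "k \<ge> 1"
    and periodic: "\<And>\<xi> \<alpha> j Q1 Q2. Q1 \<in> sphere_tensor \<Longrightarrow> Q2 \<in> sphere_tensor \<Longrightarrow>
           f \<xi> (\<alpha> + axis j (int k)) Q1 Q2 = f \<xi> \<alpha> Q1 Q2"
    and C_nonneg: "\<And>\<xi>. C \<xi> \<ge> 0"
    and f_le: "\<And>\<xi> \<alpha> Q1 Q2. Q1 \<in> sphere_tensor \<Longrightarrow> Q2 \<in> sphere_tensor \<Longrightarrow> \<bar>f \<xi> \<alpha> Q1 Q2\<bar> \<le> C \<xi>"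
    and C_summable: "C summable_on UNIV"
begin

text \<open>The summand 1 keeps \<open>M\<close> positive, so that tolerances such as
  \<open>\<delta> / (2 * M)\<close> make sense even if all \<open>C \<xi>\<close> vanish.\<close>

definition M :: real where "M = 1 + infsum C UNIV"

lemma M_pos: "M > 0"
  unfolding M_def using infsum_nonneg[of UNIV C] C_nonneg by (smt (verit))

lemma sum_C_le: "finite X \<Longrightarrow> sum C X \<le> M"
  unfolding M_def using finite_sum_le_infsum[OF C_summable, of X] C_nonneg by auto

lemma sum_C_diff_le: "finite X \<Longrightarrow> (\<Sum>\<beta>\<in>X. C (\<beta> - \<alpha>)) \<le> M" "finite X \<Longrightarrow> (\<Sum>\<alpha>\<in>X. C (\<beta> - \<alpha>)) \<le> M"
proof -
  assume X: "finite X"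
  have "(\<Sum>\<beta>\<in>X. C (\<beta> - \<alpha>)) = sum C ((\<lambda>\<beta>. \<beta> - \<alpha>) ` X)"
    by (subst sum.reindex) (auto simp: inj_on_def)
  then show "(\<Sum>\<beta>\<in>X. C (\<beta> - \<alpha>)) \<le> M" using sum_C_le X by simp
  have "(\<Sum>\<alpha>\<in>X. C (\<beta> - \<alpha>)) = sum C ((\<lambda>\<alpha>. \<beta> - \<alpha>) ` X)"
    by (subst sum.reindex) (auto simp: inj_on_def)
  then show "(\<Sum>\<alpha>\<in>X. C (\<beta> - \<alpha>)) \<le> M" using sum_C_le X by simp
qed

lemma abs_energy_le:
  assumes "finite A" "\<And>i. i \<in> A \<Longrightarrow> u i \<in> sphere_tensor"
  shows "\<bar>energy f A u\<bar> \<le> M * card A"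
proof -
  have "\<bar>energy f A u\<bar> \<le> (\<Sum>\<alpha>\<in>A. \<Sum>\<beta>\<in>A. C (\<beta> - \<alpha>))"
    unfolding energy_def
    by (intro order.trans[OF sum_abs] sum_mono f_le assms)
  also have "\<dots> \<le> (\<Sum>\<alpha>\<in>A. M)"
    by (intro sum_mono sum_C_diff_le assms)
  finally show ?thesis by (simp add: mult.commute)
qed

text \<open>Natural multiples of a single axis come by induction, a negative multiple is undone by a
  natural one, and a general shift is the sum of its axis components.\<close>

lemma periodic_shift:
  assumes "Q1 \<in> sphere_tensor" "Q2 \<in> sphere_tensor"
  shows "f \<xi> (\<alpha> + (\<chi> j. int k * z $ j)) Q1 Q2 = f \<xi> \<alpha> Q1 Q2"
proof -
  have nat: "f \<xi> (\<alpha> + axis j (int k * int m)) Q1 Q2 = f \<xi> \<alpha> Q1 Q2" for j m \<alpha>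
  proof (induction m)
    case 0
    have "axis j (int k * int 0) = 0" by (simp add: axis_def vec_eq_iff)
    then show ?case by (metis add_0_right)
  next
    case (Suc m)
    have "\<alpha> + axis j (int k * int (Suc m)) = (\<alpha> + axis j (int k * int m)) + axis j (int k)"
      by (simp add: axis_def vec_eq_iff algebra_simps)
    then show ?case using Suc periodic[OF assms] by metis
  qed
  have int: "f \<xi> (\<alpha> + axis j (int k * x)) Q1 Q2 = f \<xi> \<alpha> Q1 Q2" for j x \<alpha>
  proof (cases "x \<ge> 0")
    case True
    then show ?thesis using nat[of \<alpha> j "nat x"] by simp
  next
    case False
    have "\<alpha> = (\<alpha> + axis j (int k * x)) + axis j (int k * int (nat (- x)))"
      using False by (simp add: axis_def vec_eq_iff)
    then show ?thesis using nat by metis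
  qed
  have "f \<xi> (\<alpha> + (\<Sum>j\<in>J. axis j (int k * z $ j))) Q1 Q2 = f \<xi> \<alpha> Q1 Q2" for J
    using finite[of J]
  proof (induction J)
    case (insert j J)
    then have "\<alpha> + (\<Sum>j\<in>insert j J. axis j (int k * z $ j)) =
       (\<alpha> + (\<Sum>j\<in>J. axis j (int k * z $ j))) + axis j (int k * z $ j)"
      by (simp add: add_ac)
    then show ?case using int insert.IH by metis
  qed simp
  moreover have "(\<Sum>j\<in>UNIV. axis j (int k * z $ j)) = (\<chi> j. int k * z $ j)"
    by (simp add: vec_eq_iff axis_def if_distrib cong: if_cong)
  ultimately show ?thesis by metis
qed

lemma energy_shift:
  assumes u: "\<And>i. i \<in> A \<Longrightarrow> u i \<in> sphere_tensor"
    and vu: "\<And>i. i \<in> A \<Longrightarrow> v (i + (\<chi> j. int k * z $ j)) = u i"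
  shows "energy f ((\<lambda>i. i + (\<chi> j. int k * z $ j)) ` A) v = energy f A u"
proof -
  let ?s = "\<lambda>i. i + (\<chi> j. int k * z $ j)"
  have inj: "inj_on ?s A" by (auto simp: inj_on_def)
  have "energy f (?s ` A) v = (\<Sum>\<alpha>\<in>A. \<Sum>\<beta>\<in>A. f (?s \<beta> - ?s \<alpha>) (?s \<alpha>) (v (?s \<alpha>)) (v (?s \<beta>)))"
    unfolding energy_def by (simp add: sum.reindex[OF inj])
  also have "\<dots> = energy f A u"
    unfolding energy_def by (intro sum.cong refl) (simp add: vu u periodic_shift)
  finally show ?thesis .
qed

lemma one_minus_power_tendsto: "(\<lambda>L. (1 - c / real L) ^ m) \<longlonglongrightarrow> 1"
proof -
  have "(\<lambda>L. (1 - c / real L) ^ m) \<longlonglongrightarrow> (1 - 0) ^ m"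
    by (intro tendsto_intros tendsto_divide_0[OF tendsto_const] filterlim_at_top_imp_at_infinity
        filterlim_real_sequentially)
  then show ?thesis by simp
qed

text \<open>Only a layer along the faces interacts noticeably with the outside. A finite set
  \<open>X\<close> of differences carries all of \<open>C\<close> but \<open>\<delta> / 2\<close>;
  if \<open>R\<close> bounds the entries of its elements, then a point of depth \<open>R\<close>
  reaches the outside only through the tail, and the remaining layer has volume of lower order than
  \<open>L ^ CARD('a)\<close>.\<close>

lemma ibox_boundary_sum_le:
  assumes "\<delta> > 0"
  shows "\<exists>L0. \<forall>L\<ge>L0. \<forall>a B. finite B \<longrightarrow> B \<inter> ibox a L = {} \<longrightarrow>
    (\<Sum>\<alpha>\<in>ibox a L. \<Sum>\<beta>\<in>B. C (\<beta> - \<alpha>)) \<le> \<delta> * real L ^ CARD('a)"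
proof -
  have "(C has_sum infsum C UNIV) UNIV" using C_summable by simp
  then have "\<forall>\<^sub>F X in finite_subsets_at_top UNIV. infsum C UNIV - \<delta> / 2 < sum C X"
    unfolding has_sum_def using assms by (intro order_tendstoD(1)) auto
  then obtain X where X: "finite X" "infsum C UNIV - \<delta> / 2 < sum C X"
    unfolding eventually_finite_subsets_at_top by auto
  have tail: "sum C Y \<le> \<delta> / 2" if "finite Y" "Y \<inter> X = {}" for Y
  proof -
    have "sum C (X \<union> Y) \<le> infsum C UNIV"
      using finite_sum_le_infsum[OF C_summable, of "X \<union> Y"] that X C_nonneg by auto
    then show ?thesis using sum.union_disjoint[of X Y C] that X by (auto simp: Int_commute)
  qed
  have "finite (\<Union>\<xi>\<in>X. range (\<lambda>j. \<bar>\<xi> $ j\<bar>))" using X(1) by auto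
  then obtain r where r: "\<And>\<xi> j. \<xi> \<in> X \<Longrightarrow> \<bar>\<xi> $ j\<bar> \<le> r"
    using bdd_above_finite unfolding bdd_above_def by (metis (no_types, lifting) UN_I rangeI)
  define R where "R = nat r"
  have R: "\<bar>\<xi> $ j\<bar> \<le> int R" if "\<xi> \<in> X" for \<xi> j using r[OF that] unfolding R_def by (smt (verit) nat_0_le)
  \<comment> \<open>From here on the layer of thickness \<open>R\<close> takes up at most the
    fraction \<open>\<delta> / (2 * M)\<close> of the cube. Each of its points costs at most
    \<open>M\<close>, so the layer uses up the other half of \<delta>.\<close>
  have "\<forall>\<^sub>F L in sequentially. 1 - \<delta> / (2 * M) < (1 - (2 * real R) / real L) ^ CARD('a)"
    using M_pos assms by (intro order_tendstoD(1)[OF one_minus_power_tendsto]) simp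
  then obtain L1 where L1: "\<And>L. L \<ge> L1 \<Longrightarrow> 1 - \<delta> / (2 * M) < (1 - (2 * real R) / real L) ^ CARD('a)"
    by (auto simp: eventually_sequentially)
  show ?thesis
  proof (intro exI[of _ "max L1 (2 * R + 1)"] allI impI)
    fix L and a :: "int^'a" and B assume L: "max L1 (2 * R + 1) \<le> L" and B: "finite B" "B \<inter> ibox a L = {}"
    define I where "I = ibox (a + (\<chi> j. int R)) (L - 2 * R)"
    have "a $ j \<le> i $ j \<and> i $ j < a $ j + int L" if "i \<in> I" for i j
      using that L by (auto simp: I_def ibox_def of_nat_diff dest!: spec[of _ j])
    then have Isub: "I \<subseteq> ibox a L" by (auto simp: ibox_def)
    have IL: "real (card I) = real L ^ CARD('a) * (1 - (2 * real R) / real L) ^ CARD('a)"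
      using L by (simp add: I_def of_nat_diff power_mult_distrib[symmetric] algebra_simps)
    have int: "(\<Sum>\<beta>\<in>B. C (\<beta> - \<alpha>)) \<le> \<delta> / 2" if "\<alpha> \<in> I" for \<alpha>
    proof -
      have "\<beta> - \<alpha> \<notin> X" if "\<beta> \<in> B" for \<beta>
      proof
        assume "\<beta> - \<alpha> \<in> X"
        then have "\<bar>\<beta> $ j - \<alpha> $ j\<bar> \<le> int R" for j using R[of "\<beta> - \<alpha>" j] by simp
        moreover have "a $ j + int R \<le> \<alpha> $ j \<and> \<alpha> $ j < a $ j + int R + int (L - 2 * R)" for j
          using \<open>\<alpha> \<in> I\<close> by (auto simp: I_def ibox_def)
        ultimately have "a $ j \<le> \<beta> $ j \<and> \<beta> $ j < a $ j + int L" for j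
          using L by (simp add: of_nat_diff) (smt (verit))
        then have "\<beta> \<in> ibox a L" by (simp add: ibox_def)
        then show False using that B by blast
      qed
      then have "sum C ((\<lambda>\<beta>. \<beta> - \<alpha>) ` B) \<le> \<delta> / 2" using B(1) by (intro tail) auto
      then show ?thesis by (subst (asm) sum.reindex) (auto simp: inj_on_def)
    qed
    have "(\<Sum>\<alpha>\<in>ibox a L. \<Sum>\<beta>\<in>B. C (\<beta> - \<alpha>)) =
        (\<Sum>\<alpha>\<in>ibox a L - I. \<Sum>\<beta>\<in>B. C (\<beta> - \<alpha>)) + (\<Sum>\<alpha>\<in>I. \<Sum>\<beta>\<in>B. C (\<beta> - \<alpha>))"
      by (rule sum.subset_diff[OF Isub]) simp
    also have "\<dots> \<le> (\<Sum>\<alpha>\<in>ibox a L - I. M) + (\<Sum>\<alpha>\<in>I. \<delta> / 2)"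
      by (intro add_mono sum_mono sum_C_diff_le B int)
    also have "\<dots> = M * (real L ^ CARD('a) - real (card I)) + \<delta> / 2 * real (card I)"
      using Isub card_mono[OF finite_ibox Isub] finite_subset[OF Isub finite_ibox]
      by (simp add: card_Diff_subset of_nat_diff)
    also have "\<dots> \<le> M * (real L ^ CARD('a) - real (card I)) + \<delta> / 2 * real L ^ CARD('a)"
      using card_mono[OF finite_ibox Isub] assms
      by (intro add_left_mono mult_left_mono) (auto simp flip: of_nat_power)
    also have "real L ^ CARD('a) - real (card I) \<le> real L ^ CARD('a) * (\<delta> / (2 * M))"
    proof -
      have "real L ^ CARD('a) - real (card I) = real L ^ CARD('a) * (1 - (1 - (2 * real R) / real L) ^ CARD('a))"
        unfolding IL by (simp add: algebra_simps)
      also have "\<dots> \<le> real L ^ CARD('a) * (\<delta> / (2 * M))"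
        using L1[of L] L by (intro mult_left_mono) auto
      finally show ?thesis .
    qed
    then have "M * (real L ^ CARD('a) - real (card I)) + \<delta> / 2 * real L ^ CARD('a) \<le> \<delta> * real L ^ CARD('a)"
      using M_pos by (simp add: field_simps)
    finally show "(\<Sum>\<alpha>\<in>ibox a L. \<Sum>\<beta>\<in>B. C (\<beta> - \<alpha>)) \<le> \<delta> * real L ^ CARD('a)" using M_pos by simp
  qed
qed

text \<open>The threshold depends on \<delta> alone, not on \<open>A\<close>, on the number or
  position of the boxes, or on \<open>u\<close>; the same estimate can therefore serve the tiling of
  a large cube and the grid decomposition of the domain.\<close>

lemma energy_decomposition:
  assumes "\<delta> > 0"
  shows "\<exists>L0. \<forall>L\<ge>L0. \<forall>A (T :: 't set) a u. finite A \<longrightarrow> finite T \<longrightarrow> (\<forall>t\<in>T. ibox (a t) L \<subseteq> A) \<longrightarrow>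
    disjoint_family_on (\<lambda>t. ibox (a t) L) T \<longrightarrow> (\<forall>i\<in>A. u i \<in> sphere_tensor) \<longrightarrow>
    \<bar>energy f A u - (\<Sum>t\<in>T. energy f (ibox (a t) L) u)\<bar> \<le>
      2 * M * (real (card A) - real (card T) * real L ^ CARD('a)) + \<delta> * real (card T) * real L ^ CARD('a)"
proof -
  from ibox_boundary_sum_le[OF assms] obtain L0 where
    "\<forall>L\<ge>L0. \<forall>a B. finite B \<longrightarrow> B \<inter> ibox a L = {} \<longrightarrow>
      (\<Sum>\<alpha>\<in>ibox a L. \<Sum>\<beta>\<in>B. C (\<beta> - \<alpha>)) \<le> \<delta> * real L ^ CARD('a)" ..
  note L0 = this[rule_format]
  show ?thesis
  proof (intro exI[of _ L0] allI impI)
    fix L A and T :: "'t set" and a :: "'t \<Rightarrow> int^'a" and u :: "int^'a \<Rightarrow> real^'a^'a"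
    assume L: "L0 \<le> L" and A: "finite A" and T: "finite T" and sub: "\<forall>t\<in>T. ibox (a t) L \<subseteq> A"
      and disj: "disjoint_family_on (\<lambda>t. ibox (a t) L) T" and u: "\<forall>i\<in>A. u i \<in> sphere_tensor"
    define B where "B t = ibox (a t) L" for t
    define F where "F = A - (\<Union>t\<in>T. B t)"
    define g where "g p = f (snd p - fst p) (fst p) (u (fst p)) (u (snd p))" for p
    define c where "c p = C (snd p - fst p)" for p :: "(int^'a) \<times> (int^'a)"
    have finB: "finite (B t)" for t by (simp add: B_def)
    have disjB: "B t \<inter> B s = {}" if "t \<in> T" "s \<in> T" "t \<noteq> s" for t s
      using disj that by (auto simp: disjoint_family_on_def B_def)
    have UB: "(\<Union>t\<in>T. B t) \<subseteq> A" using sub by (auto simp: B_def)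
    have cardU: "card (\<Union>t\<in>T. B t) = card T * L ^ CARD('a)"
    proof -
      have "card (\<Union>t\<in>T. B t) = (\<Sum>t\<in>T. card (B t))"
        using T finB disjB by (intro card_UN_disjoint) auto
      then show ?thesis by (simp add: B_def)
    qed
    have cardF: "real (card F) = real (card A) - real (card T) * real L ^ CARD('a)"
      unfolding F_def using card_Diff_subset[OF _ UB] card_mono[OF A UB] cardU finite_subset[OF UB A]
      by (simp add: of_nat_diff)
    have E: "energy f X u = sum g (X \<times> X)" for X
      by (simp add: energy_def sum.cartesian_product g_def case_prod_unfold)
    define D where "D = (\<Union>t\<in>T. B t \<times> B t)"
    have Dsub: "D \<subseteq> A \<times> A" using UB by (auto simp: D_def)
    have "sum g D = (\<Sum>t\<in>T. energy f (B t) u)"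
      unfolding D_def E using T finB disjB by (intro sum.UNION_disjoint) (auto simp: Times_Int_Times)
    moreover have "energy f A u = sum g (A \<times> A - D) + sum g D"
      unfolding E using sum.subset_diff[OF Dsub, of g] A by blast
    ultimately have "\<bar>energy f A u - (\<Sum>t\<in>T. energy f (B t) u)\<bar> = \<bar>sum g (A \<times> A - D)\<bar>"
      by simp
    also have "\<bar>sum g (A \<times> A - D)\<bar> \<le> sum c (A \<times> A - D)"
    proof (rule order.trans[OF sum_abs], rule sum_mono)
      fix p assume "p \<in> A \<times> A - D"
      then show "\<bar>g p\<bar> \<le> c p" unfolding g_def c_def using u by (intro f_le) auto
    qed
    \<comment> \<open>A pair outside the diagonal blocks either has an endpoint in the uncovered set
      \<open>F\<close>, or starts in some block and ends outside that block. The first kind costs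
      \<open>M\<close> per point of \<open>F\<close> and per order of the pair, the second is the
      boundary sum of the block.\<close>
    also have "\<dots> \<le> sum c ((F \<times> A) \<union> (A \<times> F) \<union> (\<Union>t\<in>T. B t \<times> (A - B t)))"
    proof (rule sum_mono2)
      show "A \<times> A - D \<subseteq> (F \<times> A) \<union> (A \<times> F) \<union> (\<Union>t\<in>T. B t \<times> (A - B t))"
        unfolding F_def D_def by blast
      show "finite ((F \<times> A) \<union> (A \<times> F) \<union> (\<Union>t\<in>T. B t \<times> (A - B t)))"
        using A T finB by (auto simp: F_def)
    qed (simp add: c_def C_nonneg)
    also have "\<dots> \<le> sum c (F \<times> A) + sum c (A \<times> F) + sum c (\<Union>t\<in>T. B t \<times> (A - B t))"
    proof -
      have un: "sum c (X \<union> Y) \<le> sum c X + sum c Y" if "finite X" "finite Y" for X Y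
        using sum.union_inter[OF that, of c] sum_nonneg[of "X \<inter> Y" c] by (auto simp: c_def C_nonneg)
      have fin: "finite (F \<times> A)" "finite (A \<times> F)" "finite (\<Union>t\<in>T. B t \<times> (A - B t))"
        using A T finB by (auto simp: F_def)
      show ?thesis
        using un[OF fin(1,2)] un[OF finite_UnI[OF fin(1,2)] fin(3)] by linarith
    qed
    also have "sum c (F \<times> A) \<le> real (card F) * M"
    proof -
      have "sum c (F \<times> A) = (\<Sum>\<alpha>\<in>F. \<Sum>\<beta>\<in>A. C (\<beta> - \<alpha>))"
        by (simp add: sum.cartesian_product c_def case_prod_unfold)
      also have "\<dots> \<le> (\<Sum>\<alpha>\<in>F. M)" by (intro sum_mono sum_C_diff_le A)
      finally show ?thesis by simp
    qed
    also have "sum c (A \<times> F) \<le> real (card F) * M"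
    proof -
      have "sum c (A \<times> F) = (\<Sum>\<alpha>\<in>A. \<Sum>\<beta>\<in>F. C (\<beta> - \<alpha>))"
        by (simp add: sum.cartesian_product c_def case_prod_unfold)
      also have "\<dots> = (\<Sum>\<beta>\<in>F. \<Sum>\<alpha>\<in>A. C (\<beta> - \<alpha>))" by (rule sum.swap)
      also have "\<dots> \<le> (\<Sum>\<alpha>\<in>F. M)" by (intro sum_mono sum_C_diff_le A)
      finally show ?thesis by simp
    qed
    also have "sum c (\<Union>t\<in>T. B t \<times> (A - B t)) \<le> real (card T) * (\<delta> * real L ^ CARD('a))"
    proof -
      have "sum c (\<Union>t\<in>T. B t \<times> (A - B t)) = (\<Sum>t\<in>T. sum c (B t \<times> (A - B t)))"
        using T A finB disjB by (intro sum.UNION_disjoint) (auto simp: Times_Int_Times)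
      also have "\<dots> = (\<Sum>t\<in>T. \<Sum>\<alpha>\<in>B t. \<Sum>\<beta>\<in>A - B t. C (\<beta> - \<alpha>))"
        by (simp add: sum.cartesian_product c_def case_prod_unfold)
      also have "\<dots> \<le> (\<Sum>t\<in>T. \<delta> * real L ^ CARD('a))"
        unfolding B_def using A by (intro sum_mono L0[OF L]) auto
      finally show ?thesis by simp
    qed
    finally show "\<bar>energy f A u - (\<Sum>t\<in>T. energy f (ibox (a t) L) u)\<bar> \<le>
      2 * M * (real (card A) - real (card T) * real L ^ CARD('a)) + \<delta> * real (card T) * real L ^ CARD('a)"
      unfolding cardF B_def by (simp add: algebra_simps)
  qed
qed

end

section \<open>The tiling inequality\<close>

text \<open>The constraint that the average lies in the closed ball of radius \<rho> around
  \<open>P\<close>, multiplied by the number of points. In this form the errors of disjoint pieces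
  simply add up, which replaces an argument with convex combinations.\<close>

definition admissible :: "real^'n^'n \<Rightarrow> real \<Rightarrow> (int^'n) set \<Rightarrow> (int^'n \<Rightarrow> real^'n^'n) \<Rightarrow> bool" where
  "admissible P \<rho> A v \<longleftrightarrow> (\<forall>i\<in>A. v i \<in> sphere_tensor) \<and>
     norm ((\<Sum>i\<in>A. v i) - real (card A) *\<^sub>R P) \<le> \<rho> * card A"

lemma admissible_mono:
  assumes "admissible P \<rho> A v" "\<rho> + norm (P - P') \<le> \<rho>'"
  shows "admissible P' \<rho>' A v"
proof -
  have "norm ((\<Sum>i\<in>A. v i) - real (card A) *\<^sub>R P') =
      norm (((\<Sum>i\<in>A. v i) - real (card A) *\<^sub>R P) + real (card A) *\<^sub>R (P - P'))"
    by (simp add: algebra_simps)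
  also have "\<dots> \<le> \<rho> * card A + real (card A) * norm (P - P')"
    using assms(1) by (intro norm_triangle_le) (auto simp: admissible_def)
  also have "\<dots> = (\<rho> + norm (P - P')) * card A" by (simp add: algebra_simps)
  also have "\<dots> \<le> \<rho>' * card A" using assms(2) by (intro mult_right_mono) auto
  finally show ?thesis using assms(1) by (simp add: admissible_def)
qed

text \<open>The greedy labelling of n points misses n P by at most 2 sqrt n, and this is at most
  \<rho> n as soon as n >= 4 / \<rho>^2. All later occurrences of \<open>4 / \<rho>\<^sup>2\<close>
  go back to this threshold.\<close>

lemma exists_admissible:
  fixes P :: "real^'n^'n"
  assumes P: "P \<in> K_set" and \<rho>: "\<rho> > 0" and A: "finite A" "4 / \<rho>\<^sup>2 \<le> real (card A)"
  shows "\<exists>v. (\<forall>i. v i \<in> sphere_tensor) \<and> admissible P \<rho> A v"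
proof -
  obtain v where v: "\<And>i. v i \<in> sphere_tensor"
    "(norm ((\<Sum>i\<in>A. v i) - real (card A) *\<^sub>R P))\<^sup>2 \<le> 4 * card A"
    using exists_balanced_labelling[OF P A(1)] by blast
  have "4 * real (card A) \<le> (\<rho> * card A)\<^sup>2"
  proof -
    have "4 \<le> \<rho>\<^sup>2 * real (card A)" using A(2) \<rho> by (simp add: field_simps)
    then have "4 * real (card A) \<le> (\<rho>\<^sup>2 * real (card A)) * real (card A)"
      by (intro mult_right_mono) auto
    then show ?thesis by (simp add: power2_eq_square mult_ac)
  qed
  then have "norm ((\<Sum>i\<in>A. v i) - real (card A) *\<^sub>R P) \<le> \<rho> * card A"
    using \<rho> by (intro power2_le_imp_le[OF order.trans[OF v(2)]]) simp_all
  then show ?thesis using v(1) by (auto simp: admissible_def)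
qed

text \<open>A substitute for the subadditive limit lemma. Let l be a cluster point. A late term of
  the subsequence is close to l and almost dominates all terms far beyond it; conversely every late
  term almost dominates the terms of the subsequence far beyond it, which are close to l.\<close>

lemma almost_decreasing_convergent:
  fixes x :: "nat \<Rightarrow> real"
  assumes bdd: "\<And>n. n \<ge> n1 \<Longrightarrow> \<bar>x n\<bar> \<le> B"
    and dec: "\<And>\<delta>. \<delta> > 0 \<Longrightarrow> \<exists>L0. \<forall>L\<ge>L0. \<exists>n0. \<forall>n\<ge>n0. x n \<le> x L + \<delta>"
  shows "convergent x"
proof -
  have "bounded (range (\<lambda>n. x (n + n1)))"
    using bdd by (intro boundedI[of _ B]) auto
  then obtain l r where r: "strict_mono r" "((\<lambda>n. x (n + n1)) \<circ> r) \<longlonglongrightarrow> l"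
    using bounded_imp_convergent_subsequence by metis
  define s where "s j = r j + n1" for j
  have s: "j \<le> s j" for j using r(1) by (simp add: s_def strict_mono_imp_increasing trans_le_add1)
  have lim: "(\<lambda>j. x (s j)) \<longlonglongrightarrow> l" using r(2) by (simp add: o_def s_def)
  have "x \<longlonglongrightarrow> l"
  proof (rule LIMSEQ_I)
    fix e :: real assume e: "e > 0"
    obtain L0 where L0: "\<forall>L\<ge>L0. \<exists>n0. \<forall>n\<ge>n0. x n \<le> x L + e / 3"
      using dec[of "e / 3"] e by auto
    obtain j0 where j0: "\<And>j. j \<ge> j0 \<Longrightarrow> norm (x (s j) - l) < e / 3"
      using LIMSEQ_D[OF lim, of "e / 3"] e by auto
    have "s (max j0 L0) \<ge> L0" using s[of "max j0 L0"] by simp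
    then obtain n0 where n0: "\<And>n. n \<ge> n0 \<Longrightarrow> x n \<le> x (s (max j0 L0)) + e / 3"
      using L0 by blast
    show "\<exists>n0. \<forall>n\<ge>n0. norm (x n - l) < e"
    proof (intro exI[of _ "max n0 L0"] allI impI)
      fix n assume n: "max n0 L0 \<le> n"
      obtain n2 where n2: "\<And>m. m \<ge> n2 \<Longrightarrow> x m \<le> x n + e / 3" using L0 n by auto
      have "x (s (max j0 n2)) \<le> x n + e / 3" using s[of "max j0 n2"] by (intro n2) simp
      moreover have "x n \<le> x (s (max j0 L0)) + e / 3" using n by (intro n0) simp
      moreover note j0[of "max j0 n2"] j0[of "max j0 L0"]
      ultimately show "norm (x n - l) < e" by (auto simp: abs_if split: if_splits)
    qed
  qed
  then show ?thesis by (auto simp: convergent_def)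
qed

text \<open>Here \<open>p\<close> is the period of the tiling and \<open>L\<close> the side of a
  tile. The tiles sit at prescribed residues modulo \<open>p\<close>, so one of the
  \<open>n div p\<close> periods may be lost in every direction; hence the \<open>- 1\<close>, which
  does not affect the limit.\<close>

lemma tile_fraction_tendsto:
  fixes p L :: nat
  assumes "p > 0"
  shows "(\<lambda>n. (real (n div p - 1) * L / real n) ^ m) \<longlonglongrightarrow> (L / p) ^ m"
proof (rule tendsto_power)
  have lim1: "(\<lambda>n. L / p - (2 * L) / real n) \<longlonglongrightarrow> L / p - 0"
    by (intro tendsto_intros tendsto_divide_0[OF tendsto_const] filterlim_at_top_imp_at_infinity
        filterlim_real_sequentially)
  show "(\<lambda>n. real (n div p - 1) * L / real n) \<longlonglongrightarrow> L / p"
  proof (rule tendsto_sandwich)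
    show "\<forall>\<^sub>F n in sequentially. L / p - (2 * L) / real n \<le> real (n div p - 1) * L / real n"
      using eventually_gt_at_top[of 0]
    proof eventually_elim
      case (elim n)
      have "n < p + p * (n div p)" using dividend_less_times_div[OF assms] .
      then have "real n < p * (real (n div p) + 1)"
        by (metis add.commute distrib_left mult.right_neutral of_nat_1 of_nat_add of_nat_less_iff of_nat_mult)
      then have "real n / p < real (n div p) + 1" using assms by (simp add: field_simps)
      then have "real n / p - 2 \<le> real (n div p - 1)" by linarith
      then have "(real n / p - 2) * L / real n \<le> real (n div p - 1) * L / real n"
        by (intro divide_right_mono mult_right_mono) auto
      then show ?case using elim by (simp add: field_simps)
    qed
    show "\<forall>\<^sub>F n in sequentially. real (n div p - 1) * L / real n \<le> L / p"
      using eventually_gt_at_top[of 0]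
    proof eventually_elim
      case (elim n)
      have "real (n div p - 1) \<le> real (n div p)" by simp
      also have "\<dots> \<le> real n / p" by (rule of_nat_div_le_of_nat)
      finally have "real (n div p - 1) * L / real n \<le> (real n / p) * L / real n"
        by (intro divide_right_mono mult_right_mono) auto
      then show ?case using elim by simp
    qed
  qed (use lim1 in auto)
qed

context periodic_interaction
begin

text \<open>The threshold \<open>n0\<close> is uniform in the positions \<open>a\<close> and
  \<open>b\<close> and in \<open>v\<close>; so one good tile serves all cubes of a given large side.
  The energy density of the tile is almost kept because the free points make up at most the fraction
  \<eta> of the cube.\<close>

lemma tiling:
  assumes P: "P \<in> K_set" and \<rho>: "\<rho> > 0" and \<delta>: "\<delta> > 0"
  shows "\<exists>L0. \<forall>L\<ge>L0. \<exists>n0. \<forall>n\<ge>n0. \<forall>a v b. admissible P \<rho> (ibox a L) v \<longrightarrow>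
    (\<exists>u. admissible P \<rho> (ibox b n) u \<and>
      energy f (ibox b n) u \<le> real n ^ CARD('a) * (energy f (ibox a L) v / real L ^ CARD('a) + \<delta>))"
proof -
  let ?N = "CARD('a)"
  \<comment> \<open>Every free point costs \<open>3 * M\<close> in the end: \<open>2 * M\<close>
    from the energy decomposition, and \<open>M\<close> because the tiles carry only part of the
    density of the full cube. This choice makes the total \<open>\<delta> / 2\<close>.\<close>
  define \<eta> where "\<eta> = \<delta> / (6 * M)"
  have \<eta>: "\<eta> > 0" using \<delta> M_pos by (simp add: \<eta>_def)
  have "\<delta> / 2 > 0" using \<delta> by simp
  from energy_decomposition[OF this, where 't = "int^'a"] obtain L1 where
    "\<forall>L\<ge>L1. \<forall>A (T :: (int^'a) set) a u. finite A \<longrightarrow> finite T \<longrightarrow> (\<forall>t\<in>T. ibox (a t) L \<subseteq> A) \<longrightarrow>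
    disjoint_family_on (\<lambda>t. ibox (a t) L) T \<longrightarrow> (\<forall>i\<in>A. u i \<in> sphere_tensor) \<longrightarrow>
    \<bar>energy f A u - (\<Sum>t\<in>T. energy f (ibox (a t) L) u)\<bar> \<le>
      2 * M * (real (card A) - real (card T) * real L ^ CARD('a)) + \<delta> / 2 * real (card T) * real L ^ CARD('a)" ..
  note L1 = this[rule_format]
  have "\<forall>\<^sub>F L in sequentially. 1 - \<eta> < (1 - real k / real L) ^ ?N"
    using \<eta> by (intro order_tendstoD(1)[OF one_minus_power_tendsto]) simp
  then obtain L2 where "\<forall>L\<ge>L2. 1 - \<eta> < (1 - real k / real L) ^ ?N"
    unfolding eventually_sequentially ..
  note L2 = this[rule_format]
  show ?thesis
  proof (rule exI[of _ "max (max 1 k) (max L1 L2)"], intro allI impI)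
    fix L assume "max (max 1 k) (max L1 L2) \<le> L"
    then have Lk: "L \<ge> 1" "L \<ge> k" and LL1: "L1 \<le> L" and LL2: "L2 \<le> L" by auto
    \<comment> \<open>The least multiple of \<open>k\<close> strictly above \<open>L\<close>.
      Strictness matters: if \<open>k\<close> divides \<open>L\<close>, tiles of period
      \<open>L\<close> could leave no free points for correcting the average.\<close>
    define p where "p = k * (L div k + 1)"
    have p: "L < p" "p \<le> L + k" "p > 0"
      using k_pos by (auto simp: p_def dividend_less_times_div algebra_simps)
    have "1 - real k / real L \<le> L / p"
    proof -
      have "(real L - k) * p \<le> (real L - k) * (real L + k)"
        using p(2) Lk by (intro mult_left_mono) auto
      also have "\<dots> \<le> real L * real L" by (simp add: algebra_simps)
      finally have "(real L - k) * p \<le> real L * real L" .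
      then show ?thesis using Lk p by (simp add: field_simps)
    qed
    then have "(1 - real k / real L) ^ ?N \<le> (L / p) ^ ?N"
      using Lk by (intro power_mono) auto
    then have "1 - \<eta> < (L / p) ^ ?N" using L2[OF LL2] by linarith
    then have "\<forall>\<^sub>F n in sequentially. 1 - \<eta> < (real (n div p - 1) * L / real n) ^ ?N"
      by (intro order_tendstoD(1)[OF tile_fraction_tendsto[OF p(3)]])
    then obtain n1 where "\<forall>n\<ge>n1. 1 - \<eta> < (real (n div p - 1) * L / real n) ^ ?N"
      unfolding eventually_sequentially ..
    note n1 = this[rule_format]
    show "\<exists>n0. \<forall>n\<ge>n0. \<forall>a v b. admissible P \<rho> (ibox a L) v \<longrightarrow>
      (\<exists>u. admissible P \<rho> (ibox b n) u \<and>
      energy f (ibox b n) u \<le> real n ^ CARD('a) * (energy f (ibox a L) v / real L ^ CARD('a) + \<delta>))"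
    \<comment> \<open>The second bound gives \<open>n div p\<close> at least the number of points
      that the balanced labelling needs; by \<open>qL\<close> below, at least that many points
      remain free.\<close>
    proof (intro exI[of _ "max (max 1 n1) (p * nat \<lceil>4 / \<rho>\<^sup>2\<rceil>)"] allI impI)
      fix n and a b :: "int^'a" and v
      assume "max (max 1 n1) (p * nat \<lceil>4 / \<rho>\<^sup>2\<rceil>) \<le> n"
      then have n: "n \<ge> 1" "n \<ge> n1" "p * nat \<lceil>4 / \<rho>\<^sup>2\<rceil> \<le> n" by auto
      assume adm: "admissible P \<rho> (ibox a L) v"
      define q where "q = n div p - 1"
      \<comment> \<open>Coordinatewise the least index for which the tile with corner
        \<open>a + p t\<close> does not start before \<open>b\<close>; its corner exceeds that of
        the large cube by the residue of \<open>a - b\<close> modulo \<open>p\<close>. Giving up one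
        period in \<open>q\<close> makes room for this offset.\<close>
      define t0 :: "int^'a" where "t0 = (\<chi> j. - ((a $ j - b $ j) div int p))"
      define T where "T = ibox t0 q"
      define s :: "int^'a \<Rightarrow> int^'a" where "s t = (\<chi> j. int p * t $ j)" for t
      define B where "B t = ibox (a + s t) L" for t
      define A where "A = ibox b n"
      define F where "F = A - (\<Union>t\<in>T. B t)"
      have qL: "q * L \<le> n - n div p"
      proof -
        have "q * L + n div p \<le> (n div p) * L + n div p" by (simp add: q_def)
        also have "\<dots> = (n div p) * (L + 1)" by simp
        also have "\<dots> \<le> (n div p) * p" using p by (intro mult_le_mono2) simp
        also have "\<dots> \<le> n" by simp
        finally show ?thesis by simp
      qed
      have fin: "finite A" "finite T" "finite F" by (simp_all add: A_def T_def F_def)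
      have Bim: "B t = (\<lambda>i. i + s t) ` ibox a L" for t
      proof
        show "B t \<subseteq> (\<lambda>i. i + s t) ` ibox a L"
        proof
          fix i assume "i \<in> B t"
          then have "i - s t \<in> ibox a L" by (auto simp: B_def ibox_def algebra_simps)
          then show "i \<in> (\<lambda>i. i + s t) ` ibox a L" by (rule rev_image_eqI) simp
        qed
      qed (auto simp: B_def ibox_def)
      \<comment> \<open>Since \<open>L < p\<close>, the index of the tile can be read off from a
        point of it. This yields disjointness and lets \<open>u\<close> be defined by a
        formula.\<close>
      have tile: "(\<chi> j. (i $ j - a $ j) div int p) = t" if "i \<in> B t" for i t
      proof -
        have "(i $ j - a $ j) div int p = t $ j" for j
        proof -
          have "int p * t $ j \<le> i $ j - a $ j" "i $ j - a $ j < int p * t $ j + int L"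
            using that by (auto simp: B_def ibox_def s_def dest!: spec[of _ j])
          then show ?thesis using p(1)
            by (intro int_div_pos_eq[where r = "i $ j - a $ j - int p * t $ j"]) auto
        qed
        then show ?thesis by (simp add: vec_eq_iff)
      qed
      have disj: "B t \<inter> B t' = {}" if "t \<noteq> t'" for t t' using tile that by blast
      have sub: "B t \<subseteq> A" if "t \<in> T" for t
      proof
        fix i assume i: "i \<in> B t"
        have "b $ j \<le> i $ j \<and> i $ j < b $ j + int n" for j
        proof -
          define d where "d = a $ j - b $ j"
          have t: "- (d div int p) \<le> t $ j" "t $ j < - (d div int p) + int q"
            using \<open>t \<in> T\<close> by (auto simp: T_def ibox_def t0_def d_def)
          have ij: "a $ j + int p * t $ j \<le> i $ j" "i $ j < a $ j + int p * t $ j + int L"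
            using i by (auto simp: B_def ibox_def s_def)
          have dm: "int p * (d div int p) + d mod int p = d" by simp
          have m: "0 \<le> d mod int p" "d mod int p < int p" using p(3) by auto
          have "int p * (- (d div int p)) \<le> int p * t $ j"
            using t(1) by (rule mult_left_mono) simp
          then have "- d \<le> int p * t $ j" using dm m by linarith
          then have lo: "b $ j \<le> i $ j" using ij(1) by (simp add: d_def)
          have "int p * (t $ j + 1) \<le> int p * (- (d div int p) + int q)"
            using t(2) by (intro mult_left_mono) auto
          then have "int p * t $ j + int p \<le> - (int p * (d div int p)) + int p * int q"
            by (simp add: algebra_simps)
          moreover have "int p * int q + int p \<le> int n"
          proof -
            have "q > 0" using t by (cases q) auto
            then have "q + 1 \<le> n div p" by (simp add: q_def)
            then have "p * (q + 1) \<le> p * (n div p)" by (rule mult_le_mono2)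
            also have "\<dots> \<le> n" by simp
            finally have "int (p * (q + 1)) \<le> int n" by (simp only: of_nat_le_iff)
            then show ?thesis by (simp add: algebra_simps)
          qed
          ultimately have "int p * t $ j + int p \<le> - d + int n" using dm m by linarith
          then have "i $ j < b $ j + int n" using ij(2) p(1) by (simp add: d_def)
          then show ?thesis using lo by simp
        qed
        then show "i \<in> A" by (simp add: A_def ibox_def)
      qed
      have disjf: "disjoint_family_on B T" using disj by (auto simp: disjoint_family_on_def)
      have UB: "(\<Union>t\<in>T. B t) \<subseteq> A" using sub by blast
      have cardB: "card (B t) = L ^ ?N" for t by (simp add: B_def)
      have "card (\<Union>t\<in>T. B t) = (\<Sum>t\<in>T. card (B t))"
        using fin disj by (intro card_UN_disjoint) (auto simp: B_def)
      then have cardU: "card (\<Union>t\<in>T. B t) = (q * L) ^ ?N"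
        by (simp add: cardB T_def power_mult_distrib)
      have cardT: "card T = q ^ ?N" by (simp add: T_def)
      have cardA: "card A = n ^ ?N" by (simp add: A_def)
      have cardF: "card F = n ^ ?N - (q * L) ^ ?N"
        unfolding F_def using card_Diff_subset[OF finite_subset[OF UB fin(1)] UB] cardU cardA by simp
      have qLn: "q * L \<le> n" using qL by simp
      have cardF': "real (card F) = real n ^ ?N - real q ^ ?N * real L ^ ?N"
        unfolding cardF using power_mono[OF qLn, of ?N] by (simp add: of_nat_diff power_mult_distrib)
      have "4 / \<rho>\<^sup>2 \<le> real (card F)"
      proof -
        have "n - q * L \<le> card F"
        proof -
          have N: "?N = Suc (?N - 1)" by simp
          have "(q * L) ^ ?N \<le> q * L * n ^ (?N - 1)"
            by (subst N) (simp only: power_Suc mult_le_mono power_mono[OF qLn] le0 order.refl)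
          moreover have "n ^ ?N = n * n ^ (?N - 1)" by (subst N) (simp only: power_Suc)
          ultimately have "n * n ^ (?N - 1) - q * L * n ^ (?N - 1) \<le> card F" unfolding cardF by simp
          moreover have "(n - q * L) * 1 \<le> (n - q * L) * n ^ (?N - 1)" using n(1) by (intro mult_le_mono2) simp
          ultimately show ?thesis by (simp add: diff_mult_distrib)
        qed
        moreover have "n div p \<le> n - q * L" using qL div_le_dividend[of n p] by linarith
        moreover have "nat \<lceil>4 / \<rho>\<^sup>2\<rceil> \<le> n div p"
          using n(3) less_eq_div_iff_mult_less_eq[OF p(3)] by (metis mult.commute)
        ultimately have "nat \<lceil>4 / \<rho>\<^sup>2\<rceil> \<le> card F" by linarith
        then show ?thesis by linarith
      qed
      from exists_admissible[OF P \<rho> fin(3) this] obtain w where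
        w: "\<And>i. w i \<in> sphere_tensor" "admissible P \<rho> F w" by blast
      define u where "u i = (if i \<in> (\<Union>t\<in>T. B t)
        then v (i - s (\<chi> j. (i $ j - a $ j) div int p)) else w i)" for i
      have uB: "u i = v (i - s t)" if "t \<in> T" "i \<in> B t" for t i
        using that tile[OF that(2)] by (auto simp: u_def)
      have vS: "v i \<in> sphere_tensor" if "i \<in> ibox a L" for i using adm that by (simp add: admissible_def)
      have uS: "u i \<in> sphere_tensor" if "i \<in> A" for i
      proof (cases "i \<in> (\<Union>t\<in>T. B t)")
        case True
        then obtain t where t: "t \<in> T" "i \<in> B t" by blast
        then obtain i' where "i' \<in> ibox a L" "i = i' + s t" by (auto simp: Bim)
        then show ?thesis using uB[OF t] vS by simp
      qed (simp only: u_def if_False w(1))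
      have s_mult: "s t = (\<chi> j. int k * (\<chi> j. int (L div k + 1) * t $ j) $ j)" for t
        by (simp add: s_def p_def vec_eq_iff algebra_simps)
      have enB: "energy f (B t) u = energy f (ibox a L) v" if "t \<in> T" for t
      proof -
        have "u (i + s t) = v i" if "i \<in> ibox a L" for i
          using uB[OF \<open>t \<in> T\<close>, of "i + s t"] that by (auto simp: Bim)
        then show ?thesis
          unfolding Bim unfolding s_mult by (intro energy_shift vS) auto
      qed
      have sumB: "sum u (B t) = sum v (ibox a L)" if "t \<in> T" for t
      proof -
        have "sum u (B t) = (\<Sum>i\<in>ibox a L. u (i + s t))"
          unfolding Bim by (subst sum.reindex) (auto simp: inj_on_def)
        also have "\<dots> = sum v (ibox a L)"
        proof (rule sum.cong)
          fix i assume "i \<in> ibox a L"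
          then show "u (i + s t) = v i" using uB[OF \<open>t \<in> T\<close>, of "i + s t"] by (auto simp: Bim)
        qed simp
        finally show ?thesis .
      qed
      have "sum u A = sum u F + sum u (\<Union>t\<in>T. B t)"
        unfolding F_def by (rule sum.subset_diff[OF UB fin(1)])
      also have "sum u (\<Union>t\<in>T. B t) = (\<Sum>t\<in>T. sum u (B t))"
        using fin disj by (intro sum.UNION_disjoint) (auto simp: B_def)
      also have "\<dots> = real (card T) *\<^sub>R sum v (ibox a L)" by (simp add: sumB sum_constant_scaleR del: sum_constant)
      also have "sum u F = sum w F" by (intro sum.cong) (auto simp: u_def F_def)
      finally have sumA: "sum u A = sum w F + real (card T) *\<^sub>R sum v (ibox a L)" .
      have cA: "real (card A) = real (card F) + real (card T) * real (card (ibox a L))"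
        unfolding cardF' by (simp add: cardA cardT)
      \<comment> \<open>The unnormalised errors of the free part and of the tiles add up. Each of
        them is at most \<rho> times its number of points, so the same radius \<rho> works for the
        whole cube.\<close>
      have "sum u A - real (card A) *\<^sub>R P = (sum w F - real (card F) *\<^sub>R P) +
          real (card T) *\<^sub>R (sum v (ibox a L) - real (card (ibox a L)) *\<^sub>R P)"
        unfolding sumA cA by (simp add: algebra_simps)
      also have "norm \<dots> \<le> \<rho> * real (card F) + real (card T) * (\<rho> * card (ibox a L))"
        using w(2) adm by (intro norm_triangle_le add_mono)
          (auto simp: admissible_def intro!: mult_left_mono simp del: card_ibox)
      also have "\<dots> = \<rho> * card A" unfolding cA by (simp add: algebra_simps)
      finally have admu: "admissible P \<rho> A u" using uS by (simp add: admissible_def)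
      define e where "e = energy f (ibox a L) v"
      have e: "\<bar>e\<bar> \<le> M * real L ^ ?N"
        unfolding e_def using abs_energy_le[of "ibox a L" v] vS by simp
      have "\<bar>energy f A u - (\<Sum>t\<in>T. energy f (ibox (a + s t) L) u)\<bar> \<le>
          2 * M * (real (card A) - real (card T) * real L ^ ?N) + \<delta> / 2 * real (card T) * real L ^ ?N"
        by (rule L1[OF LL1 fin(1,2)]) (use sub disjf uS in \<open>auto simp: B_def[abs_def]\<close>)
      moreover have "(\<Sum>t\<in>T. energy f (ibox (a + s t) L) u) = real (card T) * e"
        using enB by (simp add: B_def e_def)
      ultimately have "energy f A u \<le> real q ^ ?N * e + 2 * M * real (card F) + \<delta> / 2 * (real q ^ ?N * real L ^ ?N)"
        unfolding cardF' by (simp add: cardT cardA)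
      also have "\<delta> / 2 * (real q ^ ?N * real L ^ ?N) \<le> \<delta> / 2 * real n ^ ?N"
        using \<delta> cardF' by (intro mult_left_mono) auto
      \<comment> \<open>The energy \<open>e\<close> may be negative, so the tiles missing from the
        full volume cannot just be dropped; the lower bound for \<open>e\<close> limits the loss to
        \<open>M\<close> per free point.\<close>
      also have "real q ^ ?N * e \<le> real n ^ ?N * (e / real L ^ ?N) + M * real (card F)"
      proof -
        have "real n ^ ?N * (e / real L ^ ?N) - real q ^ ?N * e = real (card F) * (e / real L ^ ?N)"
          unfolding cardF' using Lk by (simp add: field_simps)
        moreover have "real (card F) * (- M) \<le> real (card F) * (e / real L ^ ?N)"
          using e Lk by (intro mult_left_mono) (auto simp: field_simps abs_le_iff)
        ultimately show ?thesis by (simp add: algebra_simps)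
      qed
      also have "real n ^ ?N * (e / real L ^ ?N) + M * real (card F) + 2 * M * real (card F) + \<delta> / 2 * real n ^ ?N
        = real n ^ ?N * (e / real L ^ ?N) + 3 * M * real (card F) + \<delta> / 2 * real n ^ ?N" by simp
      also have "3 * M * real (card F) \<le> \<delta> / 2 * real n ^ ?N"
      proof -
        have "(real (n div p - 1) * L / real n) ^ ?N = real q ^ ?N * real L ^ ?N / real n ^ ?N"
          by (simp add: q_def power_mult_distrib power_divide)
        then have "(1 - \<eta>) * real n ^ ?N \<le> real q ^ ?N * real L ^ ?N"
          using n1[OF n(2)] n(1) by (simp add: field_simps q_def)
        then have "real (card F) \<le> \<eta> * real n ^ ?N" unfolding cardF' by (simp add: algebra_simps)
        then have "3 * M * real (card F) \<le> 3 * M * (\<eta> * real n ^ ?N)"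
          using M_pos by (intro mult_left_mono) auto
        also have "\<dots> = \<delta> / 2 * real n ^ ?N" using M_pos by (simp add: \<eta>_def)
        finally show ?thesis .
      qed
      finally have "energy f A u \<le> real n ^ ?N * (e / real L ^ ?N + \<delta>)" by (simp add: algebra_simps)
      then show "\<exists>u. admissible P \<rho> (ibox b n) u \<and>
        energy f (ibox b n) u \<le> real n ^ CARD('a) * (energy f (ibox a L) v / real L ^ CARD('a) + \<delta>)"
        using admu unfolding A_def e_def by blast
    qed
  qed
qed

end

section \<open>The homogenized density\<close>

context periodic_interaction
begin

definition cube_values :: "real \<Rightarrow> real^'a^'a \<Rightarrow> nat \<Rightarrow> real set" where
  "cube_values \<rho> P n = {energy f (ibox a n) v / real n ^ CARD('a) | a v. admissible P \<rho> (ibox a n) v}"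

definition cell_density :: "real \<Rightarrow> real^'a^'a \<Rightarrow> real" where
  "cell_density \<rho> P = lim (\<lambda>n. Inf (cube_values \<rho> P n))"

lemma cube_values_abs_le: "x \<in> cube_values \<rho> P n \<Longrightarrow> \<bar>x\<bar> \<le> M"
proof -
  assume "x \<in> cube_values \<rho> P n"
  then obtain a v where x: "x = energy f (ibox a n) v / real n ^ CARD('a)" "admissible P \<rho> (ibox a n) v"
    by (auto simp: cube_values_def)
  then have "\<bar>energy f (ibox a n) v\<bar> \<le> M * real n ^ CARD('a)"
    using abs_energy_le[of "ibox a n" v] by (simp add: admissible_def)
  then show ?thesis unfolding x(1) using M_pos
    by (cases "n = 0") (simp_all add: power_0_left abs_divide divide_le_eq)
qed

lemma bdd_below_cube_values: "bdd_below (cube_values \<rho> P n)"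
  by (meson abs_le_D2 bdd_below.I cube_values_abs_le minus_le_iff)

lemma cube_values_nonempty:
  assumes "P \<in> K_set" "\<rho> > 0" "nat \<lceil>4 / \<rho>\<^sup>2\<rceil> \<le> n"
  shows "cube_values \<rho> P n \<noteq> {}"
proof -
  have "0 < 4 / \<rho>\<^sup>2" using assms(2) by simp
  then have n: "4 / \<rho>\<^sup>2 \<le> real n" "n \<ge> 1" using assms(3) by linarith+
  have "n ^ 1 \<le> n ^ CARD('a)" using n(2) by (intro power_increasing) auto
  then have "4 / \<rho>\<^sup>2 \<le> real (card (ibox (0 :: int^'a) n))" using n(1) by (simp flip: of_nat_power)
  from exists_admissible[OF assms(1,2) _ this] show ?thesis by (auto simp: cube_values_def)
qed

lemma abs_Inf_cube_values_le: "cube_values \<rho> P n \<noteq> {} \<Longrightarrow> \<bar>Inf (cube_values \<rho> P n)\<bar> \<le> M"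
  by (intro cInf_abs_ge cube_values_abs_le)

lemma Inf_cube_values_tendsto:
  assumes P: "P \<in> K_set" and \<rho>: "\<rho> > 0"
  shows "(\<lambda>n. Inf (cube_values \<rho> P n)) \<longlonglongrightarrow> cell_density \<rho> P"
proof -
  define n1 where "n1 = nat \<lceil>4 / \<rho>\<^sup>2\<rceil>"
  note ne = cube_values_nonempty[OF P \<rho>, folded n1_def]
  have "convergent (\<lambda>n. Inf (cube_values \<rho> P n))"
  proof (rule almost_decreasing_convergent[where ?n1.0 = n1 and B = M])
    show "\<bar>Inf (cube_values \<rho> P n)\<bar> \<le> M" if "n1 \<le> n" for n
      by (intro abs_Inf_cube_values_le ne that)
    fix \<delta> :: real assume "\<delta> > 0"
    then have \<delta>: "\<delta> / 2 > 0" by simp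
    from tiling[OF P \<rho> \<delta>] obtain L0 where "\<forall>L\<ge>L0. \<exists>n0. \<forall>n\<ge>n0. \<forall>a v b. admissible P \<rho> (ibox a L) v \<longrightarrow>
      (\<exists>u. admissible P \<rho> (ibox b n) u \<and>
      energy f (ibox b n) u \<le> real n ^ CARD('a) * (energy f (ibox a L) v / real L ^ CARD('a) + \<delta> / 2))" ..
    note L0 = this[rule_format]
    show "\<exists>L0. \<forall>L\<ge>L0. \<exists>n0. \<forall>n\<ge>n0. Inf (cube_values \<rho> P n) \<le> Inf (cube_values \<rho> P L) + \<delta>"
    proof (rule exI[of _ "max L0 n1"], intro allI impI)
      fix L assume L: "max L0 n1 \<le> L"
      have "cube_values \<rho> P L \<noteq> {}" using L by (intro ne) simp
      then have "\<exists>x\<in>cube_values \<rho> P L. x < Inf (cube_values \<rho> P L) + \<delta> / 2"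
        using \<delta> by (intro cInf_lessD) auto
      then obtain a v where av: "admissible P \<rho> (ibox a L) v"
        "energy f (ibox a L) v / real L ^ CARD('a) < Inf (cube_values \<rho> P L) + \<delta> / 2"
        by (auto simp: cube_values_def)
      have "L0 \<le> L" using L by simp
      from L0[OF this] obtain n0 where "\<forall>n\<ge>n0. \<forall>a v b. admissible P \<rho> (ibox a L) v \<longrightarrow>
        (\<exists>u. admissible P \<rho> (ibox b n) u \<and>
        energy f (ibox b n) u \<le> real n ^ CARD('a) * (energy f (ibox a L) v / real L ^ CARD('a) + \<delta> / 2))" ..
      note n0 = this[rule_format]
      show "\<exists>n0. \<forall>n\<ge>n0. Inf (cube_values \<rho> P n) \<le> Inf (cube_values \<rho> P L) + \<delta>"
      proof (intro exI[of _ "max 1 n0"] allI impI)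
        fix n assume n: "max 1 n0 \<le> n"
        from n0[OF _ av(1), of n 0] n obtain u where u: "admissible P \<rho> (ibox 0 n) u"
          "energy f (ibox 0 n) u \<le> real n ^ CARD('a) * (energy f (ibox a L) v / real L ^ CARD('a) + \<delta> / 2)"
          by auto
        have "Inf (cube_values \<rho> P n) \<le> energy f (ibox 0 n) u / real n ^ CARD('a)"
          using u(1) by (intro cInf_lower bdd_below_cube_values) (auto simp: cube_values_def)
        also have "\<dots> \<le> energy f (ibox a L) v / real L ^ CARD('a) + \<delta> / 2"
          using u(2) n by (simp add: divide_le_eq mult.commute)
        finally show "Inf (cube_values \<rho> P n) \<le> Inf (cube_values \<rho> P L) + \<delta>" using av(2) by simp
      qed
    qed
  qed
  then show ?thesis unfolding cell_density_def by (simp add: convergent_LIMSEQ_iff)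
qed

lemma cell_density_lower:
  assumes P: "P \<in> K_set" and \<rho>: "\<rho> > 0" and \<delta>: "\<delta> > 0"
  shows "\<exists>n0. \<forall>n\<ge>n0. \<forall>a v. admissible P \<rho> (ibox a n) v \<longrightarrow>
    real n ^ CARD('a) * (cell_density \<rho> P - \<delta>) \<le> energy f (ibox a n) v"
proof -
  have "\<forall>\<^sub>F n in sequentially. cell_density \<rho> P - \<delta> < Inf (cube_values \<rho> P n)"
    using \<delta> by (intro order_tendstoD(1)[OF Inf_cube_values_tendsto[OF P \<rho>]]) simp
  then obtain n0 where "\<forall>n\<ge>n0. cell_density \<rho> P - \<delta> < Inf (cube_values \<rho> P n)"
    unfolding eventually_sequentially ..
  note n0 = this[rule_format]
  show ?thesis
  proof (intro exI[of _ "max 1 n0"] allI impI)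
    fix n and a :: "int^'a" and v
    assume n: "max 1 n0 \<le> n" and adm: "admissible P \<rho> (ibox a n) v"
    have "cell_density \<rho> P - \<delta> \<le> Inf (cube_values \<rho> P n)" using n0[of n] n by simp
    also have "\<dots> \<le> energy f (ibox a n) v / real n ^ CARD('a)"
      using adm by (intro cInf_lower bdd_below_cube_values) (auto simp: cube_values_def)
    finally show "real n ^ CARD('a) * (cell_density \<rho> P - \<delta>) \<le> energy f (ibox a n) v"
      using n by (simp add: le_divide_eq mult.commute)
  qed
qed

text \<open>Here \<open>n0\<close> is chosen before the corner \<open>b\<close>: a near-minimiser on
  a single cube of side \<open>L\<close> is fixed, and tiling transports it into every large cube.
  The recovery functions need this, since their boxes move with \<epsilon>.\<close>

lemma cell_density_upper:
  assumes P: "P \<in> K_set" and \<rho>: "\<rho> > 0" and \<delta>: "\<delta> > 0"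
  shows "\<exists>n0. \<forall>n\<ge>n0. \<forall>b. \<exists>u. admissible P \<rho> (ibox b n) u \<and>
    energy f (ibox b n) u \<le> real n ^ CARD('a) * (cell_density \<rho> P + \<delta>)"
proof -
  have \<delta>2: "\<delta> / 2 > 0" using \<delta> by simp
  from tiling[OF P \<rho> \<delta>2] obtain L0 where "\<forall>L\<ge>L0. \<exists>n0. \<forall>n\<ge>n0. \<forall>a v b. admissible P \<rho> (ibox a L) v \<longrightarrow>
    (\<exists>u. admissible P \<rho> (ibox b n) u \<and>
    energy f (ibox b n) u \<le> real n ^ CARD('a) * (energy f (ibox a L) v / real L ^ CARD('a) + \<delta> / 2))" ..
  note L0 = this[rule_format]
  have "\<forall>\<^sub>F n in sequentially. Inf (cube_values \<rho> P n) < cell_density \<rho> P + \<delta> / 2"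
    using \<delta>2 by (intro order_tendstoD(2)[OF Inf_cube_values_tendsto[OF P \<rho>]]) simp
  then obtain L1 where "\<forall>L\<ge>L1. Inf (cube_values \<rho> P L) < cell_density \<rho> P + \<delta> / 2"
    unfolding eventually_sequentially ..
  note L1 = this[rule_format]
  define L where "L = max (max L0 L1) (nat \<lceil>4 / \<rho>\<^sup>2\<rceil>)"
  have "cube_values \<rho> P L \<noteq> {}" by (intro cube_values_nonempty P \<rho>) (simp add: L_def)
  moreover have "Inf (cube_values \<rho> P L) < cell_density \<rho> P + \<delta> / 2" by (intro L1) (simp add: L_def)
  ultimately have "\<exists>x\<in>cube_values \<rho> P L. x < cell_density \<rho> P + \<delta> / 2" by (intro cInf_lessD)
  then obtain a v where av: "admissible P \<rho> (ibox a L) v"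
    "energy f (ibox a L) v / real L ^ CARD('a) < cell_density \<rho> P + \<delta> / 2"
    by (auto simp: cube_values_def)
  have "L0 \<le> L" by (simp add: L_def)
  from L0[OF this] obtain n0 where "\<forall>n\<ge>n0. \<forall>a v b. admissible P \<rho> (ibox a L) v \<longrightarrow>
    (\<exists>u. admissible P \<rho> (ibox b n) u \<and>
    energy f (ibox b n) u \<le> real n ^ CARD('a) * (energy f (ibox a L) v / real L ^ CARD('a) + \<delta> / 2))" ..
  note n0 = this[rule_format]
  show ?thesis
  proof (intro exI[of _ n0] allI impI)
    fix n and b :: "int^'a" assume "n0 \<le> n"
    from n0[OF this av(1), of b] obtain u where u: "admissible P \<rho> (ibox b n) u"
      "energy f (ibox b n) u \<le> real n ^ CARD('a) * (energy f (ibox a L) v / real L ^ CARD('a) + \<delta> / 2)"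
      by auto
    note u(2)
    also have "\<dots> \<le> real n ^ CARD('a) * (cell_density \<rho> P + \<delta>)"
      using av(2) by (intro mult_left_mono) auto
    finally show "\<exists>u. admissible P \<rho> (ibox b n) u \<and>
      energy f (ibox b n) u \<le> real n ^ CARD('a) * (cell_density \<rho> P + \<delta>)" using u(1) by blast
  qed
qed

text \<open>Every competitor for the smaller ball is a competitor for the larger one, so the infima
  compare side by side. Continuity in the matrix is traded for a change of the radius.\<close>

lemma cell_density_mono:
  assumes "P \<in> K_set" "P' \<in> K_set" "\<rho> > 0" "\<rho> + norm (P - P') \<le> \<rho>'"
  shows "cell_density \<rho>' P' \<le> cell_density \<rho> P"
proof (rule LIMSEQ_le)
  show "(\<lambda>n. Inf (cube_values \<rho> P n)) \<longlonglongrightarrow> cell_density \<rho> P"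
    by (intro Inf_cube_values_tendsto assms)
  show "(\<lambda>n. Inf (cube_values \<rho>' P' n)) \<longlonglongrightarrow> cell_density \<rho>' P'"
    using assms norm_ge_zero[of "P - P'"] by (intro Inf_cube_values_tendsto) linarith+
  show "\<exists>n0. \<forall>n\<ge>n0. Inf (cube_values \<rho>' P' n) \<le> Inf (cube_values \<rho> P n)"
  proof (intro exI[of _ "nat \<lceil>4 / \<rho>\<^sup>2\<rceil>"] allI impI cInf_superset_mono bdd_below_cube_values cube_values_nonempty)
    show "cube_values \<rho> P n \<subseteq> cube_values \<rho>' P' n" for n
      using admissible_mono[OF _ assms(4)] by (fastforce simp: cube_values_def)
  qed (use assms in auto)
qed

lemma cell_density_abs_le:
  assumes "P \<in> K_set" "\<rho> > 0"
  shows "\<bar>cell_density \<rho> P\<bar> \<le> M"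
proof (rule LIMSEQ_le_const2[OF tendsto_rabs[OF Inf_cube_values_tendsto[OF assms]]])
  show "\<exists>n0. \<forall>n\<ge>n0. \<bar>Inf (cube_values \<rho> P n)\<bar> \<le> M"
    by (intro exI allI impI abs_Inf_cube_values_le cube_values_nonempty[OF assms])
qed

end

section \<open>Lattice points of the cubes of the homogenization formula\<close>

lemma lat_in_W_cube_iff:
  assumes "h > 0"
  shows "lat (i :: int^'n) \<in> (*\<^sub>R) h ` W_cube \<longleftrightarrow>
    i \<in> ibox (\<chi> j. \<lceil>- h / 2\<rceil>) (nat (\<lceil>h / 2\<rceil> - \<lceil>- h / 2\<rceil>))"
proof -
  have "x \<in> (*\<^sub>R) h ` W_cube \<longleftrightarrow> (\<forall>j. - h / 2 \<le> x $ j \<and> x $ j < h / 2)" for x :: "real^'n"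
  proof
    assume "x \<in> (*\<^sub>R) h ` W_cube"
    then obtain w where w: "x = h *\<^sub>R w" "\<And>j. - 1 / 2 \<le> w $ j" "\<And>j. w $ j < 1 / 2"
      by (auto simp: W_cube_def)
    have "h * (- 1 / 2) \<le> h * w $ j" "h * w $ j < h * (1 / 2)" for j
      using w(2,3)[of j] assms by (intro mult_left_mono mult_strict_left_mono; simp)+
    then show "\<forall>j. - h / 2 \<le> x $ j \<and> x $ j < h / 2" using w by simp
  next
    assume "\<forall>j. - h / 2 \<le> x $ j \<and> x $ j < h / 2"
    then have "(1 / h) *\<^sub>R x \<in> W_cube" using assms by (auto simp: W_cube_def field_simps)
    then show "x \<in> (*\<^sub>R) h ` W_cube" using assms by (auto intro!: image_eqI[of _ _ "(1 / h) *\<^sub>R x"])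
  qed
  \<comment> \<open>As the cube is half-open, both ends become ceilings: for an integer z the
    condition z < h / 2 means z < \<lceil>h / 2\<rceil>.\<close>
  moreover have "- h / 2 \<le> real_of_int z \<and> real_of_int z < h / 2 \<longleftrightarrow>
      \<lceil>- h / 2\<rceil> \<le> z \<and> z < \<lceil>- h / 2\<rceil> + int (nat (\<lceil>h / 2\<rceil> - \<lceil>- h / 2\<rceil>))" for z
  proof -
    have "\<lceil>- h / 2\<rceil> \<le> \<lceil>h / 2\<rceil>" using assms by (intro ceiling_mono) simp
    then show ?thesis by (simp add: ceiling_le_iff less_ceiling_iff)
  qed
  ultimately show ?thesis by (simp add: lat_def ibox_def)
qed

lemma lattice_side_tendsto: "((\<lambda>h. (real (nat (\<lceil>h / 2\<rceil> - \<lceil>- h / 2\<rceil>)) / h) ^ m) \<longlongrightarrow> 1) at_top"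
proof -
  have "((\<lambda>h. real (nat (\<lceil>h / 2\<rceil> - \<lceil>- h / 2\<rceil>)) / h) \<longlongrightarrow> 1) at_top"
  proof (rule tendsto_sandwich)
    show "\<forall>\<^sub>F h :: real in at_top. 1 - 1 / h \<le> real (nat (\<lceil>h / 2\<rceil> - \<lceil>- h / 2\<rceil>)) / h"
      using eventually_gt_at_top[of 0]
    proof eventually_elim
      case (elim h)
      have "h - 1 \<le> real (nat (\<lceil>h / 2\<rceil> - \<lceil>- h / 2\<rceil>))" by linarith
      then have "(h - 1) / h \<le> real (nat (\<lceil>h / 2\<rceil> - \<lceil>- h / 2\<rceil>)) / h"
        using elim by (intro divide_right_mono) auto
      then show ?case using elim by (simp add: diff_divide_distrib)
    qed
    show "\<forall>\<^sub>F h :: real in at_top. real (nat (\<lceil>h / 2\<rceil> - \<lceil>- h / 2\<rceil>)) / h \<le> 1 + 1 / h"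
      using eventually_gt_at_top[of 0]
    proof eventually_elim
      case (elim h)
      have "real (nat (\<lceil>h / 2\<rceil> - \<lceil>- h / 2\<rceil>)) \<le> h + 1" using elim by linarith
      then have "real (nat (\<lceil>h / 2\<rceil> - \<lceil>- h / 2\<rceil>)) / h \<le> (h + 1) / h"
        using elim by (intro divide_right_mono) auto
      then show ?case using elim by (simp add: add_divide_distrib)
    qed
    have *: "((\<lambda>h::real. 1 / h) \<longlongrightarrow> 0) at_top"
      by (intro tendsto_divide_0[OF tendsto_const] filterlim_at_top_imp_at_infinity filterlim_ident)
    show "((\<lambda>h::real. 1 - 1 / h) \<longlongrightarrow> 1) at_top" "((\<lambda>h::real. 1 + 1 / h) \<longlongrightarrow> 1) at_top"
      using tendsto_diff[OF tendsto_const[of 1] *] tendsto_add[OF tendsto_const[of 1] *] by auto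
  qed
  from tendsto_power[OF this, of m] show ?thesis by simp
qed

lemma admissible_iff_average:
  assumes "finite A" "A \<noteq> {}"
  shows "admissible P \<rho> A v \<longleftrightarrow> (\<forall>i\<in>A. v i \<in> sphere_tensor) \<and>
    (1 / real (card A)) *\<^sub>R (\<Sum>i\<in>A. v i) \<in> cball P \<rho>"
proof -
  have c: "real (card A) > 0" using assms by (simp add: card_gt_0_iff)
  have "(\<Sum>i\<in>A. v i) - real (card A) *\<^sub>R P = real (card A) *\<^sub>R ((1 / real (card A)) *\<^sub>R (\<Sum>i\<in>A. v i) - P)"
    using c by (simp add: scaleR_diff_right)
  then have "norm ((\<Sum>i\<in>A. v i) - real (card A) *\<^sub>R P) =
      real (card A) * dist P ((1 / real (card A)) *\<^sub>R (\<Sum>i\<in>A. v i))"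
    using c by (simp add: dist_norm norm_minus_commute)
  then show ?thesis using c by (simp add: admissible_def mult.commute)
qed

context periodic_interaction
begin

text \<open>The parameter \<open>h\<close> is real, whereas the lattice points form a box of integer
  side \<open>n h\<close>. The factor \<open>g h\<close>, which tends to 1, corrects the
  normalisation by a power of \<open>h\<close> instead of \<open>n h\<close>.\<close>

lemma cell_inf_tendsto:
  assumes P: "P \<in> K_set" and \<rho>: "\<rho> > 0"
  shows "(cell_inf f P \<rho> \<longlongrightarrow> ereal (cell_density \<rho> P)) at_top"
proof -
  define a :: "real \<Rightarrow> int^'a" where "a h = (\<chi> j. \<lceil>- h / 2\<rceil>)" for h
  define n where "n h = nat (\<lceil>h / 2\<rceil> - \<lceil>- h / 2\<rceil>)" for h :: real
  define g where "g h = (real (n h) / h) ^ CARD('a)" for h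
  have g: "(g \<longlongrightarrow> 1) at_top" unfolding g_def n_def by (rule lattice_side_tendsto)
  have Z: "Z_eps 1 ((*\<^sub>R) h ` W_cube) = ibox (a h) (n h)" if "h > 0" for h
    using lat_in_W_cube_iff[OF that] by (auto simp: Z_eps_def a_def n_def)
  have n_lim: "filterlim n at_top at_top"
    unfolding filterlim_at_top
  proof
    fix Z
    show "\<forall>\<^sub>F h in at_top. Z \<le> n h"
      using eventually_ge_at_top[of "real Z + 1"]
      by eventually_elim (unfold n_def, linarith)
  qed
  define adm where "adm h = {Q. (\<forall>x \<in> scaled_lattice 1 \<inter> (*\<^sub>R) h ` W_cube. Q x \<in> sphere_tensor) \<and>
                  disc_avg 1 ((*\<^sub>R) h ` W_cube) Q \<in> cball P \<rho>}" for h
  have sl: "scaled_lattice 1 \<inter> (*\<^sub>R) h ` W_cube = lat ` ibox (a h) (n h)" if "h > 0" for h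
    using Z[OF that] by (auto simp: scaled_lattice_def Z_eps_def)
  have adm_iff: "Q \<in> adm h \<longleftrightarrow> admissible P \<rho> (ibox (a h) (n h)) (\<lambda>i. Q (lat i))"
    if h: "h > 0" and n: "n h \<ge> 1" for h Q
  proof -
    have ne: "ibox (a h) (n h) \<noteq> {}"
      using n card_ibox[of "a h" "n h"] by (metis card.empty not_one_le_zero power_eq_0_iff)
    have "inj_on lat (ibox (a h) (n h))" by (rule inj_on_subset[OF inj_lat subset_UNIV])
    then have "disc_avg 1 ((*\<^sub>R) h ` W_cube) Q =
        (1 / real (card (ibox (a h) (n h)))) *\<^sub>R (\<Sum>i\<in>ibox (a h) (n h). Q (lat i))"
      unfolding disc_avg_def sl[OF h] by (simp add: card_image sum.reindex del: card_ibox)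
    then show ?thesis
      unfolding adm_def admissible_iff_average[OF finite_ibox ne] sl[OF h] by (simp del: card_ibox)
  qed
  have E: "disc_energy f 1 ((*\<^sub>R) h ` W_cube) Q = ereal (energy f (ibox (a h) (n h)) (\<lambda>i. Q (lat i)))"
    if h: "h > 0" and Q: "Q \<in> adm h" for h Q
  proof -
    have "Q (1 *\<^sub>R lat i) \<in> sphere_tensor" if "i \<in> Z_eps 1 ((*\<^sub>R) h ` W_cube)" for i
      using Q that unfolding Z[OF h] adm_def sl[OF h] by simp
    then show ?thesis
      using disc_energy_eq_energy[of 1 "(*\<^sub>R) h ` W_cube" Q f] by (simp add: Z[OF h])
  qed
  have lower: "\<forall>\<^sub>F h in at_top. ereal (g h * (cell_density \<rho> P - \<delta>)) \<le> cell_inf f P \<rho> h" if "\<delta> > 0" for \<delta>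
  proof -
    from cell_density_lower[OF P \<rho> that] obtain n0 where "\<forall>n\<ge>n0. \<forall>a v. admissible P \<rho> (ibox a n) v \<longrightarrow>
      real n ^ CARD('a) * (cell_density \<rho> P - \<delta>) \<le> energy f (ibox a n) v" ..
    note n0 = this[rule_format]
    have "\<forall>\<^sub>F h in at_top. n h \<ge> max 1 n0" using n_lim unfolding filterlim_at_top by blast
    then show ?thesis using eventually_gt_at_top[of 0]
    proof eventually_elim
      case (elim h)
      have "ereal (real (n h) ^ CARD('a) * (cell_density \<rho> P - \<delta>)) \<le>
          (INF Q\<in>adm h. disc_energy f 1 ((*\<^sub>R) h ` W_cube) Q)"
      proof (rule INF_greatest)
        fix Q assume Q: "Q \<in> adm h"
        then have "admissible P \<rho> (ibox (a h) (n h)) (\<lambda>i. Q (lat i))" using adm_iff elim by simp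
        then show "ereal (real (n h) ^ CARD('a) * (cell_density \<rho> P - \<delta>)) \<le> disc_energy f 1 ((*\<^sub>R) h ` W_cube) Q"
          unfolding E[OF elim(2) Q] using n0 elim by simp
      qed
      then have "ereal (1 / h ^ CARD('a)) * ereal (real (n h) ^ CARD('a) * (cell_density \<rho> P - \<delta>)) \<le> cell_inf f P \<rho> h"
        unfolding cell_inf_def adm_def using elim by (intro ereal_mult_left_mono) auto
      then show ?case by (simp add: g_def power_divide)
    qed
  qed
  have upper: "\<forall>\<^sub>F h in at_top. cell_inf f P \<rho> h \<le> ereal (g h * (cell_density \<rho> P + \<delta>))" if "\<delta> > 0" for \<delta>
  proof -
    from cell_density_upper[OF P \<rho> that] obtain n0 where "\<forall>n\<ge>n0. \<forall>b. \<exists>u. admissible P \<rho> (ibox b n) u \<and>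
      energy f (ibox b n) u \<le> real n ^ CARD('a) * (cell_density \<rho> P + \<delta>)" ..
    note n0 = this[rule_format]
    have "\<forall>\<^sub>F h in at_top. n h \<ge> max 1 n0" using n_lim unfolding filterlim_at_top by blast
    then show ?thesis using eventually_gt_at_top[of 0]
    proof eventually_elim
      case (elim h)
      from n0[of "n h" "a h"] elim obtain u where u: "admissible P \<rho> (ibox (a h) (n h)) u"
        "energy f (ibox (a h) (n h)) u \<le> real (n h) ^ CARD('a) * (cell_density \<rho> P + \<delta>)" by auto
      \<comment> \<open>Competitors are functions on the whole space; away from the lattice the
        values of this one are arbitrary and do not enter.\<close>
      define Q where "Q x = u (inv lat x)" for x
      have Ql: "Q (lat i) = u i" for i by (simp add: Q_def inv_f_f[OF inj_lat])
      have Q: "Q \<in> adm h" using adm_iff elim u(1) by (simp add: Ql)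
      have "(INF Q\<in>adm h. disc_energy f 1 ((*\<^sub>R) h ` W_cube) Q) \<le> disc_energy f 1 ((*\<^sub>R) h ` W_cube) Q"
        by (rule INF_lower[OF Q])
      also have "\<dots> \<le> ereal (real (n h) ^ CARD('a) * (cell_density \<rho> P + \<delta>))"
        unfolding E[OF elim(2) Q] using u(2) by (simp add: Ql)
      finally have "cell_inf f P \<rho> h \<le> ereal (1 / h ^ CARD('a)) * ereal (real (n h) ^ CARD('a) * (cell_density \<rho> P + \<delta>))"
        unfolding cell_inf_def adm_def using elim by (intro ereal_mult_left_mono) auto
      then show ?case by (simp add: g_def power_divide)
    qed
  qed
  show ?thesis
  proof (rule order_tendstoI)
    fix y assume "y < ereal (cell_density \<rho> P)"
    then obtain z where z: "y < ereal z" "z < cell_density \<rho> P"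
      using ereal_dense2 by (metis ereal_less(1) less_ereal.simps(1) ereal_dense3)
    \<comment> \<open>Half of the gap is given to the density estimate; the other half absorbs the
      factor \<open>g h\<close>.\<close>
    define \<delta> where "\<delta> = (cell_density \<rho> P - z) / 2"
    have \<delta>: "\<delta> > 0" using z by (simp add: \<delta>_def)
    have "((\<lambda>h. g h * (cell_density \<rho> P - \<delta>)) \<longlongrightarrow> 1 * (cell_density \<rho> P - \<delta>)) at_top"
      by (intro tendsto_intros g)
    moreover have "z < 1 * (cell_density \<rho> P - \<delta>)" using z by (simp add: \<delta>_def field_simps)
    ultimately have "\<forall>\<^sub>F h in at_top. z < g h * (cell_density \<rho> P - \<delta>)" by (rule order_tendstoD(1))
    then show "\<forall>\<^sub>F h in at_top. y < cell_inf f P \<rho> h"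
      using lower[OF \<delta>]
    proof eventually_elim
      case (elim h)
      then show ?case using z(1) by (metis ereal_less_eq(3) less_imp_le order_less_le_trans)
    qed
  next
    fix y assume "ereal (cell_density \<rho> P) < y"
    then obtain z where z: "ereal z < y" "cell_density \<rho> P < z"
      using ereal_dense2 by (metis less_ereal.simps(1))
    define \<delta> where "\<delta> = (z - cell_density \<rho> P) / 2"
    have \<delta>: "\<delta> > 0" using z by (simp add: \<delta>_def)
    have "((\<lambda>h. g h * (cell_density \<rho> P + \<delta>)) \<longlongrightarrow> 1 * (cell_density \<rho> P + \<delta>)) at_top"
      by (intro tendsto_intros g)
    moreover have "1 * (cell_density \<rho> P + \<delta>) < z" using z by (simp add: \<delta>_def field_simps)
    ultimately have "\<forall>\<^sub>F h in at_top. g h * (cell_density \<rho> P + \<delta>) < z" by (rule order_tendstoD(2))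
    then show "\<forall>\<^sub>F h in at_top. cell_inf f P \<rho> h < y"
      using upper[OF \<delta>]
    proof eventually_elim
      case (elim h)
      then show ?case using z(1) by (metis ereal_less_eq(3) less_imp_le order_le_less_trans)
    qed
  qed
qed

definition hom_density :: "real^'a^'a \<Rightarrow> real" where
  "hom_density P = (SUP \<rho>\<in>{0<..}. cell_density \<rho> P)"

lemma bdd_above_density:
  assumes "P \<in> K_set" "X \<subseteq> {0<..}"
  shows "bdd_above ((\<lambda>\<rho>. cell_density \<rho> P) ` X)"
proof (rule bdd_aboveI2)
  fix \<rho> assume "\<rho> \<in> X"
  then have "\<rho> > 0" using assms(2) by auto
  then show "cell_density \<rho> P \<le> M" using cell_density_abs_le[OF assms(1), of \<rho>] by linarith
qed

lemma cell_density_le_hom_density: "P \<in> K_set \<Longrightarrow> \<rho> > 0 \<Longrightarrow> cell_density \<rho> P \<le> hom_density P"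
  unfolding hom_density_def by (intro cSUP_upper bdd_above_density) auto

lemma has_hom_limit_hom_density:
  assumes P: "P \<in> K_set"
  shows "has_hom_limit f P (hom_density P)"
  unfolding has_hom_limit_def
proof (intro exI conjI allI impI)
  show "(cell_inf f P \<rho> \<longlongrightarrow> ereal (cell_density \<rho> P)) at_top" if "\<rho> > 0" for \<rho>
    using cell_inf_tendsto[OF P that] .
  have "((\<lambda>\<rho>. cell_density \<rho> P) \<longlongrightarrow> hom_density P) (at_right 0)"
  proof (rule order_tendstoI)
    fix y assume "y < hom_density P"
    then obtain r where r: "r > 0" "y < cell_density r P"
      unfolding hom_density_def
      using less_cSUP_iff[OF _ bdd_above_density[OF P order.refl]] by auto
    have "\<forall>\<^sub>F \<rho> in at_right 0. \<rho> \<in> {0<..<r}" using r by (intro eventually_at_right_real)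
    then show "\<forall>\<^sub>F \<rho> in at_right 0. y < cell_density \<rho> P"
    proof eventually_elim
      case (elim \<rho>)
      then have "cell_density r P \<le> cell_density \<rho> P" by (intro cell_density_mono P) auto
      then show ?case using r by simp
    qed
  next
    fix y assume y: "hom_density P < y"
    have "\<forall>\<^sub>F \<rho> in at_right 0. \<rho> \<in> {0<..<1::real}" by (intro eventually_at_right_real) simp
    then show "\<forall>\<^sub>F \<rho> in at_right 0. cell_density \<rho> P < y"
      by eventually_elim (use cell_density_le_hom_density[OF P] y in force)
  qed
  then show "((\<lambda>\<rho>. ereal (cell_density \<rho> P)) \<longlongrightarrow> ereal (hom_density P)) (at_right 0)" by simp
qed

lemma f_hom_eq:
  assumes "P \<in> K_set"
  shows "f_hom f P = hom_density P"
  unfolding f_hom_def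
proof (rule the_equality)
  show *: "has_hom_limit f P (hom_density P)" by (rule has_hom_limit_hom_density[OF assms])
  show "l = hom_density P" if "has_hom_limit f P l" for l
    by (rule has_hom_limit_unique[OF that *])
qed

end

section \<open>Cubes and cells in Euclidean space\<close>

text \<open>Near a boundary point the frontier is contained in the graph of \<open>g\<close>. The
  graph is the image of the null hyperplane \<open>H\<close> under \<open>F\<close>, and
  \<open>F\<close> satisfies a Lipschitz bound with constant \<open>1 + L\<close>; such images of
  null sets are null.\<close>

lemma negligible_frontier_lipschitz:
  fixes \<Omega> :: "(real^'n) set"
  assumes lip: "lipschitz_boundary \<Omega>" and "open \<Omega>"
  shows "negligible (frontier \<Omega>)"
proof (rule locally_negligible_alt[THEN iffD2], rule ballI)
  fix x assume x: "x \<in> frontier \<Omega>"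
  then obtain r \<nu> L g where r: "r > 0" and \<nu>: "norm \<nu> = 1"
    and L: "L-lipschitz_on {z. z \<bullet> \<nu> = 0} (g :: real^'n \<Rightarrow> real)"
    and sub: "\<Omega> \<inter> ball x r = {y \<in> ball x r. y \<bullet> \<nu> < g (y - (y \<bullet> \<nu>) *\<^sub>R \<nu>)}"
    using lip[unfolded lipschitz_boundary_def, rule_format, OF x] by (elim exE conjE) (rule that)
  define H where "H = {z. z \<bullet> \<nu> = 0}"
  define F where "F z = z + g z *\<^sub>R \<nu>" for z
  define \<pi> where "\<pi> y = y - (y \<bullet> \<nu>) *\<^sub>R \<nu>" for y
  have \<nu>\<nu>: "\<nu> \<bullet> \<nu> = 1" using \<nu> by (simp add: norm_eq_1)
  have \<pi>H: "\<pi> y \<in> H" for y by (simp add: \<pi>_def H_def inner_diff_left \<nu>\<nu>)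
  have "\<nu> \<noteq> 0" using \<nu> by auto
  then have negH: "negligible H"
    using negligible_hyperplane[of \<nu> 0] by (simp add: H_def inner_commute)
  have "negligible (F ` H)"
  proof (rule negligible_locally_Lipschitz_image[OF _ negH])
    fix z assume z: "z \<in> H"
    have "norm (F y - F z) \<le> (1 + L) * norm (y - z)" if "y \<in> H" for y
    proof -
      have "norm (F y - F z) = norm ((y - z) + (g y - g z) *\<^sub>R \<nu>)" by (simp add: F_def algebra_simps)
      also have "\<dots> \<le> norm (y - z) + \<bar>g y - g z\<bar>" using norm_triangle_ineq[of "y - z"] \<nu> by (metis mult.right_neutral norm_scaleR)
      also have "\<bar>g y - g z\<bar> \<le> L * norm (y - z)"
        using lipschitz_onD[OF L, of y z] that z by (simp add: H_def dist_norm)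
      finally show ?thesis by (simp add: algebra_simps)
    qed
    then show "\<exists>T B. open T \<and> z \<in> T \<and> (\<forall>y\<in>H \<inter> T. norm (F y - F z) \<le> B * norm (y - z))"
      by (intro exI[of _ UNIV] exI[of _ "1 + L"]) auto
  qed simp
  moreover have "frontier \<Omega> \<inter> ball x r \<subseteq> F ` H"
  proof
    fix y assume y: "y \<in> frontier \<Omega> \<inter> ball x r"
    \<comment> \<open>Equality in the graph condition comes from both sides: \<open>y\<close> is not
      in the open set, which gives one inequality, and it is a limit of points of the set, which
      gives the other by continuity of \<open>g\<close>.\<close>
    have "y \<notin> \<Omega>" using y \<open>open \<Omega>\<close> by (simp add: frontier_def interior_open)
    then have ge: "g (\<pi> y) \<le> y \<bullet> \<nu>" using y sub unfolding \<pi>_def by (metis (no_types, lifting) IntD1 IntD2 mem_Collect_eq not_le)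
    have "y \<in> closure \<Omega>" using y by (simp add: frontier_def)
    then obtain s where s: "\<And>n. s n \<in> \<Omega>" "s \<longlonglongrightarrow> y" unfolding closure_sequential by blast
    have ev: "\<forall>\<^sub>F n in sequentially. s n \<in> ball x r"
      using y s(2) by (intro topological_tendstoD) auto
    have contg: "continuous_on H g" using L unfolding H_def by (rule lipschitz_on_continuous_on)
    have "(\<lambda>n. \<pi> (s n)) \<longlonglongrightarrow> \<pi> y" unfolding \<pi>_def by (intro tendsto_intros s)
    then have "(\<lambda>n. g (\<pi> (s n))) \<longlonglongrightarrow> g (\<pi> y)"
      by (rule continuous_on_tendsto_compose[OF contg]) (simp_all add: \<pi>H)
    moreover have "(\<lambda>n. s n \<bullet> \<nu>) \<longlonglongrightarrow> y \<bullet> \<nu>" by (intro tendsto_intros s)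
    moreover have "\<forall>\<^sub>F n in sequentially. s n \<bullet> \<nu> \<le> g (\<pi> (s n))"
      using ev
    proof eventually_elim
      case (elim n)
      then have "s n \<in> \<Omega> \<inter> ball x r" using s(1) by simp
      then show ?case unfolding sub \<pi>_def by simp
    qed
    ultimately have "y \<bullet> \<nu> \<le> g (\<pi> y)" by (intro tendsto_le[OF sequentially_bot])
    with ge have "y = F (\<pi> y)" by (simp add: F_def) (simp add: \<pi>_def)
    then show "y \<in> F ` H" using \<pi>H by blast
  qed
  ultimately have "negligible (frontier \<Omega> \<inter> ball x r)" by (rule negligible_subset)
  then show "\<exists>U. openin (top_of_set (frontier \<Omega>)) U \<and> x \<in> U \<and> negligible U"
    using x r by (intro exI[of _ "frontier \<Omega> \<inter> ball x r"]) (auto simp: openin_open_Int)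
qed

section \<open>Half-open cubes and the grid of size r\<close>

definition rcube :: "real^'n \<Rightarrow> real \<Rightarrow> (real^'n) set" where
  "rcube a s = {x. \<forall>j. a $ j \<le> x $ j \<and> x $ j < a $ j + s}"

lemma box_subset_rcube: "box a (a + (\<chi> j. s)) \<subseteq> rcube a s"
  by (auto simp: rcube_def mem_box_cart less_imp_le)

lemma rcube_subset_cbox: "rcube a s \<subseteq> cbox a (a + (\<chi> j. s))"
  by (auto simp: rcube_def mem_box_cart less_imp_le)

lemma
  fixes a :: "real^'n" and s :: real
  assumes "s \<ge> 0"
  shows rcube_lmeasurable: "rcube a s \<in> lmeasurable"
    and measure_rcube: "measure lebesgue (rcube a s) = s ^ CARD('n)"
proof -
  let ?b = "a + (\<chi> j. s)"
  have "negligible (cbox a ?b - box a ?b)" by (rule negligible_frontier_interval)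
  then have neg: "negligible (cbox a ?b - rcube a s \<union> (rcube a s - cbox a ?b))"
    by (rule negligible_subset) (use box_subset_rcube[of a s] rcube_subset_cbox[of a s] in blast)
  show "rcube a s \<in> lmeasurable"
    using lmeasurable_negligible_symdiff[OF lmeasurable_cbox neg] .
  have "measure lebesgue (rcube a s) = measure lebesgue (cbox a ?b)"
    using measure_negligible_symdiff[OF lmeasurable_cbox neg] .
  also have "cbox a ?b \<noteq> {}" using assms by (auto simp: interval_ne_empty_cart)
  then have "measure lebesgue (cbox a ?b) = s ^ CARD('n)"
    using content_cbox_cart[of a ?b] by simp
  finally show "measure lebesgue (rcube a s) = s ^ CARD('n)" .
qed

lemma convex_rcube: "convex (rcube a s)"
proof -
  have "rcube a s = (\<Inter>j. {x. axis j 1 \<bullet> x \<ge> a $ j} \<inter> {x. axis j 1 \<bullet> x < a $ j + s})"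
    by (auto simp: rcube_def inner_axis')
  then show ?thesis
    by (simp only:) (intro convex_INT convex_Int convex_halfspace_ge convex_halfspace_lt)
qed

lemma norm_diff_rcube_le:
  fixes x y :: "real^'n" and s :: real
  assumes "x \<in> rcube a s" "y \<in> rcube a s"
  shows "norm (x - y) \<le> CARD('n) * s"
proof -
  have "norm (x - y) \<le> (\<Sum>j\<in>UNIV. \<bar>(x - y) $ j\<bar>)" by (rule norm_le_l1_cart)
  also have "\<dots> \<le> (\<Sum>j\<in>(UNIV :: 'n set). s)"
  proof (rule sum_mono)
    fix j
    have "a $ j \<le> x $ j \<and> x $ j < a $ j + s" "a $ j \<le> y $ j \<and> y $ j < a $ j + s"
      using assms by (auto simp: rcube_def)
    then show "\<bar>(x - y) $ j\<bar> \<le> s" unfolding vector_minus_component by linarith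
  qed
  finally show ?thesis by simp
qed

definition grid :: "real \<Rightarrow> int^'n \<Rightarrow> (real^'n) set" where
  "grid r z = rcube (r *\<^sub>R lat z) r"

lemma connected_grid: "connected (grid r z)"
  unfolding grid_def by (rule convex_connected[OF convex_rcube])

lemma corner_in_grid: "r > 0 \<Longrightarrow> r *\<^sub>R lat z \<in> grid r z"
  by (simp add: grid_def rcube_def)

text \<open>Because the cubes are half-open, the index of the cube containing a point is the
  coordinatewise floor of its quotient by \<open>r\<close>; disjointness and covering follow from
  this formula.\<close>

lemma mem_grid_iff: "r > 0 \<Longrightarrow> x \<in> grid r z \<longleftrightarrow> z = (\<chi> j. \<lfloor>x $ j / r\<rfloor>)"
  by (simp add: grid_def rcube_def lat_def vec_eq_iff)
    (intro iff_allI; subst eq_commute, simp add: floor_eq_iff field_simps)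

lemma grid_disjoint: "r > 0 \<Longrightarrow> z \<noteq> z' \<Longrightarrow> grid r z \<inter> grid r z' = {}"
  by (auto simp: mem_grid_iff)

lemma measure_grid: "r > 0 \<Longrightarrow> measure lebesgue (grid r (z :: int^'n)) = r ^ CARD('n)"
  by (simp add: grid_def measure_rcube)

lemma grid_lmeasurable: "r > 0 \<Longrightarrow> grid r z \<in> lmeasurable"
  by (simp add: grid_def rcube_lmeasurable)

definition inner_cubes :: "real \<Rightarrow> (real^'n) set \<Rightarrow> (int^'n) set" where
  "inner_cubes r \<Omega> = {z. grid r z \<subseteq> \<Omega>}"

definition boundary_cubes :: "real \<Rightarrow> (real^'n) set \<Rightarrow> (int^'n) set" where
  "boundary_cubes r \<Omega> = {z. grid r z \<inter> \<Omega> \<noteq> {} \<and> \<not> grid r z \<subseteq> \<Omega>}"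

lemma finite_cubes_meeting:
  assumes "bounded \<Omega>" "r > 0"
  shows "finite {z. grid r z \<inter> \<Omega> \<noteq> {}}"
proof -
  obtain B where B: "\<And>x. x \<in> \<Omega> \<Longrightarrow> norm x \<le> B" using assms(1) by (auto simp: bounded_iff)
  have "{z. grid r z \<inter> \<Omega> \<noteq> {}} \<subseteq> ibox (\<chi> j. \<lfloor>- B / r\<rfloor>) (nat (\<lfloor>B / r\<rfloor> - \<lfloor>- B / r\<rfloor> + 1))"
  proof
    fix z assume "z \<in> {z. grid r z \<inter> \<Omega> \<noteq> {}}"
    then obtain x where x: "x \<in> grid r z" "x \<in> \<Omega>" by blast
    have "\<lfloor>- B / r\<rfloor> \<le> z $ j \<and> z $ j \<le> \<lfloor>B / r\<rfloor>" for j
    proof -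
      have "\<bar>x $ j\<bar> \<le> B" using B[OF x(2)] component_le_norm_cart[of x j] by linarith
      then have "- B / r \<le> x $ j / r" "x $ j / r \<le> B / r"
        using assms(2) by (intro divide_right_mono; simp)+
      then have "\<lfloor>- B / r\<rfloor> \<le> \<lfloor>x $ j / r\<rfloor> \<and> \<lfloor>x $ j / r\<rfloor> \<le> \<lfloor>B / r\<rfloor>" by (intro conjI floor_mono)
      then show ?thesis using x(1) assms(2) by (simp add: mem_grid_iff)
    qed
    moreover from this[of undefined] have "\<lfloor>- B / r\<rfloor> \<le> \<lfloor>B / r\<rfloor>" by linarith
    ultimately show "z \<in> ibox (\<chi> j. \<lfloor>- B / r\<rfloor>) (nat (\<lfloor>B / r\<rfloor> - \<lfloor>- B / r\<rfloor> + 1))"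
      by (simp add: ibox_def)
  qed
  then show ?thesis by (rule finite_subset) simp
qed

lemma finite_inner_cubes: "bounded \<Omega> \<Longrightarrow> r > 0 \<Longrightarrow> finite (inner_cubes r \<Omega>)"
  by (rule finite_subset[OF _ finite_cubes_meeting]) (use corner_in_grid in \<open>auto simp: inner_cubes_def\<close>)

lemma finite_boundary_cubes: "bounded \<Omega> \<Longrightarrow> r > 0 \<Longrightarrow> finite (boundary_cubes r \<Omega>)"
  by (rule finite_subset[OF _ finite_cubes_meeting]) (auto simp: boundary_cubes_def)

lemma subset_cubes:
  assumes "r > 0"
  shows "\<Omega> \<subseteq> (\<Union>z\<in>inner_cubes r \<Omega>. grid r z) \<union> (\<Union>z\<in>boundary_cubes r \<Omega>. grid r z)"
proof
  fix x assume "x \<in> \<Omega>"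
  moreover have "x \<in> grid r (\<chi> j. \<lfloor>x $ j / r\<rfloor>)" using assms by (simp add: mem_grid_iff)
  ultimately show "x \<in> (\<Union>z\<in>inner_cubes r \<Omega>. grid r z) \<union> (\<Union>z\<in>boundary_cubes r \<Omega>. grid r z)"
    unfolding inner_cubes_def boundary_cubes_def by blast
qed

section \<open>Total volume of the cubes that cross the boundary\<close>

lemma lmeasurable_infdist_neighbourhood:
  assumes F: "compact F" "F \<noteq> {}"
  shows "{x :: real^'n. infdist x F \<le> c} \<in> lmeasurable"
proof (rule lmeasurable_compact)
  obtain B where B: "\<And>x. x \<in> F \<Longrightarrow> norm x \<le> B" using compact_imp_bounded[OF F(1)] by (auto simp: bounded_iff)
  have "norm x \<le> B + c" if x: "infdist x F \<le> c" for x
  proof -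
    obtain y where y: "y \<in> F" "infdist x F = dist x y"
      using infdist_attains_inf[OF compact_imp_closed[OF F(1)] F(2)] by blast
    then have "norm (x - y) \<le> c" using x by (simp add: dist_norm)
    then show ?thesis using B[OF y(1)] norm_triangle_sub[of x y] by linarith
  qed
  then have "bounded {x. infdist x F \<le> c}" unfolding bounded_iff by blast
  moreover have "closed {x. infdist x F \<le> c}" by (intro closed_Collect_le continuous_intros)
  ultimately show "compact {x. infdist x F \<le> c}" by (simp add: compact_eq_bounded_closed)
qed

text \<open>The closed neighbourhoods are compact, hence of finite measure, and decrease to
  \<open>F\<close>; continuity of the measure from above gives the limit 0.\<close>

lemma measure_infdist_neighbourhood_tendsto:
  assumes F: "compact F" "F \<noteq> {}" "negligible (F :: (real^'n) set)"
  shows "(\<lambda>i. measure lebesgue {x. infdist x F \<le> 1 / real (Suc i)}) \<longlonglongrightarrow> 0"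
proof -
  let ?V = "\<lambda>i. {x. infdist x F \<le> 1 / real (Suc i)}"
  have lm: "?V i \<in> lmeasurable" for i by (rule lmeasurable_infdist_neighbourhood[OF F(1,2)])
  have "(\<lambda>i. measure lebesgue (?V i)) \<longlonglongrightarrow> measure lebesgue (\<Inter>i. ?V i)"
  proof (rule Lim_measure_decseq)
    show "range ?V \<subseteq> sets lebesgue" using lm by (auto simp: fmeasurable_def)
    show "emeasure lebesgue (?V i) \<noteq> \<infinity>" for i using lm[of i] by (auto simp: fmeasurable_def)
    show "decseq ?V"
    proof (rule decseq_SucI)
      fix i
      have "1 / real (Suc (Suc i)) \<le> 1 / real (Suc i)" by (intro divide_left_mono) auto
      then show "?V (Suc i) \<le> ?V i" by auto
    qed
  qed
  also have "(\<Inter>i. ?V i) = F"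
  proof
    show "(\<Inter>i. ?V i) \<subseteq> F"
    proof
      fix x assume "x \<in> (\<Inter>i. ?V i)"
      then have "infdist x F \<le> 1 / real (Suc i)" for i by simp
      then have "infdist x F \<le> 0"
        using LIMSEQ_inverse_real_of_nat by (intro LIMSEQ_le_const) (auto simp: inverse_eq_divide)
      then have "infdist x F = 0" using infdist_nonneg[of x F] by linarith
      then show "x \<in> F" using in_closed_iff_infdist_zero[OF compact_imp_closed[OF F(1)] F(2)] by simp
    qed
    show "F \<subseteq> (\<Inter>i. ?V i)" by (auto simp: infdist_zero)
  qed
  finally show ?thesis using negligible_imp_measure0[OF F(3)] by simp
qed

text \<open>A cube that meets both the set and its complement is connected and so meets the
  frontier. As its diameter is at most N r, it lies in a thin neighbourhood of the frontier, whose
  volume bounds that of all these disjoint cubes together.\<close>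

lemma boundary_cubes_volume_tendsto:
  fixes \<Omega> :: "(real^'n) set"
  assumes bdd: "bounded \<Omega>" and neg: "negligible (frontier \<Omega>)"
  shows "((\<lambda>r. r ^ CARD('n) * card (boundary_cubes r \<Omega>)) \<longlongrightarrow> 0) (at_right 0)"
proof (cases "frontier \<Omega> = {}")
  \<comment> \<open>The empty frontier needs its own argument: \<open>infdist x {}\<close> is 0, so
    that the neighbourhoods would be the whole space.\<close>
  case True
  have "boundary_cubes r \<Omega> = {}" for r
  proof -
    have "grid r z \<inter> \<Omega> = {} \<or> grid r z - \<Omega> = {}" for z
      using connected_Int_frontier[OF connected_grid, of r z \<Omega>] True by auto
    then show ?thesis unfolding boundary_cubes_def by blast
  qed
  then show ?thesis by simp
next
  case False
  let ?V = "\<lambda>i. {x. infdist x (frontier \<Omega>) \<le> 1 / real (Suc i)}"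
  have comp: "compact (frontier \<Omega>)" using bdd by (simp add: compact_frontier_bounded)
  note V = measure_infdist_neighbourhood_tendsto[OF comp False neg]
  show ?thesis
  proof (rule order_tendstoI)
    fix y :: real assume "y < 0"
    have "\<forall>\<^sub>F r in at_right (0 :: real). r > 0" by (simp add: eventually_at_right_less)
    then show "\<forall>\<^sub>F r in at_right 0. y < r ^ CARD('n) * card (boundary_cubes r \<Omega>)"
    proof eventually_elim
      case (elim r)
      then have "0 \<le> r ^ CARD('n) * card (boundary_cubes r \<Omega>)" by simp
      then show ?case using \<open>y < 0\<close> by linarith
    qed
  next
    fix y :: real assume "0 < y"
    from order_tendstoD(2)[OF V this] obtain i where i: "measure lebesgue (?V i) < y"
      by (auto simp: eventually_sequentially)
    have lmV: "?V i \<in> lmeasurable" by (rule lmeasurable_infdist_neighbourhood[OF comp False])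
    have "\<forall>\<^sub>F r in at_right 0. r \<in> {0<..<1 / (real CARD('n) * real (Suc i))}"
      by (intro eventually_at_right_real) simp
    then show "\<forall>\<^sub>F r in at_right 0. r ^ CARD('n) * card (boundary_cubes r \<Omega>) < y"
    proof eventually_elim
      case (elim r)
      have r: "r > 0" "CARD('n) * r \<le> 1 / real (Suc i)"
      proof -
        have e: "0 < r" "r < 1 / (real CARD('n) * real (Suc i))"
          using elim by (simp_all only: greaterThanLessThan_iff)
        show "r > 0" by (rule e)
        have "CARD('n) * r \<le> CARD('n) * (1 / (real CARD('n) * real (Suc i)))"
          by (rule mult_left_mono[OF less_imp_le[OF e(2)]]) simp
        then show "CARD('n) * r \<le> 1 / real (Suc i)" by simp
      qed
      have fin: "finite (boundary_cubes r \<Omega>)" using finite_boundary_cubes[OF bdd r(1)] .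
      have "grid r z \<subseteq> ?V i" if "z \<in> boundary_cubes r \<Omega>" for z
      proof
        fix x assume x: "x \<in> grid r z"
        have "grid r z \<inter> \<Omega> \<noteq> {}" "grid r z - \<Omega> \<noteq> {}" using that by (auto simp: boundary_cubes_def)
        then have "grid r z \<inter> frontier \<Omega> \<noteq> {}" by (rule connected_Int_frontier[OF connected_grid])
        then obtain x' where x': "x' \<in> grid r z" "x' \<in> frontier \<Omega>" by blast
        have "infdist x (frontier \<Omega>) \<le> dist x x'" by (rule infdist_le[OF x'(2)])
        also have "\<dots> \<le> CARD('n) * r"
          unfolding dist_norm using x x'(1) unfolding grid_def by (rule norm_diff_rcube_le)
        finally show "x \<in> ?V i" using r(2) by simp
      qed
      then have sub: "(\<Union>z\<in>boundary_cubes r \<Omega>. grid r z) \<subseteq> ?V i" by blast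
      have "measure lebesgue (\<Union>z\<in>boundary_cubes r \<Omega>. grid r z) = (\<Sum>z\<in>boundary_cubes r \<Omega>. measure lebesgue (grid r z))"
        using fin grid_lmeasurable[OF r(1)] grid_disjoint[OF r(1)]
        by (intro measure_UNION') (auto simp: pairwise_def disjnt_def)
      also have "\<dots> = r ^ CARD('n) * card (boundary_cubes r \<Omega>)" by (simp add: measure_grid[OF r(1)])
      finally have "r ^ CARD('n) * card (boundary_cubes r \<Omega>) \<le> measure lebesgue (?V i)"
        using measure_mono_fmeasurable[OF sub _ lmV] fin grid_lmeasurable[OF r(1)]
        by (metis (no_types, lifting) fmeasurableD sets.finite_UN)
      then show ?case using i by linarith
    qed
  qed
qed

lemma set_integrableI_integrable:
  fixes f :: "_ \<Rightarrow> _ :: {banach, second_countable_topology}"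
  shows "integrable M f \<Longrightarrow> A \<in> sets M \<Longrightarrow> set_integrable M A f"
  unfolding set_integrable_def by (rule integrable_mult_indicator)

lemma norm_set_integral_le_measure:
  fixes f :: "_ \<Rightarrow> _ :: {banach, second_countable_topology}"
  assumes "set_integrable M A f" "A \<in> sets M" "emeasure M A \<noteq> \<infinity>" "\<And>x. x \<in> A \<Longrightarrow> norm (f x) \<le> c"
  shows "norm (LINT x:A|M. f x) \<le> measure M A * c"
proof -
  have "norm (LINT x:A|M. f x) \<le> (LINT x:A|M. norm (f x))"
    by (rule set_integral_norm_bound[OF assms(1)])
  also have "\<dots> \<le> (LINT x:A|M. c)"
    using assms by (intro set_integral_mono set_integrable_norm) (auto simp: set_integrable_def less_top)
  also have "\<dots> = measure M A * c" using set_integral_const[OF assms(2,3), of c] by simp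
  finally show ?thesis .
qed

lemma finite_measure_lebesgue_on_lmeasurable:
  assumes "\<Omega> \<in> lmeasurable"
  shows "finite_measure (lebesgue_on \<Omega>)"
  using assms by (auto intro!: finite_measureI simp: emeasure_restrict_space fmeasurable_def space_restrict_space)

lemma
  fixes \<Omega> :: "(real^'n) set"
  assumes \<Omega>: "\<Omega> \<in> sets lebesgue" and A: "A \<in> lmeasurable" "A \<subseteq> \<Omega>"
  shows sets_lebesgue_on_subset: "A \<in> sets (lebesgue_on \<Omega>)"
    and measure_lebesgue_on_subset: "measure (lebesgue_on \<Omega>) A = measure lebesgue A"
    and emeasure_lebesgue_on_subset: "emeasure (lebesgue_on \<Omega>) A \<noteq> \<infinity>"
  using assms by (auto simp: sets_restrict_space_iff measure_restrict_space emeasure_restrict_space fmeasurable_def)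

section \<open>Lattice cells and the boxes of lattice points inside grid cubes\<close>

definition cell :: "real \<Rightarrow> int^'n \<Rightarrow> (real^'n) set" where
  "cell \<epsilon> i = rcube (\<epsilon> *\<^sub>R lat i - (\<chi> j. \<epsilon> / 2)) \<epsilon>"

lemma cell_eq_W_cube:
  assumes "\<epsilon> > 0"
  shows "cell \<epsilon> i = (\<lambda>w. \<epsilon> *\<^sub>R (lat i + w)) ` W_cube"
proof
  show "cell \<epsilon> i \<subseteq> (\<lambda>w. \<epsilon> *\<^sub>R (lat i + w)) ` W_cube"
  proof
    fix x assume "x \<in> cell \<epsilon> i"
    then have x: "\<epsilon> * lat i $ j - \<epsilon> / 2 \<le> x $ j \<and> x $ j < \<epsilon> * lat i $ j + \<epsilon> / 2" for j
      by (auto simp: cell_def rcube_def dest!: spec[of _ j])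
    have "(1 / \<epsilon>) *\<^sub>R x - lat i \<in> W_cube"
    proof -
      have "x $ j / \<epsilon> - lat i $ j \<ge> - 1 / 2 \<and> x $ j / \<epsilon> - lat i $ j < 1 / 2" for j
        using x[of j] assms by (simp add: field_simps)
      then show ?thesis by (simp add: W_cube_def)
    qed
    moreover have "x = \<epsilon> *\<^sub>R (lat i + ((1 / \<epsilon>) *\<^sub>R x - lat i))" using assms by simp
    ultimately show "x \<in> (\<lambda>w. \<epsilon> *\<^sub>R (lat i + w)) ` W_cube" by blast
  qed
  show "(\<lambda>w. \<epsilon> *\<^sub>R (lat i + w)) ` W_cube \<subseteq> cell \<epsilon> i"
  proof
    fix x assume "x \<in> (\<lambda>w. \<epsilon> *\<^sub>R (lat i + w)) ` W_cube"
    then obtain w where x: "x = \<epsilon> *\<^sub>R (lat i + w)" "\<And>j. - 1 / 2 \<le> w $ j" "\<And>j. w $ j < 1 / 2"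
      by (auto simp: W_cube_def)
    have "\<epsilon> * (- 1 / 2) \<le> \<epsilon> * w $ j" "\<epsilon> * w $ j < \<epsilon> * (1 / 2)" for j
      using x(2,3)[of j] assms by (intro mult_left_mono mult_strict_left_mono; simp)+
    from this[simplified] show "x \<in> cell \<epsilon> i"
      by (simp add: cell_def rcube_def x(1) distrib_left)
  qed
qed

lemma mem_cell_iff: "\<epsilon> > 0 \<Longrightarrow> x \<in> cell \<epsilon> i \<longleftrightarrow> i = (\<chi> j. \<lfloor>x $ j / \<epsilon> + 1 / 2\<rfloor>)"
  by (simp add: cell_def rcube_def lat_def vec_eq_iff)
    (intro iff_allI; subst eq_commute, simp add: floor_eq_iff field_simps)

lemma center_in_cell: "\<epsilon> > 0 \<Longrightarrow> \<epsilon> *\<^sub>R lat i \<in> cell \<epsilon> i"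
  by (simp add: cell_def rcube_def)

lemma cell_disjoint: "\<epsilon> > 0 \<Longrightarrow> i \<noteq> i' \<Longrightarrow> cell \<epsilon> i \<inter> cell \<epsilon> i' = {}"
  by (auto simp: mem_cell_iff)

lemma measure_cell: "\<epsilon> > 0 \<Longrightarrow> measure lebesgue (cell \<epsilon> (i :: int^'n)) = \<epsilon> ^ CARD('n)"
  by (simp add: cell_def measure_rcube)

lemma cell_lmeasurable: "\<epsilon> > 0 \<Longrightarrow> cell \<epsilon> i \<in> lmeasurable"
  by (simp add: cell_def rcube_lmeasurable)

text \<open>The \<open>\<epsilon>\<close>-cells of \<open>lbox r \<epsilon> z\<close> lie in \<open>grid r z\<close>; the shifts by \<open>1\<close> and \<open>1/2\<close> make room for
  half a cell on each side.\<close>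

definition lside :: "real \<Rightarrow> real \<Rightarrow> nat" where
  "lside r \<epsilon> = nat (\<lfloor>r / \<epsilon>\<rfloor> - 1)"

definition lcorner :: "real \<Rightarrow> real \<Rightarrow> int^'n \<Rightarrow> int^'n" where
  "lcorner r \<epsilon> z = (\<chi> j. \<lceil>r * z $ j / \<epsilon> + 1 / 2\<rceil>)"

abbreviation lbox :: "real \<Rightarrow> real \<Rightarrow> int^'n \<Rightarrow> (int^'n) set" where
  "lbox r \<epsilon> z \<equiv> ibox (lcorner r \<epsilon> z) (lside r \<epsilon>)"

lemma cell_subset_grid:
  assumes "r > 0" "\<epsilon> > 0" "i \<in> lbox r \<epsilon> z"
  shows "cell \<epsilon> i \<subseteq> grid r z"
proof
  fix x assume "x \<in> cell \<epsilon> i"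
  then have x: "\<epsilon> * i $ j - \<epsilon> / 2 \<le> x $ j" "x $ j < \<epsilon> * i $ j + \<epsilon> / 2" for j
    by (auto simp: cell_def rcube_def lat_def dest!: spec[of _ j])
  have "r * z $ j \<le> x $ j \<and> x $ j < r * z $ j + r" for j
  proof -
    have i: "\<lceil>r * z $ j / \<epsilon> + 1 / 2\<rceil> \<le> i $ j" "i $ j < \<lceil>r * z $ j / \<epsilon> + 1 / 2\<rceil> + int (nat (\<lfloor>r / \<epsilon>\<rfloor> - 1))"
      using assms(3) by (auto simp: ibox_def lcorner_def lside_def)
    then have "nat (\<lfloor>r / \<epsilon>\<rfloor> - 1) > 0" by linarith
    then have "i $ j \<le> \<lceil>r * z $ j / \<epsilon> + 1 / 2\<rceil> + \<lfloor>r / \<epsilon>\<rfloor> - 2" using i(2) by linarith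
    then have "real_of_int (i $ j) + 1 / 2 \<le> r * z $ j / \<epsilon> + r / \<epsilon>" by linarith
    then have "\<epsilon> * (real_of_int (i $ j) + 1 / 2) \<le> \<epsilon> * (r * z $ j / \<epsilon> + r / \<epsilon>)"
      using assms(2) by (intro mult_left_mono) auto
    then have up: "\<epsilon> * i $ j + \<epsilon> / 2 \<le> r * z $ j + r" using assms(2) by (simp add: distrib_left)
    have "r * z $ j / \<epsilon> \<le> real_of_int (i $ j) - 1 / 2" using i(1) by linarith
    then have "\<epsilon> * (r * z $ j / \<epsilon>) \<le> \<epsilon> * (real_of_int (i $ j) - 1 / 2)"
      using assms(2) by (intro mult_left_mono) auto
    then have "r * z $ j \<le> \<epsilon> * i $ j - \<epsilon> / 2" using assms(2) by (simp add: right_diff_distrib)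
    then show ?thesis using up x[of j] by linarith
  qed
  then show "x \<in> grid r z" by (simp add: grid_def rcube_def lat_def)
qed

lemma lbox_disjoint:
  assumes "r > 0" "\<epsilon> > 0" "z \<noteq> z'"
  shows "lbox r \<epsilon> z \<inter> lbox r \<epsilon> z' = {}"
  using cell_subset_grid[OF assms(1,2)] center_in_cell[OF assms(2)] grid_disjoint[OF assms(1,3)] by blast

lemma lbox_subset_Z_eps:
  assumes "r > 0" "\<epsilon> > 0" "z \<in> inner_cubes r \<Omega>"
  shows "lbox r \<epsilon> z \<subseteq> Z_eps \<epsilon> \<Omega>"
  using cell_subset_grid[OF assms(1,2)] center_in_cell[OF assms(2)] assms(3)
  unfolding Z_eps_def inner_cubes_def by blast

lemma lside_le: "r > 0 \<Longrightarrow> \<epsilon> > 0 \<Longrightarrow> \<epsilon> * lside r \<epsilon> \<le> r"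
proof -
  assume "r > 0" "\<epsilon> > 0"
  then have "r / \<epsilon> > 0" by simp
  then have "real (lside r \<epsilon>) \<le> r / \<epsilon>" unfolding lside_def by linarith
  then have "\<epsilon> * lside r \<epsilon> \<le> \<epsilon> * (r / \<epsilon>)" using \<open>\<epsilon> > 0\<close> by (intro mult_left_mono) auto
  then show ?thesis using \<open>\<epsilon> > 0\<close> by simp
qed

lemma lside_tendsto:
  assumes "r > 0"
  shows "((\<lambda>\<epsilon>. \<epsilon> * lside r \<epsilon>) \<longlongrightarrow> r) (at_right 0)"
proof (rule tendsto_sandwich)
  have "\<forall>\<^sub>F \<epsilon> in at_right 0. \<epsilon> \<in> {0<..<r}" using assms by (rule eventually_at_right_real)
  then show "\<forall>\<^sub>F \<epsilon> in at_right 0. r - 2 * \<epsilon> \<le> \<epsilon> * lside r \<epsilon>"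
  proof eventually_elim
    case (elim \<epsilon>)
    have "r / \<epsilon> - 2 \<le> real (lside r \<epsilon>)" unfolding lside_def by linarith
    then have "\<epsilon> * (r / \<epsilon> - 2) \<le> \<epsilon> * lside r \<epsilon>" using elim by (intro mult_left_mono) auto
    then show ?case using elim by (simp add: algebra_simps)
  qed
  have "\<forall>\<^sub>F \<epsilon> in at_right 0. \<epsilon> \<in> {0<..<r}" using assms by (rule eventually_at_right_real)
  then show "\<forall>\<^sub>F \<epsilon> in at_right 0. \<epsilon> * lside r \<epsilon> \<le> r"
    by eventually_elim (use assms in \<open>auto intro: lside_le\<close>)
  have "((\<lambda>\<epsilon>. r - 2 * \<epsilon>) \<longlongrightarrow> r - 2 * 0) (at_right 0)" by (intro tendsto_intros)
  then show "((\<lambda>\<epsilon>. r - 2 * \<epsilon>) \<longlongrightarrow> r) (at_right 0)" by simp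
qed simp

lemma eventually_lside_ge:
  assumes "r > 0"
  shows "\<forall>\<^sub>F \<epsilon> in at_right 0. lside r \<epsilon> \<ge> n"
proof -
  have "\<forall>\<^sub>F \<epsilon> in at_right 0. \<epsilon> \<in> {0<..<r / (n + 2)}" using assms by (intro eventually_at_right_real) simp
  then show ?thesis
  proof eventually_elim
    case (elim \<epsilon>)
    then have "real n + 2 < r / \<epsilon>" by (simp add: field_simps)
    then show ?case unfolding lside_def by linarith
  qed
qed

lemma
  fixes z :: "int^'n"
  assumes "r > 0" "\<epsilon> > 0"
  shows finite_Z_eps_grid: "finite (Z_eps \<epsilon> (grid r z))"
    and card_Z_eps_grid_le: "\<epsilon> ^ CARD('n) * card (Z_eps \<epsilon> (grid r z)) \<le> (r + \<epsilon>) ^ CARD('n)"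
proof -
  let ?B = "ibox (\<chi> j. \<lceil>r * z $ j / \<epsilon>\<rceil>) (nat \<lceil>r / \<epsilon>\<rceil>)"
  have sub: "Z_eps \<epsilon> (grid r z) \<subseteq> ?B"
  proof
    fix i assume "i \<in> Z_eps \<epsilon> (grid r z)"
    then have i: "r * z $ j \<le> \<epsilon> * i $ j \<and> \<epsilon> * i $ j < r * z $ j + r" for j
      by (auto simp: Z_eps_def grid_def rcube_def lat_def)
    have "\<lceil>r * z $ j / \<epsilon>\<rceil> \<le> i $ j \<and> i $ j < \<lceil>r * z $ j / \<epsilon>\<rceil> + int (nat \<lceil>r / \<epsilon>\<rceil>)" for j
    proof -
      have "r * z $ j / \<epsilon> \<le> real_of_int (i $ j)" "real_of_int (i $ j) < r * z $ j / \<epsilon> + r / \<epsilon>"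
        using i[of j] assms(2) by (auto simp: field_simps)
      then show ?thesis by linarith
    qed
    then show "i \<in> ?B" by (simp add: ibox_def)
  qed
  show "finite (Z_eps \<epsilon> (grid r z))" using sub by (rule finite_subset) simp
  have "card (Z_eps \<epsilon> (grid r z)) \<le> card ?B" by (rule card_mono[OF finite_ibox sub])
  then have "\<epsilon> ^ CARD('n) * card (Z_eps \<epsilon> (grid r z)) \<le> \<epsilon> ^ CARD('n) * real (nat \<lceil>r / \<epsilon>\<rceil>) ^ CARD('n)"
    using assms(2) by (intro mult_left_mono) (simp_all flip: of_nat_power)
  also have "\<dots> = (\<epsilon> * real (nat \<lceil>r / \<epsilon>\<rceil>)) ^ CARD('n)" by (simp add: power_mult_distrib)
  also have "\<dots> \<le> (r + \<epsilon>) ^ CARD('n)"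
  proof (rule power_mono)
    have "r / \<epsilon> > 0" using assms by simp
    then have "real (nat \<lceil>r / \<epsilon>\<rceil>) \<le> r / \<epsilon> + 1" by linarith
    then have "\<epsilon> * real (nat \<lceil>r / \<epsilon>\<rceil>) \<le> \<epsilon> * (r / \<epsilon> + 1)" using assms by (intro mult_left_mono) auto
    then show "\<epsilon> * real (nat \<lceil>r / \<epsilon>\<rceil>) \<le> r + \<epsilon>" using assms by (simp add: algebra_simps)
    show "0 \<le> \<epsilon> * real (nat \<lceil>r / \<epsilon>\<rceil>)" using assms(2) by (intro mult_nonneg_nonneg) simp_all
  qed
  finally show "\<epsilon> ^ CARD('n) * card (Z_eps \<epsilon> (grid r z)) \<le> (r + \<epsilon>) ^ CARD('n)" .
qed

lemma Z_eps_subset_cubes: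
  assumes "r > 0"
  shows "Z_eps \<epsilon> \<Omega> \<subseteq> (\<Union>z\<in>inner_cubes r \<Omega> \<union> boundary_cubes r \<Omega>. Z_eps \<epsilon> (grid r z))"
  using subset_cubes[OF assms, of \<Omega>] by (auto simp: Z_eps_def)

lemma finite_Z_eps:
  assumes "bounded \<Omega>" "\<epsilon> > 0"
  shows "finite (Z_eps \<epsilon> (\<Omega> :: (real^'n) set))"
proof (rule finite_subset[OF Z_eps_subset_cubes[OF zero_less_one]], rule finite_UN_I)
  show "finite (inner_cubes 1 \<Omega> \<union> boundary_cubes 1 \<Omega>)"
    using finite_inner_cubes[OF assms(1)] finite_boundary_cubes[OF assms(1)] by simp
  show "finite (Z_eps \<epsilon> (grid 1 z))" for z :: "int^'n"
    by (rule finite_Z_eps_grid[OF zero_less_one assms(2)])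
qed

definition leftover :: "real \<Rightarrow> (real^'n) set \<Rightarrow> real \<Rightarrow> real" where
  "leftover r \<Omega> \<epsilon> = \<epsilon> ^ CARD('n) *
     (real (card (Z_eps \<epsilon> \<Omega>)) - real (card (inner_cubes r \<Omega>)) * real (lside r \<epsilon>) ^ CARD('n))"

text \<open>Every lattice point of the domain lies in an inner or a boundary cube, and a grid cube
  contains lattice points of total weight at most \<open>(r + \<epsilon>) ^ CARD('n)\<close>. After
  subtracting the boxes of the inner cubes, whose weight tends to that of the full cubes, only the
  volume of the boundary cubes is left in the limit for fixed \<open>r\<close>.\<close>

lemma eventually_leftover_less:
  fixes \<Omega> :: "(real^'n) set"
  assumes bdd: "bounded \<Omega>" and r: "r > 0" and \<delta>: "r ^ CARD('n) * card (boundary_cubes r \<Omega>) < \<delta>"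
  shows "\<forall>\<^sub>F \<epsilon> in at_right 0. leftover r \<Omega> \<epsilon> < \<delta>"
proof -
  let ?I = "inner_cubes r \<Omega>" and ?J = "boundary_cubes r \<Omega>" and ?N = "CARD('n)"
  have fin: "finite ?I" "finite ?J" using finite_inner_cubes finite_boundary_cubes bdd r by auto
  have "?I \<inter> ?J = {}" by (auto simp: inner_cubes_def boundary_cubes_def)
  then have cIJ: "real (card (?I \<union> ?J)) = real (card ?I) + real (card ?J)"
    using fin by (simp add: card_Un_disjoint)
  let ?g = "\<lambda>\<epsilon>. real (card (?I \<union> ?J)) * (r + \<epsilon>) ^ ?N - real (card ?I) * (\<epsilon> * lside r \<epsilon>) ^ ?N"
  have "(?g \<longlongrightarrow> real (card (?I \<union> ?J)) * (r + 0) ^ ?N - real (card ?I) * r ^ ?N) (at_right 0)"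
    by (intro tendsto_intros lside_tendsto r)
  then have "(?g \<longlongrightarrow> r ^ ?N * card ?J) (at_right 0)" unfolding cIJ by (simp add: algebra_simps)
  then have "\<forall>\<^sub>F \<epsilon> in at_right 0. ?g \<epsilon> < \<delta>" using \<delta> by (rule order_tendstoD(2))
  moreover have "\<forall>\<^sub>F \<epsilon> in at_right (0 :: real). \<epsilon> > 0" by (simp add: eventually_at_right_less)
  ultimately show ?thesis
  proof eventually_elim
    case (elim \<epsilon>)
    have "card (Z_eps \<epsilon> \<Omega>) \<le> card (\<Union>z\<in>?I \<union> ?J. Z_eps \<epsilon> (grid r z))"
      using fin finite_Z_eps_grid[OF r elim(2)] by (intro card_mono Z_eps_subset_cubes[OF r]) auto
    also have "\<dots> \<le> (\<Sum>z\<in>?I \<union> ?J. card (Z_eps \<epsilon> (grid r z)))"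
      using fin by (intro card_UN_le) auto
    finally have "real (card (Z_eps \<epsilon> \<Omega>)) \<le> (\<Sum>z\<in>?I \<union> ?J. real (card (Z_eps \<epsilon> (grid r z))))"
      by (metis of_nat_le_iff of_nat_sum)
    then have "\<epsilon> ^ ?N * real (card (Z_eps \<epsilon> \<Omega>)) \<le> \<epsilon> ^ ?N * (\<Sum>z\<in>?I \<union> ?J. real (card (Z_eps \<epsilon> (grid r z))))"
      using elim(2) by (intro mult_left_mono) auto
    also have "\<dots> \<le> (\<Sum>z\<in>?I \<union> ?J. (r + \<epsilon>) ^ ?N)"
      unfolding sum_distrib_left by (intro sum_mono card_Z_eps_grid_le r elim(2))
    finally have "\<epsilon> ^ ?N * real (card (Z_eps \<epsilon> \<Omega>)) \<le> real (card (?I \<union> ?J)) * (r + \<epsilon>) ^ ?N" by simp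
    then have "leftover r \<Omega> \<epsilon> \<le> ?g \<epsilon>"
      unfolding leftover_def by (simp add: algebra_simps)
    then show ?case using elim(1) by linarith
  qed
qed

lemma C_eps_cell_eq:
  assumes "\<epsilon> > 0" "y \<in> C_eps \<epsilon> \<Omega>" "i \<in> Z_eps \<epsilon> \<Omega>" "x \<in> cell \<epsilon> i" "x \<in> \<Omega>"
  shows "y x = y (\<epsilon> *\<^sub>R lat i)"
  using assms cell_eq_W_cube[OF assms(1)] unfolding C_eps_def by blast

text \<open>On the cells of the box the function is constant, so their contribution to the integral
  is exactly the weighted sum. The difference is the integral over the uncovered part of the grid
  cube, where the norm is 1.\<close>

lemma set_integral_grid_approx:
  fixes \<Omega> :: "(real^'n) set"
  assumes \<Omega>: "\<Omega> \<in> sets lebesgue" and y: "y \<in> C_eps \<epsilon> \<Omega>" "integrable (lebesgue_on \<Omega>) y"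
    and r: "r > 0" and \<epsilon>: "\<epsilon> > 0" and z: "z \<in> inner_cubes r \<Omega>"
  shows "norm ((LINT x:grid r z|lebesgue_on \<Omega>. y x) - \<epsilon> ^ CARD('n) *\<^sub>R (\<Sum>i\<in>lbox r \<epsilon> z. y (\<epsilon> *\<^sub>R lat i)))
    \<le> r ^ CARD('n) - (\<epsilon> * lside r \<epsilon>) ^ CARD('n)"
proof -
  let ?M = "lebesgue_on \<Omega>" and ?N = "CARD('n)" and ?L = "lbox r \<epsilon> z"
  define U where "U = (\<Union>i\<in>?L. cell \<epsilon> i)"
  have gO: "grid r z \<subseteq> \<Omega>" using z by (simp add: inner_cubes_def)
  have Ug: "U \<subseteq> grid r z" using cell_subset_grid[OF r \<epsilon>] by (auto simp: U_def)
  have cellO: "cell \<epsilon> i \<subseteq> \<Omega>" if "i \<in> ?L" for i using cell_subset_grid[OF r \<epsilon> that] gO by blast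
  note sets = sets_lebesgue_on_subset[OF \<Omega>]
  have sc: "cell \<epsilon> i \<in> sets ?M" if "i \<in> ?L" for i by (intro sets cell_lmeasurable \<epsilon> cellO that)
  have sg: "grid r z \<in> sets ?M" by (intro sets grid_lmeasurable r gO)
  have Ulm: "U \<in> lmeasurable" unfolding U_def by (intro fmeasurable.finite_UN cell_lmeasurable \<epsilon>) auto
  have sU: "U \<in> sets ?M" using Ulm Ug gO by (intro sets) auto
  have Dlm: "grid r z - U \<in> lmeasurable" using grid_lmeasurable[OF r] Ulm by (rule fmeasurable.Diff)
  have sD: "grid r z - U \<in> sets ?M" using sg sU by simp
  note int = set_integrableI_integrable[OF y(2)]
  have S: "y x \<in> sphere_tensor" if "x \<in> \<Omega>" for x using y(1) that by (simp add: C_eps_def)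
  have "(LINT x:grid r z|?M. y x) = (LINT x:U \<union> (grid r z - U)|?M. y x)"
    using Ug by (simp add: Un_absorb1)
  also have "\<dots> = (LINT x:U|?M. y x) + (LINT x:grid r z - U|?M. y x)"
    by (intro set_integral_Un int sU sD) auto
  also have "(LINT x:U|?M. y x) = (\<Sum>i\<in>?L. LINT x:cell \<epsilon> i|?M. y x)"
    unfolding U_def using cell_disjoint[OF \<epsilon>]
    by (intro set_integral_finite_Union int sc) (auto simp: disjoint_family_on_def)
  also have "\<dots> = (\<Sum>i\<in>?L. \<epsilon> ^ ?N *\<^sub>R y (\<epsilon> *\<^sub>R lat i))"
  proof (rule sum.cong)
    fix i assume i: "i \<in> ?L"
    have iZ: "i \<in> Z_eps \<epsilon> \<Omega>" using lbox_subset_Z_eps[OF r \<epsilon> z] i by blast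
    have "(LINT x:cell \<epsilon> i|?M. y x) = (LINT x:cell \<epsilon> i|?M. y (\<epsilon> *\<^sub>R lat i))"
      using C_eps_cell_eq[OF \<epsilon> y(1) iZ] cellO[OF i] by (intro set_lebesgue_integral_cong sc i) auto
    also have "\<dots> = measure ?M (cell \<epsilon> i) *\<^sub>R y (\<epsilon> *\<^sub>R lat i)"
      by (intro set_integral_const sc i emeasure_lebesgue_on_subset[OF \<Omega> cell_lmeasurable[OF \<epsilon>] cellO])
    also have "measure ?M (cell \<epsilon> i) = \<epsilon> ^ ?N"
      using measure_lebesgue_on_subset[OF \<Omega> cell_lmeasurable[OF \<epsilon>] cellO[OF i]] by (simp add: measure_cell[OF \<epsilon>])
    finally show "(LINT x:cell \<epsilon> i|?M. y x) = \<epsilon> ^ ?N *\<^sub>R y (\<epsilon> *\<^sub>R lat i)" .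
  qed simp
  finally have "(LINT x:grid r z|?M. y x) - \<epsilon> ^ ?N *\<^sub>R (\<Sum>i\<in>?L. y (\<epsilon> *\<^sub>R lat i)) = (LINT x:grid r z - U|?M. y x)"
    by (simp add: scaleR_sum_right)
  moreover have "norm (LINT x:grid r z - U|?M. y x) \<le> measure ?M (grid r z - U) * 1"
  proof (intro norm_set_integral_le_measure int sD emeasure_lebesgue_on_subset[OF \<Omega> Dlm])
    show "grid r z - U \<subseteq> \<Omega>" using gO by blast
    show "norm (y x) \<le> 1" if "x \<in> grid r z - U" for x
      using norm_sphere_tensor[OF S, of x] that gO by auto
  qed
  moreover have "measure ?M (grid r z - U) = r ^ ?N - (\<epsilon> * lside r \<epsilon>) ^ ?N"
  proof -
    have "measure ?M (grid r z - U) = measure lebesgue (grid r z - U)"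
      using gO Dlm by (intro measure_lebesgue_on_subset[OF \<Omega>]) auto
    also have "\<dots> = measure lebesgue (grid r z) - measure lebesgue U"
      using grid_lmeasurable[OF r] Ulm Ug by (intro measurable_measure_Diff) auto
    also have "measure lebesgue U = (\<Sum>i\<in>?L. measure lebesgue (cell \<epsilon> i))"
      unfolding U_def using cell_disjoint[OF \<epsilon>] cell_lmeasurable[OF \<epsilon>]
      by (intro measure_UNION') (auto simp: pairwise_def disjnt_def)
    finally show ?thesis by (simp add: measure_grid[OF r] measure_cell[OF \<epsilon>] power_mult_distrib mult.commute)
  qed
  ultimately show ?thesis by simp
qed

section \<open>Averages on grid cubes\<close>

text \<open>The function is first truncated at a level \<open>k\<close>, then approximated almost
  everywhere by continuous functions; both limits pass to the integral by dominated
  convergence.\<close>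

lemma L1_approx_continuous:
  fixes \<phi> :: "real^'n \<Rightarrow> 'b::euclidean_space"
  assumes \<Omega>: "\<Omega> \<in> lmeasurable" and int: "integrable (lebesgue_on \<Omega>) \<phi>" and \<eta>: "\<eta> > 0"
  shows "\<exists>g B. continuous_on UNIV g \<and> (\<forall>x. norm (g x) \<le> B) \<and>
    (LINT x|lebesgue_on \<Omega>. norm (\<phi> x - g x)) < \<eta>"
proof -
  let ?M = "lebesgue_on \<Omega>"
  interpret finite_measure ?M using \<Omega> by (rule finite_measure_lebesgue_on_lmeasurable)
  have \<Omega>s: "\<Omega> \<in> sets lebesgue" using \<Omega> by (rule fmeasurableD)
  have \<phi>m: "\<phi> \<in> borel_measurable ?M" using int by (rule borel_measurable_integrable)
  define t where "t k x = (if norm (\<phi> x) \<le> real k then \<phi> x else 0)" for k :: nat and x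
  have tm: "t k \<in> borel_measurable ?M" for k unfolding t_def using \<phi>m by measurable
  have "(\<lambda>k. LINT x|?M. norm (\<phi> x - t k x)) \<longlonglongrightarrow> (LINT x|?M. 0)"
  proof (rule integral_dominated_convergence[where w = "\<lambda>x. norm (\<phi> x)"])
    show "AE x in ?M. (\<lambda>k. norm (\<phi> x - t k x)) \<longlonglongrightarrow> 0"
    proof (rule AE_I2)
      fix x
      obtain k0 :: nat where k0: "norm (\<phi> x) \<le> real k0" using real_arch_simple by blast
      have "\<forall>\<^sub>F k in sequentially. norm (\<phi> x - t k x) = 0"
        using eventually_ge_at_top[of k0]
      proof eventually_elim
        case (elim k)
        then have "norm (\<phi> x) \<le> real k" using k0 by linarith
        then show ?case by (simp add: t_def)
      qed
      then show "(\<lambda>k. norm (\<phi> x - t k x)) \<longlonglongrightarrow> 0" by (rule tendsto_eventually)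
    qed
    show "AE x in ?M. norm (norm (\<phi> x - t k x)) \<le> norm (\<phi> x)" for k by (auto simp: t_def)
  qed (use \<phi>m tm int in auto)
  then have "\<forall>\<^sub>F k in sequentially. (LINT x|?M. norm (\<phi> x - t k x)) < \<eta> / 2"
    using \<eta> by (intro order_tendstoD(2)[of _ "LINT x|?M. 0"]) auto
  then obtain k where k: "(LINT x|?M. norm (\<phi> x - t k x)) < \<eta> / 2"
    unfolding eventually_sequentially by blast
  have tk: "norm (t k x) \<le> real k" for x by (simp add: t_def)
  have t_int: "integrable ?M (t k)" using tm tk by (intro integrable_const_bound[of _ "real k"]) auto
  have "t k measurable_on \<Omega>" using measurable_on_iff_borel_measurable[OF \<Omega>s] tm by blast
  then obtain N g where N: "negligible N" and "\<forall>n. continuous_on UNIV (g n)"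
    and "\<forall>x. x \<notin> N \<longrightarrow> (\<lambda>n. g n x) \<longlonglongrightarrow> (if x \<in> \<Omega> then t k x else 0)"
    unfolding measurable_on_def by (elim exE conjE) (rule that)
  note g = this(2)[rule_format] and lim = this(3)[rule_format]
  \<comment> \<open>The approximants \<open>g n\<close> may be unbounded. Projection onto the ball
    of radius \<open>k\<close>, which contains all values of \<open>t k\<close>, keeps continuity
    and convergence and provides the majorant \<open>2 * real k\<close>.\<close>
  let ?c = "closest_point (cball (0 :: 'b) (real k))"
  have c: "continuous_on UNIV ?c" by (intro continuous_on_closest_point) auto
  have cb: "norm (?c y) \<le> real k" for y
    using closest_point_in_set[of "cball (0 :: 'b) (real k)" y] by simp
  define h where "h n x = ?c (g n x)" for n x
  have h: "continuous_on UNIV (h n)" for n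
    unfolding h_def by (rule continuous_on_compose2[OF c g]) simp
  have hm: "h n \<in> borel_measurable ?M" for n
    using continuous_imp_measurable_on_sets_lebesgue[OF continuous_on_subset[OF h subset_UNIV] \<Omega>s] .
  have "AE x in lebesgue. x \<notin> N" using N by (intro AE_not_in) (simp add: negligible_iff_null_sets)
  then have AEN: "AE x in ?M. x \<notin> N" using \<Omega>s by (simp add: AE_restrict_space_iff) (auto elim: eventually_mono)
  have "(\<lambda>n. LINT x|?M. norm (t k x - h n x)) \<longlonglongrightarrow> (LINT x|?M. 0)"
  proof (rule integral_dominated_convergence[where w = "\<lambda>x. 2 * real k"])
    show "AE x in ?M. (\<lambda>n. norm (t k x - h n x)) \<longlonglongrightarrow> 0"
      using AEN AE_space
    proof eventually_elim
      case (elim x)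
      then have "(\<lambda>n. g n x) \<longlonglongrightarrow> t k x" using lim[of x] by (simp add: space_restrict_space)
      then have "(\<lambda>n. h n x) \<longlonglongrightarrow> ?c (t k x)"
        unfolding h_def by (rule continuous_on_tendsto_compose[OF c]) auto
      also have "?c (t k x) = t k x" using tk[of x] by (intro closest_point_self) simp
      finally have "(\<lambda>n. norm (t k x - h n x)) \<longlonglongrightarrow> norm (t k x - t k x)" by (intro tendsto_intros)
      then show ?case by simp
    qed
    show "AE x in ?M. norm (norm (t k x - h n x)) \<le> 2 * real k" for n
    proof (rule AE_I2)
      fix x
      show "norm (norm (t k x - h n x)) \<le> 2 * real k"
        using norm_triangle_ineq4[of "t k x" "h n x"] tk[of x] cb[of "g n x"] by (simp add: h_def)
    qed
  qed (use tm hm in auto)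
  then have "\<forall>\<^sub>F n in sequentially. (LINT x|?M. norm (t k x - h n x)) < \<eta> / 2"
    using \<eta> by (intro order_tendstoD(2)[of _ "LINT x|?M. 0"]) auto
  then obtain n where n: "(LINT x|?M. norm (t k x - h n x)) < \<eta> / 2"
    unfolding eventually_sequentially by blast
  have h_int: "integrable ?M (h n)" using hm cb by (intro integrable_const_bound[of _ "real k"]) (auto simp: h_def)
  have "(LINT x|?M. norm (\<phi> x - h n x)) \<le> (LINT x|?M. norm (\<phi> x - t k x) + norm (t k x - h n x))"
  proof (rule integral_mono)
    show "norm (\<phi> x - h n x) \<le> norm (\<phi> x - t k x) + norm (t k x - h n x)" for x
      using norm_triangle_ineq[of "\<phi> x - t k x" "t k x - h n x"] by simp
  qed (use int t_int h_int in auto)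
  also have "\<dots> = (LINT x|?M. norm (\<phi> x - t k x)) + (LINT x|?M. norm (t k x - h n x))"
    using int t_int h_int by (intro Bochner_Integration.integral_add) auto
  also have "\<dots> < \<eta>" using k n by simp
  finally show ?thesis using h[of n] cb unfolding h_def by blast
qed

definition rest :: "real \<Rightarrow> (real^'n) set \<Rightarrow> (real^'n) set" where
  "rest r \<Omega> = \<Omega> - (\<Union>z\<in>inner_cubes r \<Omega>. grid r z)"

text \<open>The divisor is the volume of the whole grid cube, so this is a true average only for
  cubes contained in the domain.\<close>

definition grid_avg :: "(real^'n) set \<Rightarrow> real \<Rightarrow> (real^'n \<Rightarrow> 'b::{banach,second_countable_topology}) \<Rightarrow> int^'n \<Rightarrow> 'b" where
  "grid_avg \<Omega> r \<phi> z = (1 / r ^ CARD('n)) *\<^sub>R (LINT x:grid r z|lebesgue_on \<Omega>. \<phi> x)"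

context
  fixes \<Omega> :: "(real^'n) set"
  assumes bdd: "bounded \<Omega>" and lm: "\<Omega> \<in> lmeasurable"
begin

lemma grid_sets:
  assumes "r > 0" "z \<in> inner_cubes r \<Omega>"
  shows "grid r z \<in> sets (lebesgue_on \<Omega>)" "measure (lebesgue_on \<Omega>) (grid r z) = r ^ CARD('n)"
    "emeasure (lebesgue_on \<Omega>) (grid r z) \<noteq> \<infinity>"
proof -
  have "grid r z \<subseteq> \<Omega>" using assms(2) by (simp add: inner_cubes_def)
  note * = fmeasurableD[OF lm] grid_lmeasurable[OF assms(1)] this
  show "grid r z \<in> sets (lebesgue_on \<Omega>)" by (rule sets_lebesgue_on_subset[OF *])
  show "emeasure (lebesgue_on \<Omega>) (grid r z) \<noteq> \<infinity>" by (rule emeasure_lebesgue_on_subset[OF *])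
  show "measure (lebesgue_on \<Omega>) (grid r z) = r ^ CARD('n)"
    using measure_lebesgue_on_subset[OF *] measure_grid[OF assms(1)] by simp
qed

lemma rest_sets: "r > 0 \<Longrightarrow> rest r \<Omega> \<in> sets (lebesgue_on \<Omega>)"
  unfolding rest_def using grid_sets(1) finite_inner_cubes[OF bdd]
  by (intro sets.Diff sets.finite_UN) (auto simp: sets_restrict_space_iff fmeasurableD[OF lm])

lemma integral_grid_decomposition:
  fixes \<phi> :: "real^'n \<Rightarrow> 'b::{banach,second_countable_topology}"
  assumes r: "r > 0" and int: "integrable (lebesgue_on \<Omega>) \<phi>"
  shows "(LINT x|lebesgue_on \<Omega>. \<phi> x) =
    (\<Sum>z\<in>inner_cubes r \<Omega>. LINT x:grid r z|lebesgue_on \<Omega>. \<phi> x) + (LINT x:rest r \<Omega>|lebesgue_on \<Omega>. \<phi> x)"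
proof -
  let ?M = "lebesgue_on \<Omega>" and ?U = "\<Union>z\<in>inner_cubes r \<Omega>. grid r z"
  have fin: "finite (inner_cubes r \<Omega>)" by (rule finite_inner_cubes[OF bdd r])
  have U: "?U \<in> sets ?M" using fin grid_sets(1)[OF r] by (intro sets.finite_UN)
  have "?U \<subseteq> \<Omega>" by (auto simp: inner_cubes_def)
  then have eq: "\<Omega> = ?U \<union> rest r \<Omega>" by (auto simp: rest_def)
  have "(LINT x|?M. \<phi> x) = (LINT x:\<Omega>|?M. \<phi> x)"
    using set_integral_space[OF int] by (simp add: space_restrict_space)
  also have "\<dots> = (LINT x:?U \<union> rest r \<Omega>|?M. \<phi> x)" using eq by simp
  also have "\<dots> = (LINT x:?U|?M. \<phi> x) + (LINT x:rest r \<Omega>|?M. \<phi> x)"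
    by (intro set_integral_Un set_integrableI_integrable int U rest_sets r) (auto simp: rest_def)
  also have "(LINT x:?U|?M. \<phi> x) = (\<Sum>z\<in>inner_cubes r \<Omega>. LINT x:grid r z|?M. \<phi> x)"
    using grid_disjoint[OF r]
    by (intro set_integral_finite_Union fin set_integrableI_integrable int grid_sets r) (auto simp: disjoint_family_on_def)
  finally show ?thesis .
qed

lemma sum_set_integral_grid_le:
  assumes r: "r > 0" and int: "integrable (lebesgue_on \<Omega>) (h :: _ \<Rightarrow> real)" and h: "\<And>x. h x \<ge> 0"
  shows "(\<Sum>z\<in>inner_cubes r \<Omega>. LINT x:grid r z|lebesgue_on \<Omega>. h x) \<le> (LINT x|lebesgue_on \<Omega>. h x)"
proof -
  have "0 \<le> (LINT x:rest r \<Omega>|lebesgue_on \<Omega>. h x)"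
    unfolding set_lebesgue_integral_def by (intro Bochner_Integration.integral_nonneg) (simp add: h)
  then show ?thesis using integral_grid_decomposition[OF r int] by simp
qed

lemma measure_rest_le:
  assumes r: "r > 0"
  shows "measure (lebesgue_on \<Omega>) (rest r \<Omega>) \<le> r ^ CARD('n) * card (boundary_cubes r \<Omega>)"
proof -
  let ?V = "\<Union>z\<in>boundary_cubes r \<Omega>. grid r z"
  have fin: "finite (boundary_cubes r \<Omega>)" by (rule finite_boundary_cubes[OF bdd r])
  have sets: "rest r \<Omega> \<in> sets lebesgue"
    using rest_sets[OF r] by (simp add: sets_restrict_space_iff fmeasurableD[OF lm])
  have "measure (lebesgue_on \<Omega>) (rest r \<Omega>) = measure lebesgue (rest r \<Omega>)"
    by (rule measure_restrict_space) (auto simp: rest_def fmeasurableD[OF lm])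
  also have "\<dots> \<le> measure lebesgue ?V"
  proof (rule measure_mono_fmeasurable[OF _ sets])
    show "rest r \<Omega> \<subseteq> ?V" using subset_cubes[OF r, of \<Omega>] by (auto simp: rest_def)
    show "?V \<in> lmeasurable" using fin grid_lmeasurable[OF r] by (intro fmeasurable.finite_UN)
  qed
  also have "\<dots> \<le> (\<Sum>z\<in>boundary_cubes r \<Omega>. measure lebesgue (grid r z))"
    using fin grid_lmeasurable[OF r] by (intro measure_UNION_le) (auto intro: fmeasurableD)
  finally show ?thesis by (simp add: measure_grid[OF r] mult.commute)
qed

text \<open>Among constants the average is optimal up to a factor 2, since its distance from any
  \<open>v\<close> is at most the mean of \<open>norm (\<phi> x - v)\<close>. The free choice of
  \<open>v\<close> allows a comparison with the value of a continuous function at the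
  corner.\<close>

lemma set_integral_dist_avg_le:
  fixes \<phi> :: "real^'n \<Rightarrow> 'b::{banach,second_countable_topology}"
  assumes r: "r > 0" and int: "integrable (lebesgue_on \<Omega>) \<phi>" and z: "z \<in> inner_cubes r \<Omega>"
  shows "(LINT x:grid r z|lebesgue_on \<Omega>. norm (\<phi> x - grid_avg \<Omega> r \<phi> z))
    \<le> 2 * (LINT x:grid r z|lebesgue_on \<Omega>. norm (\<phi> x - v))"
proof -
  let ?M = "lebesgue_on \<Omega>" and ?C = "grid r z" and ?a = "grid_avg \<Omega> r \<phi> z"
  interpret finite_measure ?M using lm by (rule finite_measure_lebesgue_on_lmeasurable)
  note C = grid_sets[OF r z]
  have int': "set_integrable ?M ?C (\<lambda>x. norm (\<phi> x - w))" "set_integrable ?M ?C (\<lambda>x. \<phi> x - w)" for w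
    using int by (auto intro!: set_integrableI_integrable C(1))
  have c: "r ^ CARD('n) > 0" using r by simp
  have "(LINT x:?C|?M. norm (\<phi> x - ?a)) \<le> (LINT x:?C|?M. norm (\<phi> x - v) + norm (v - ?a))"
  proof (rule set_integral_mono)
    show "norm (\<phi> x - ?a) \<le> norm (\<phi> x - v) + norm (v - ?a)" for x
      using norm_triangle_ineq[of "\<phi> x - v" "v - ?a"] by simp
    show "set_integrable ?M ?C (\<lambda>x. norm (\<phi> x - v) + norm (v - ?a))"
      using int by (auto intro!: set_integrableI_integrable C(1))
  qed (rule int')
  also have "\<dots> = (LINT x:?C|?M. norm (\<phi> x - v)) + (LINT x:?C|?M. norm (v - ?a))"
    using int by (intro set_integral_add int' set_integrableI_integrable C(1)) auto
  also have "(LINT x:?C|?M. norm (v - ?a)) = r ^ CARD('n) * norm (v - ?a)"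
    using set_integral_const[OF C(1,3), of "norm (v - ?a)"] C(2) by simp
  also have "\<dots> = norm (r ^ CARD('n) *\<^sub>R (?a - v))" using c by (simp add: norm_minus_commute)
  also have "r ^ CARD('n) *\<^sub>R (?a - v) = (LINT x:?C|?M. \<phi> x - v)"
  proof -
    have "(LINT x:?C|?M. \<phi> x - v) = (LINT x:?C|?M. \<phi> x) - (LINT x:?C|?M. v)"
      using int by (intro set_integral_diff set_integrableI_integrable C(1)) auto
    then show ?thesis using set_integral_const[OF C(1,3), of v] C(2) r
      by (simp add: grid_avg_def scaleR_diff_right)
  qed
  also have "norm \<dots> \<le> (LINT x:?C|?M. norm (\<phi> x - v))" by (rule set_integral_norm_bound[OF int'(2)])
  finally show ?thesis by simp
qed

text \<open>A continuous approximant is uniformly continuous on the compact closure and hence almost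
  constant on small cubes. Distance of the approximant and its oscillation contribute
  \<open>\<eta> / 4\<close> each, both doubled by the passage to the average.\<close>

lemma eventually_grid_oscillation_less:
  fixes \<phi> :: "real^'n \<Rightarrow> 'b::euclidean_space"
  assumes int: "integrable (lebesgue_on \<Omega>) \<phi>" and \<eta>: "\<eta> > 0"
  shows "\<forall>\<^sub>F r in at_right 0.
    (\<Sum>z\<in>inner_cubes r \<Omega>. LINT x:grid r z|lebesgue_on \<Omega>. norm (\<phi> x - grid_avg \<Omega> r \<phi> z)) < \<eta>"
proof -
  let ?M = "lebesgue_on \<Omega>"
  interpret finite_measure ?M using lm by (rule finite_measure_lebesgue_on_lmeasurable)
  have "\<eta> / 4 > 0" using \<eta> by simp
  from L1_approx_continuous[OF lm int this] obtain g B where g: "continuous_on UNIV g" "\<forall>x. norm (g x) \<le> B"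
    "(LINT x|?M. norm (\<phi> x - g x)) < \<eta> / 4" by (elim exE conjE) (rule that)
  have gm: "g \<in> borel_measurable ?M"
    by (rule continuous_imp_measurable_on_sets_lebesgue[OF continuous_on_subset[OF g(1) subset_UNIV] fmeasurableD[OF lm]])
  have gi: "integrable ?M g" using gm g(2) by (intro integrable_const_bound[of _ B]) auto
  \<comment> \<open>The added 1 avoids a division by zero for a null set.\<close>
  define \<kappa> where "\<kappa> = \<eta> / (4 * (measure ?M \<Omega> + 1))"
  have mp: "measure ?M \<Omega> + 1 > 0" using measure_nonneg[of ?M \<Omega>] by linarith
  have \<kappa>: "\<kappa> > 0" using \<eta> mp by (simp add: \<kappa>_def)
  have \<kappa>': "measure ?M \<Omega> * \<kappa> \<le> \<eta> / 4"
  proof -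
    have "measure ?M \<Omega> * \<kappa> \<le> (measure ?M \<Omega> + 1) * \<kappa>" using \<kappa> by (intro mult_right_mono) auto
    also have "\<dots> = \<eta> / 4" using mp by (simp add: \<kappa>_def field_simps)
    finally show ?thesis .
  qed
  have "compact (closure \<Omega>)" using bdd by (simp add: compact_closure)
  then have "uniformly_continuous_on (closure \<Omega>) g"
    using continuous_on_subset[OF g(1) subset_UNIV] by (intro compact_uniformly_continuous)
  then obtain d where d: "d > 0" "\<And>x x'. x \<in> closure \<Omega> \<Longrightarrow> x' \<in> closure \<Omega> \<Longrightarrow> dist x' x < d \<Longrightarrow> dist (g x') (g x) < \<kappa>"
    using \<kappa> unfolding uniformly_continuous_on_def by metis
  have "\<forall>\<^sub>F r in at_right 0. r \<in> {0<..<d / CARD('n)}" using d(1) by (intro eventually_at_right_real) simp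
  then show ?thesis
  proof eventually_elim
    case (elim r)
    then have r: "r > 0" "CARD('n) * r < d" by (auto simp: field_simps)
    have bound: "(LINT x:grid r z|?M. norm (\<phi> x - grid_avg \<Omega> r \<phi> z)) \<le>
        2 * (LINT x:grid r z|?M. norm (\<phi> x - g x) + \<kappa>)" if z: "z \<in> inner_cubes r \<Omega>" for z
    proof -
      have zO: "grid r z \<subseteq> \<Omega>" using z by (simp add: inner_cubes_def)
      let ?v = "g (r *\<^sub>R lat z)"
      have "(LINT x:grid r z|?M. norm (\<phi> x - ?v)) \<le> (LINT x:grid r z|?M. norm (\<phi> x - g x) + \<kappa>)"
      proof (rule set_integral_mono)
        fix x assume x: "x \<in> grid r z"
        have "norm (x - r *\<^sub>R lat z) \<le> CARD('n) * r"
          using x corner_in_grid[OF r(1), of z] unfolding grid_def by (rule norm_diff_rcube_le)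
        then have "dist x (r *\<^sub>R lat z) < d" using r(2) by (simp add: dist_norm)
        then have "dist (g x) ?v < \<kappa>"
          using x corner_in_grid[OF r(1), of z] zO closure_subset[of \<Omega>] by (intro d(2)) auto
        then show "norm (\<phi> x - ?v) \<le> norm (\<phi> x - g x) + \<kappa>"
          using norm_triangle_ineq[of "\<phi> x - g x" "g x - ?v"] by (simp add: dist_norm)
      qed (use int gi in \<open>auto intro!: set_integrableI_integrable grid_sets[OF r(1) z]\<close>)
      then show ?thesis using set_integral_dist_avg_le[OF r(1) int z, of ?v] by linarith
    qed
    have "(\<Sum>z\<in>inner_cubes r \<Omega>. LINT x:grid r z|?M. norm (\<phi> x - grid_avg \<Omega> r \<phi> z))
        \<le> (\<Sum>z\<in>inner_cubes r \<Omega>. 2 * (LINT x:grid r z|?M. norm (\<phi> x - g x) + \<kappa>))"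
      by (intro sum_mono bound)
    also have "\<dots> \<le> 2 * (LINT x|?M. norm (\<phi> x - g x) + \<kappa>)"
      unfolding sum_distrib_left[symmetric] using int gi \<kappa>
      by (intro mult_left_mono sum_set_integral_grid_le[OF r(1)]) auto
    also have "(LINT x|?M. norm (\<phi> x - g x) + \<kappa>) = (LINT x|?M. norm (\<phi> x - g x)) + measure ?M \<Omega> * \<kappa>"
      using int gi by (subst Bochner_Integration.integral_add) (auto simp: space_restrict_space)
    finally have "(\<Sum>z\<in>inner_cubes r \<Omega>. LINT x:grid r z|?M. norm (\<phi> x - grid_avg \<Omega> r \<phi> z))
      \<le> 2 * ((LINT x|?M. norm (\<phi> x - g x)) + measure ?M \<Omega> * \<kappa>)" .
    also have "\<dots> < 2 * (\<eta> / 4 + \<eta> / 4)"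
      by (intro mult_strict_left_mono add_less_le_mono[OF g(3) \<kappa>']) simp
    finally show ?case by simp
  qed
qed

text \<open>An instance of absolute continuity of the integral: the rest has small volume, on which
  a bounded approximant contributes little, and the remaining part is small in the integral norm
  over all of the domain.\<close>

lemma eventually_rest_integral_less:
  fixes \<phi> :: "real^'n \<Rightarrow> 'b::euclidean_space"
  assumes int: "integrable (lebesgue_on \<Omega>) \<phi>" and neg: "negligible (frontier \<Omega>)" and \<eta>: "\<eta> > 0"
  shows "\<forall>\<^sub>F r in at_right 0. (LINT x:rest r \<Omega>|lebesgue_on \<Omega>. norm (\<phi> x)) < \<eta>"
proof -
  let ?M = "lebesgue_on \<Omega>"
  interpret finite_measure ?M using lm by (rule finite_measure_lebesgue_on_lmeasurable)
  have "\<eta> / 2 > 0" using \<eta> by simp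
  from L1_approx_continuous[OF lm int this] obtain g B where g: "continuous_on UNIV g" "\<forall>x. norm (g x) \<le> B"
    "(LINT x|?M. norm (\<phi> x - g x)) < \<eta> / 2" by (elim exE conjE) (rule that)
  have gm: "g \<in> borel_measurable ?M"
    by (rule continuous_imp_measurable_on_sets_lebesgue[OF continuous_on_subset[OF g(1) subset_UNIV] fmeasurableD[OF lm]])
  have gi: "integrable ?M g" using gm g(2) by (intro integrable_const_bound[of _ B]) auto
  have B: "B \<ge> 0" using g(2) norm_ge_zero order.trans by blast
  have "\<forall>\<^sub>F r in at_right 0. r ^ CARD('n) * card (boundary_cubes r \<Omega>) < \<eta> / (2 * (B + 1))"
    using \<eta> B by (intro order_tendstoD(2)[OF boundary_cubes_volume_tendsto[OF bdd neg]]) simp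
  moreover have "\<forall>\<^sub>F r in at_right (0 :: real). r > 0" by (simp add: eventually_at_right_less)
  ultimately show ?thesis
  proof eventually_elim
    case (elim r)
    let ?R = "rest r \<Omega>"
    have R: "?R \<in> sets ?M" using rest_sets elim(2) .
    have "(LINT x:?R|?M. norm (\<phi> x)) \<le> (LINT x:?R|?M. norm (\<phi> x - g x) + B)"
    proof (rule set_integral_mono)
      show "norm (\<phi> x) \<le> norm (\<phi> x - g x) + B" for x
        using norm_triangle_sub[of "\<phi> x" "g x"] g(2)[rule_format, of x] by linarith
    qed (use int gi in \<open>auto intro!: set_integrableI_integrable R\<close>)
    also have "\<dots> = (LINT x:?R|?M. norm (\<phi> x - g x)) + (LINT x:?R|?M. B)"
      using int gi by (intro set_integral_add set_integrableI_integrable R) auto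
    also have "(LINT x:?R|?M. norm (\<phi> x - g x)) \<le> (LINT x|?M. norm (\<phi> x - g x))"
      unfolding set_lebesgue_integral_def using int gi
      by (intro integral_mono integrable_mult_indicator R) (auto simp: indicator_def)
    also have "(LINT x:?R|?M. B) = measure ?M ?R * B"
      using set_integral_const[OF R, of B] by simp
    also have "\<dots> \<le> (r ^ CARD('n) * card (boundary_cubes r \<Omega>)) * B"
      using measure_rest_le[OF elim(2)] B by (intro mult_right_mono)
    also have "\<dots> \<le> \<eta> / (2 * (B + 1)) * B" using elim(1) B by (intro mult_right_mono) auto
    also have "\<dots> \<le> \<eta> / 2" using \<eta> B by (simp add: field_simps)
    finally show ?case using g(3) by linarith
  qed
qed

end

section \<open>Weak* neighbourhoods\<close>

text \<open>This is completeness of Lebesgue measure. It is needed because representatives in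
  \<open>C_eps\<close> and the values of \<open>f_hom\<close> are known only almost
  everywhere.\<close>

lemma borel_measurable_lebesgue_on_AE:
  fixes f :: "real^'n \<Rightarrow> 'b::euclidean_space"
  assumes \<Omega>: "\<Omega> \<in> sets lebesgue" and f: "f \<in> borel_measurable (lebesgue_on \<Omega>)"
    and ae: "AE x in lebesgue_on \<Omega>. f x = g x"
  shows "g \<in> borel_measurable (lebesgue_on \<Omega>)"
proof -
  have "(\<lambda>x. if x \<in> \<Omega> then f x else 0) \<in> borel_measurable lebesgue"
    by (rule borel_measurable_if_I[OF f \<Omega>])
  moreover have "AE x in lebesgue. x \<in> \<Omega> \<longrightarrow> f x = g x" using ae \<Omega> by (simp add: AE_restrict_space_iff)
  then have "AE x in lebesgue. (if x \<in> \<Omega> then f x else 0) = (if x \<in> \<Omega> then g x else 0)"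
    by eventually_elim auto
  ultimately have "(\<lambda>x. if x \<in> \<Omega> then g x else 0) \<in> borel_measurable lebesgue"
    by (rule borel_measurable_AE)
  then have "(\<lambda>x. if x \<in> \<Omega> then g x else 0) \<in> borel_measurable (lebesgue_on \<Omega>)"
    by (rule measurable_restrict_space1)
  then show ?thesis
    by (rule measurable_cong[THEN iffD1, rotated]) (simp add: space_restrict_space)
qed

text \<open>The form is continuous in \<open>v\<close>, so a dense set of directions suffices. With
  a countable one, membership almost everywhere can be checked one inequality at a time.\<close>

lemma sym_in_K_set_iff_dense:
  fixes P :: "real^'n^'n"
  assumes D: "UNIV \<subseteq> closure D" and P: "P \<in> sym_matrices"
  shows "P \<in> K_set \<longleftrightarrow> (\<forall>v\<in>D. 0 \<le> P \<bullet> tensor v v) \<and> P \<bullet> mat 1 = 1"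
proof -
  have "0 \<le> P \<bullet> tensor v v" if "\<forall>v\<in>D. 0 \<le> P \<bullet> tensor v v" for v
  proof -
    have "closed {v. 0 \<le> P \<bullet> tensor v v}"
      unfolding tensor_def by (intro closed_Collect_le continuous_intros)
    then have "closure D \<subseteq> {v. 0 \<le> P \<bullet> tensor v v}" using that by (intro closure_minimal) auto
    then show ?thesis using D by auto
  qed
  then show ?thesis using P by (auto simp: K_set_eq_halfspaces sym_matrices_def)
qed

section \<open>Open sets given by finitely many tests\<close>

lemma openin_weak_star_test:
  assumes "\<phi> \<in> L1 \<Omega> sym_matrices" "open V"
  shows "openin (weak_star \<Omega>) {y \<in> Linf \<Omega> sym_matrices. (LINT x|lebesgue_on \<Omega>. \<phi> x \<bullet> y x) \<in> V}"
proof -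
  let ?T = "product_topology (\<lambda>_. euclideanreal) (L1 \<Omega> sym_matrices)"
  let ?F = "\<lambda>Q. \<lambda>\<phi>\<in>L1 \<Omega> sym_matrices. LINT x|lebesgue_on \<Omega>. \<phi> x \<bullet> Q x"
  have "openin ?T {h \<in> topspace ?T. h \<phi> \<in> V}"
    using assms by (intro openin_continuous_map_preimage[OF continuous_map_product_projection[OF assms(1)]]) simp
  moreover have "{y \<in> Linf \<Omega> sym_matrices. (LINT x|lebesgue_on \<Omega>. \<phi> x \<bullet> y x) \<in> V}
      = ?F -` {h \<in> topspace ?T. h \<phi> \<in> V} \<inter> Linf \<Omega> sym_matrices"
    using assms(1) by auto
  ultimately show ?thesis unfolding weak_star_def openin_pullback_topology by blast
qed

text \<open>A basic open box of the product topology restricts finitely many coordinates only, and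
  the smallest of finitely many radii is still positive.\<close>

lemma weak_star_basic_neighbourhood:
  assumes U: "openin (weak_star \<Omega>) U" "Q \<in> U"
  shows "\<exists>\<Phi> \<tau>. finite \<Phi> \<and> \<Phi> \<subseteq> L1 \<Omega> sym_matrices \<and> \<tau> > 0 \<and>
    {y \<in> Linf \<Omega> sym_matrices. \<forall>\<phi>\<in>\<Phi>. \<bar>(LINT x|lebesgue_on \<Omega>. \<phi> x \<bullet> y x) - (LINT x|lebesgue_on \<Omega>. \<phi> x \<bullet> Q x)\<bar> < \<tau>} \<subseteq> U"
proof -
  let ?I = "L1 \<Omega> sym_matrices"
  let ?T = "product_topology (\<lambda>_. euclideanreal) ?I"
  let ?t = "\<lambda>\<phi> y. LINT x|lebesgue_on \<Omega>. \<phi> x \<bullet> y x"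
  let ?F = "\<lambda>Q. \<lambda>\<phi>\<in>?I. ?t \<phi> Q"
  obtain W where W: "openin ?T W" "U = ?F -` W \<inter> Linf \<Omega> sym_matrices"
    using U(1) unfolding weak_star_def openin_pullback_topology by blast
  have "?F Q \<in> W" using U(2) W(2) by blast
  with W(1) have "\<exists>X. finite {i \<in> ?I. X i \<noteq> topspace euclideanreal} \<and> (\<forall>i\<in>?I. openin euclideanreal (X i)) \<and>
      ?F Q \<in> Pi\<^sub>E ?I X \<and> Pi\<^sub>E ?I X \<subseteq> W"
    unfolding openin_product_topology_alt by (rule bspec)
  then obtain X where X: "finite {i \<in> ?I. X i \<noteq> topspace euclideanreal}" "\<forall>i\<in>?I. openin euclideanreal (X i)"
    "?F Q \<in> Pi\<^sub>E ?I X" "Pi\<^sub>E ?I X \<subseteq> W" by (elim exE conjE) (rule that)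
  define \<Phi> where "\<Phi> = {i \<in> ?I. X i \<noteq> UNIV}"
  have fin: "finite \<Phi>" using X(1) by (simp add: \<Phi>_def)
  have "\<exists>e>0. ball (?t \<phi> Q) e \<subseteq> X \<phi>" if "\<phi> \<in> \<Phi>" for \<phi>
  proof -
    have "\<phi> \<in> ?I" using that by (simp add: \<Phi>_def)
    then have "open (X \<phi>)" "?t \<phi> Q \<in> X \<phi>" using X(2) PiE_mem[OF X(3)] by auto
    then show ?thesis by (rule openE) blast
  qed
  then obtain e where e: "\<And>\<phi>. \<phi> \<in> \<Phi> \<Longrightarrow> e \<phi> > 0" "\<And>\<phi>. \<phi> \<in> \<Phi> \<Longrightarrow> ball (?t \<phi> Q) (e \<phi>) \<subseteq> X \<phi>"
    by metis
  define \<tau> where "\<tau> = Min (insert 1 (e ` \<Phi>))"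
  have \<tau>: "\<tau> > 0" "\<And>\<phi>. \<phi> \<in> \<Phi> \<Longrightarrow> \<tau> \<le> e \<phi>"
    using fin e(1) by (auto simp: \<tau>_def)
  have "y \<in> U" if y: "y \<in> Linf \<Omega> sym_matrices" "\<forall>\<phi>\<in>\<Phi>. \<bar>?t \<phi> y - ?t \<phi> Q\<bar> < \<tau>" for y
  proof -
    have "?t \<phi> y \<in> X \<phi>" if "\<phi> \<in> ?I" for \<phi>
    proof (cases "\<phi> \<in> \<Phi>")
      case True
      then have "?t \<phi> y \<in> ball (?t \<phi> Q) (e \<phi>)"
        using y(2) \<tau>(2)[OF True] by (auto simp: dist_real_def abs_minus_commute)
      then show ?thesis using e(2)[OF True] by blast
    qed (use that in \<open>auto simp: \<Phi>_def\<close>)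
    then have "?F y \<in> Pi\<^sub>E ?I X" by auto
    then show ?thesis using X(4) W(2) y(1) by blast
  qed
  then show ?thesis using fin \<tau>(1) by (intro exI[of _ \<Phi>] exI[of _ \<tau>]) (auto simp: \<Phi>_def)
qed

lemma norm_matrix_le_sum: "norm (A :: real^'n^'n) \<le> (\<Sum>i\<in>UNIV. \<Sum>j\<in>UNIV. \<bar>A $ i $ j\<bar>)"
proof -
  have "norm A \<le> (\<Sum>i\<in>UNIV. norm (A $ i))" unfolding norm_vec_def by (intro L2_set_le_sum) auto
  also have "\<dots> \<le> (\<Sum>i\<in>UNIV. \<Sum>j\<in>UNIV. \<bar>A $ i $ j\<bar>)" by (intro sum_mono norm_le_l1_cart)
  finally show ?thesis .
qed

text \<open>Test functions have to be symmetric, so the entry \<open>(a, b)\<close> is tested with the symmetric part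
  of the corresponding matrix unit.\<close>

definition sym_unit :: "'n \<Rightarrow> 'n \<Rightarrow> real^'n^'n" where
  "sym_unit a b = (\<chi> i j. ((if i = a \<and> j = b then 1 else 0) + (if i = b \<and> j = a then 1 else 0)) / 2)"

lemma sym_unit_sym: "sym_unit a b \<in> sym_matrices"
  by (simp add: sym_matrices_def sym_unit_def transpose_def vec_eq_iff conj_commute add.commute)

lemma inner_sym_unit: "A \<in> sym_matrices \<Longrightarrow> sym_unit a b \<bullet> A = A $ a $ b"
proof -
  assume "A \<in> sym_matrices"
  then have s: "A $ b $ a = A $ a $ b" by (metis (mono_tags) mem_Collect_eq sym_matrices_def transpose_def vec_lambda_beta)
  have d: "(\<Sum>i\<in>UNIV. \<Sum>j\<in>UNIV. (if i = c \<and> j = d then 1 else 0) * A $ i $ j) = A $ c $ d" for c d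
  proof -
    have "(\<Sum>j\<in>UNIV. (if i = c \<and> j = d then 1 else 0) * A $ i $ j) = (if i = c then A $ i $ d else 0)" for i
      by (cases "i = c") (simp_all add: mult_delta_left)
    then show ?thesis by simp
  qed
  have "sym_unit a b \<bullet> A = (\<Sum>i\<in>UNIV. \<Sum>j\<in>UNIV. ((if i = a \<and> j = b then 1 else 0) * A $ i $ j
      + (if i = b \<and> j = a then 1 else 0) * A $ i $ j) / 2)"
    unfolding inner_vec_def sym_unit_def by (intro sum.cong refl) (simp add: field_simps)
  also have "\<dots> = ((\<Sum>i\<in>UNIV. \<Sum>j\<in>UNIV. (if i = a \<and> j = b then 1 else 0) * A $ i $ j) +
      (\<Sum>i\<in>UNIV. \<Sum>j\<in>UNIV. (if i = b \<and> j = a then 1 else 0) * A $ i $ j)) / 2"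
    by (simp only: sum_divide_distrib[symmetric] sum.distrib)
  also have "\<dots> = A $ a $ b" unfolding d using s by simp
  finally show ?thesis .
qed

context
  fixes \<Omega> :: "(real^'n) set"
  assumes bdd: "bounded \<Omega>" and lm: "\<Omega> \<in> lmeasurable"
begin

lemma Linf_integrable: "Q \<in> Linf \<Omega> S \<Longrightarrow> integrable (lebesgue_on \<Omega>) Q"
proof -
  assume Q: "Q \<in> Linf \<Omega> S"
  interpret finite_measure "lebesgue_on \<Omega>" using lm by (rule finite_measure_lebesgue_on_lmeasurable)
  from Q obtain B where "Q \<in> borel_measurable (lebesgue_on \<Omega>)" "AE x in lebesgue_on \<Omega>. norm (Q x) \<le> B"
    by (auto simp: Linf_def)
  then show ?thesis by (intro integrable_const_bound)
qed

lemma integrable_inner_Linf: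
  assumes "integrable (lebesgue_on \<Omega>) \<phi>" "Q \<in> Linf \<Omega> S"
  shows "integrable (lebesgue_on \<Omega>) (\<lambda>x. \<phi> x \<bullet> Q x)"
proof -
  from assms(2) obtain B where B: "Q \<in> borel_measurable (lebesgue_on \<Omega>)" "AE x in lebesgue_on \<Omega>. norm (Q x) \<le> B"
    by (auto simp: Linf_def)
  show ?thesis
  proof (rule Bochner_Integration.integrable_bound)
    show "integrable (lebesgue_on \<Omega>) (\<lambda>x. norm (\<phi> x) * B)" using assms(1) by simp
    show "AE x in lebesgue_on \<Omega>. norm (\<phi> x \<bullet> Q x) \<le> norm (norm (\<phi> x) * B)"
      using B(2)
    proof eventually_elim
      case (elim x)
      have "norm (\<phi> x \<bullet> Q x) \<le> norm (\<phi> x) * norm (Q x)" by (simp add: Cauchy_Schwarz_ineq2)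
      also have "\<dots> \<le> norm (\<phi> x) * B" using elim by (intro mult_left_mono) auto
      finally show ?case by simp
    qed
  qed (use borel_measurable_integrable[OF assms(1)] B(1) in measurable)
qed

text \<open>The entries of the integral over \<open>A\<close> are pairings with the test functions
  \<open>indicator A x *\<^sub>R sym_unit a b\<close>. Finitely many sets and entries lead to a
  finite intersection of subbasic open sets.\<close>

lemma weak_star_cubes_neighbourhood:
  assumes Q: "Q \<in> Linf \<Omega> sym_matrices" and Z: "finite Z" "Z \<subseteq> sets (lebesgue_on \<Omega>)" and \<tau>: "\<tau> > 0"
  shows "\<exists>U. openin (weak_star \<Omega>) U \<and> Q \<in> U \<and>
    (\<forall>y\<in>U. \<forall>A\<in>Z. norm ((LINT x:A|lebesgue_on \<Omega>. y x) - (LINT x:A|lebesgue_on \<Omega>. Q x)) < \<tau>)"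
proof -
  let ?M = "lebesgue_on \<Omega>"
  interpret finite_measure ?M using lm by (rule finite_measure_lebesgue_on_lmeasurable)
  \<comment> \<open>The norm is at most the sum of the N^2 absolute entries; the added 1 turns the
    resulting bound into a strict one.\<close>
  define \<tau>' where "\<tau>' = \<tau> / (real CARD('n) * real CARD('n) + 1)"
  have \<tau>': "\<tau>' > 0" using \<tau> by (simp add: \<tau>'_def add_nonneg_pos)
  define \<phi> :: "(real^'n) set \<Rightarrow> 'n \<Rightarrow> 'n \<Rightarrow> real^'n \<Rightarrow> real^'n^'n"
    where "\<phi> A a b x = indicator A x *\<^sub>R sym_unit a b" for A a b x
  define V where "V A a b = {y \<in> Linf \<Omega> sym_matrices. (LINT x|?M. \<phi> A a b x \<bullet> y x) \<in>
    ball (LINT x|?M. \<phi> A a b x \<bullet> Q x) \<tau>'}" for A a b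
  have \<phi>L1: "\<phi> A a b \<in> L1 \<Omega> sym_matrices" if "A \<in> Z" for A a b
  proof -
    have "A \<in> sets ?M" using that Z(2) by blast
    then have "integrable ?M (\<phi> A a b)" unfolding \<phi>_def by (intro integrable_mult_indicator) auto
    moreover have "\<phi> A a b x \<in> sym_matrices" for x
      using sym_unit_sym[of a b] by (cases "x \<in> A") (auto simp: \<phi>_def sym_matrices_def transpose_def vec_eq_iff)
    ultimately show ?thesis by (simp add: L1_def)
  qed
  have test: "(LINT x|?M. \<phi> A a b x \<bullet> y x) = (LINT x:A|?M. y x) $ a $ b"
    if A: "A \<in> Z" and y: "y \<in> Linf \<Omega> sym_matrices" for A a b y
  proof -
    have As: "A \<in> sets ?M" using A Z(2) by blast
    have yi: "integrable ?M (\<lambda>x. indicator A x *\<^sub>R y x)"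
      by (intro integrable_mult_indicator As Linf_integrable[OF y])
    have ys: "AE x in ?M. y x \<in> sym_matrices" using y by (simp add: Linf_def)
    have "(LINT x|?M. \<phi> A a b x \<bullet> y x) = (LINT x|?M. (indicator A x *\<^sub>R y x) $ a $ b)"
    proof (rule integral_cong_AE)
      show "AE x in ?M. \<phi> A a b x \<bullet> y x = (indicator A x *\<^sub>R y x) $ a $ b"
        using ys by eventually_elim (simp add: \<phi>_def inner_sym_unit)
      show "(\<lambda>x. \<phi> A a b x \<bullet> y x) \<in> borel_measurable ?M"
        using integrable_inner_Linf[OF _ y, of "\<phi> A a b"] \<phi>L1[OF A] by (simp add: L1_def)
      show "(\<lambda>x. (indicator A x *\<^sub>R y x) $ a $ b) \<in> borel_measurable ?M"
        by (intro borel_measurable_integrable integrable_bounded_linear[OF bounded_linear_vec_nth]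
            integrable_bounded_linear[OF bounded_linear_vec_nth] yi)
    qed
    also have "\<dots> = (LINT x|?M. (indicator A x *\<^sub>R y x) $ a) $ b"
      by (rule integral_bounded_linear[OF bounded_linear_vec_nth
          integrable_bounded_linear[OF bounded_linear_vec_nth yi]])
    also have "(LINT x|?M. (indicator A x *\<^sub>R y x) $ a) = (LINT x:A|?M. y x) $ a"
      unfolding set_lebesgue_integral_def by (rule integral_bounded_linear[OF bounded_linear_vec_nth yi])
    finally show ?thesis .
  qed
  let ?X = "Z \<times> (UNIV :: 'n set) \<times> (UNIV :: 'n set)"
  \<comment> \<open>The intersection with the whole space takes care of an empty
    \<open>Z\<close>.\<close>
  define U where "U = topspace (weak_star \<Omega>) \<inter> (\<Inter>(A, a, b)\<in>?X. V A a b)"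
  have "openin (weak_star \<Omega>) U"
  proof (cases "?X = {}")
    case True
    then show ?thesis unfolding U_def by simp
  next
    case False
    have "openin (weak_star \<Omega>) (\<Inter>p\<in>?X. V (fst p) (fst (snd p)) (snd (snd p)))"
    proof (rule openin_INT2[OF _ False])
      show "finite ?X" using Z(1) by simp
      show "openin (weak_star \<Omega>) (V (fst p) (fst (snd p)) (snd (snd p)))" if "p \<in> ?X" for p
        unfolding V_def using that by (intro openin_weak_star_test \<phi>L1) auto
    qed
    then show ?thesis unfolding U_def by (auto simp: case_prod_unfold)
  qed
  moreover have "Q \<in> U" using Q \<tau>' by (auto simp: U_def V_def topspace_weak_star)
  moreover have "norm ((LINT x:A|?M. y x) - (LINT x:A|?M. Q x)) < \<tau>" if y: "y \<in> U" and A: "A \<in> Z" for y A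
  proof -
    let ?D = "(LINT x:A|?M. y x) - (LINT x:A|?M. Q x)"
    have yL: "y \<in> Linf \<Omega> sym_matrices" using y by (simp add: U_def topspace_weak_star)
    have "\<bar>?D $ a $ b\<bar> \<le> \<tau>'" for a b
    proof -
      have "y \<in> V A a b" using y A by (auto simp: U_def)
      then show ?thesis
        using test[OF A yL, of a b] test[OF A Q, of a b]
        by (simp add: V_def dist_real_def abs_minus_commute less_imp_le)
    qed
    then have "(\<Sum>a\<in>UNIV. \<Sum>b\<in>UNIV. \<bar>?D $ a $ b\<bar>) \<le> (\<Sum>a\<in>(UNIV :: 'n set). \<Sum>b\<in>(UNIV :: 'n set). \<tau>')"
      by (intro sum_mono)
    then have "norm ?D \<le> real CARD('n) * real CARD('n) * \<tau>'"
      using norm_matrix_le_sum[of ?D] by simp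
    also have "\<dots> < (real CARD('n) * real CARD('n) + 1) * \<tau>'" using \<tau>' by simp
    also have "\<dots> = \<tau>"
    proof -
      have "real CARD('n) * real CARD('n) + 1 \<noteq> 0" using zero_le_square[of "real CARD('n)"] by linarith
      then show ?thesis by (simp add: \<tau>'_def)
    qed
    finally show ?thesis .
  qed
  ultimately show ?thesis by blast
qed

text \<open>If the average were outside the closed convex set, a hyperplane would separate them
  strictly; integrating the strict inequality over the cube gives a contradiction.\<close>

lemma grid_avg_mem_convex:
  fixes \<phi> :: "real^'n \<Rightarrow> 'b::euclidean_space"
  assumes S: "convex S" "closed S" and int: "integrable (lebesgue_on \<Omega>) \<phi>"
    and ae: "AE x in lebesgue_on \<Omega>. \<phi> x \<in> S" and r: "r > 0" and z: "z \<in> inner_cubes r \<Omega>"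
  shows "grid_avg \<Omega> r \<phi> z \<in> S"
proof (rule ccontr)
  let ?M = "lebesgue_on \<Omega>" and ?C = "grid r z"
  interpret finite_measure ?M using lm by (rule finite_measure_lebesgue_on_lmeasurable)
  note C = grid_sets[OF bdd lm r z]
  have c: "r ^ CARD('n) > 0" using r by simp
  assume "grid_avg \<Omega> r \<phi> z \<notin> S"
  from separating_hyperplane_closed_point[OF S this] obtain w b where
    wb: "w \<bullet> grid_avg \<Omega> r \<phi> z < b" "\<forall>x\<in>S. b < w \<bullet> x" by blast
  have "r ^ CARD('n) * b = (LINT x:?C|?M. b)" using set_integral_const[OF C(1,3), of b] C(2) by simp
  also have "\<dots> \<le> (LINT x:?C|?M. w \<bullet> \<phi> x)"
  proof (rule set_integral_mono_AE)
    show "AE x \<in> ?C in ?M. b \<le> w \<bullet> \<phi> x" using ae by eventually_elim (use wb(2) in auto)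
  qed (use int in \<open>auto intro!: set_integrableI_integrable C\<close>)
  also have "\<dots> = (LINT x|?M. w \<bullet> (indicator ?C x *\<^sub>R \<phi> x))" by (simp add: set_lebesgue_integral_def)
  also have "\<dots> = w \<bullet> (LINT x:?C|?M. \<phi> x)"
    unfolding set_lebesgue_integral_def by (intro integral_inner_right integrable_mult_indicator C int)
  also have "\<dots> = r ^ CARD('n) * (w \<bullet> grid_avg \<Omega> r \<phi> z)" using r by (simp add: grid_avg_def)
  finally show False using wb(1) c by simp
qed

text \<open>On each cube the test function is split into its average and the oscillation around it.
  The oscillation is paired with \<open>y - Q\<close>, which is bounded by 2; the average only sees
  the integral of \<open>y - Q\<close>, which \<open>close\<close> controls. Off the inner cubes the
  bound 2 is used again.\<close>

lemma weak_test_difference_le: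
  fixes y Q \<phi> :: "real^'n \<Rightarrow> real^'n^'n"
  assumes \<phi>: "integrable (lebesgue_on \<Omega>) \<phi>" and y: "y \<in> Linf \<Omega> S" "AE x in lebesgue_on \<Omega>. norm (y x) \<le> 1"
    and Q: "Q \<in> Linf \<Omega> S'" "AE x in lebesgue_on \<Omega>. norm (Q x) \<le> 1" and r: "r > 0"
    and close: "\<And>z. z \<in> inner_cubes r \<Omega> \<Longrightarrow>
      norm ((LINT x:grid r z|lebesgue_on \<Omega>. y x) - (LINT x:grid r z|lebesgue_on \<Omega>. Q x)) \<le> \<kappa> * r ^ CARD('n)"
    and \<kappa>: "\<kappa> \<ge> 0"
  shows "\<bar>(LINT x|lebesgue_on \<Omega>. \<phi> x \<bullet> y x) - (LINT x|lebesgue_on \<Omega>. \<phi> x \<bullet> Q x)\<bar> \<le>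
    2 * (\<Sum>z\<in>inner_cubes r \<Omega>. LINT x:grid r z|lebesgue_on \<Omega>. norm (\<phi> x - grid_avg \<Omega> r \<phi> z))
    + \<kappa> * (LINT x|lebesgue_on \<Omega>. norm (\<phi> x)) + 2 * (LINT x:rest r \<Omega>|lebesgue_on \<Omega>. norm (\<phi> x))"
proof -
  let ?M = "lebesgue_on \<Omega>" and ?Z = "inner_cubes r \<Omega>"
  interpret finite_measure ?M using lm by (rule finite_measure_lebesgue_on_lmeasurable)
  define D where "D x = y x - Q x" for x
  have yQ: "integrable ?M y" "integrable ?M Q" using Linf_integrable y(1) Q(1) by blast+
  have D2: "AE x in ?M. norm (D x) \<le> 2" using y(2) Q(2)
  proof eventually_elim
    case (elim x)
    then show ?case using norm_triangle_ineq4[of "y x" "Q x"] by (simp add: D_def)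
  qed
  have D: "D \<in> Linf \<Omega> UNIV" using D2 yQ unfolding Linf_def D_def by auto
  have Di: "integrable ?M D" by (rule Linf_integrable[OF D])
  have bound: "\<bar>LINT x:A|?M. \<psi> x \<bullet> D x\<bar> \<le> 2 * (LINT x:A|?M. norm (\<psi> x))"
    if A: "A \<in> sets ?M" and \<psi>: "integrable ?M \<psi>" for A \<psi>
  proof -
    have "norm (LINT x:A|?M. \<psi> x \<bullet> D x) \<le> (LINT x:A|?M. norm (\<psi> x \<bullet> D x))"
      by (intro set_integral_norm_bound set_integrableI_integrable integrable_inner_Linf[OF \<psi> D] A)
    also have "\<dots> \<le> (LINT x:A|?M. 2 * norm (\<psi> x))"
    proof (rule set_integral_mono_AE)
      show "AE x\<in>A in ?M. norm (\<psi> x \<bullet> D x) \<le> 2 * norm (\<psi> x)"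
        using D2
      proof eventually_elim
        case (elim x)
        have "norm (\<psi> x \<bullet> D x) \<le> norm (\<psi> x) * norm (D x)" by (simp add: Cauchy_Schwarz_ineq2)
        also have "\<dots> \<le> norm (\<psi> x) * 2" using elim by (intro mult_left_mono) auto
        finally show ?case by simp
      qed
      show "set_integrable ?M A (\<lambda>x. norm (\<psi> x \<bullet> D x))"
        by (intro set_integrableI_integrable integrable_norm integrable_inner_Linf[OF \<psi> D] A)
      show "set_integrable ?M A (\<lambda>x. 2 * norm (\<psi> x))"
        using \<psi> by (intro set_integrableI_integrable A) auto
    qed
    finally show ?thesis by simp
  qed
  have cube: "\<bar>LINT x:grid r z|?M. \<phi> x \<bullet> D x\<bar> \<le> 2 * (LINT x:grid r z|?M. norm (\<phi> x - grid_avg \<Omega> r \<phi> z))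
      + \<kappa> * (LINT x:grid r z|?M. norm (\<phi> x))" if z: "z \<in> ?Z" for z
  proof -
    let ?C = "grid r z" and ?a = "grid_avg \<Omega> r \<phi> z"
    note C = grid_sets[OF bdd lm r z]
    have i1: "integrable ?M (\<lambda>x. \<phi> x - ?a)" using \<phi> by simp
    have i2: "integrable ?M (\<lambda>x. ?a)" by simp
    have "(LINT x:?C|?M. \<phi> x \<bullet> D x) = (LINT x:?C|?M. (\<phi> x - ?a) \<bullet> D x + ?a \<bullet> D x)"
      by (simp add: inner_diff_left)
    also have "\<dots> = (LINT x:?C|?M. (\<phi> x - ?a) \<bullet> D x) + (LINT x:?C|?M. ?a \<bullet> D x)"
      by (intro set_integral_add set_integrableI_integrable integrable_inner_Linf[OF i1 D] integrable_inner_Linf[OF i2 D] C)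
    also have "(LINT x:?C|?M. ?a \<bullet> D x) = ?a \<bullet> (LINT x:?C|?M. D x)"
    proof -
      have "(LINT x:?C|?M. ?a \<bullet> D x) = (LINT x|?M. ?a \<bullet> (indicator ?C x *\<^sub>R D x))"
        by (simp add: set_lebesgue_integral_def)
      also have "\<dots> = ?a \<bullet> (LINT x:?C|?M. D x)"
        unfolding set_lebesgue_integral_def by (intro integral_inner_right integrable_mult_indicator C Di)
      finally show ?thesis .
    qed
    finally have eq: "(LINT x:?C|?M. \<phi> x \<bullet> D x) = (LINT x:?C|?M. (\<phi> x - ?a) \<bullet> D x) + ?a \<bullet> (LINT x:?C|?M. D x)" .
    have "(LINT x:?C|?M. D x) = (LINT x:?C|?M. y x) - (LINT x:?C|?M. Q x)"
      unfolding D_def by (intro set_integral_diff set_integrableI_integrable yQ C)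
    then have "norm (LINT x:?C|?M. D x) \<le> \<kappa> * r ^ CARD('n)" using close[OF z] by simp
    then have "\<bar>?a \<bullet> (LINT x:?C|?M. D x)\<bar> \<le> norm ?a * (\<kappa> * r ^ CARD('n))"
      using Cauchy_Schwarz_ineq2[of ?a "LINT x:?C|?M. D x"] mult_left_mono[of _ _ "norm ?a"] by force
    also have "\<dots> = \<kappa> * norm (LINT x:?C|?M. \<phi> x)" using r by (simp add: grid_avg_def)
    also have "\<dots> \<le> \<kappa> * (LINT x:?C|?M. norm (\<phi> x))"
      by (intro mult_left_mono \<kappa> set_integral_norm_bound set_integrableI_integrable \<phi> C)
    finally show ?thesis using eq bound[OF C(1) i1] by linarith
  qed
  have "(LINT x|?M. \<phi> x \<bullet> y x) - (LINT x|?M. \<phi> x \<bullet> Q x) = (LINT x|?M. \<phi> x \<bullet> D x)"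
    unfolding D_def inner_diff_right
    by (intro Bochner_Integration.integral_diff[symmetric] integrable_inner_Linf[OF \<phi> y(1)]
        integrable_inner_Linf[OF \<phi> Q(1)])
  also have "\<dots> = (\<Sum>z\<in>?Z. LINT x:grid r z|?M. \<phi> x \<bullet> D x) + (LINT x:rest r \<Omega>|?M. \<phi> x \<bullet> D x)"
    by (rule integral_grid_decomposition[OF bdd lm r integrable_inner_Linf[OF \<phi> D]])
  finally have eq: "(LINT x|?M. \<phi> x \<bullet> y x) - (LINT x|?M. \<phi> x \<bullet> Q x) =
      (\<Sum>z\<in>?Z. LINT x:grid r z|?M. \<phi> x \<bullet> D x) + (LINT x:rest r \<Omega>|?M. \<phi> x \<bullet> D x)" .
  have "\<bar>(LINT x|?M. \<phi> x \<bullet> y x) - (LINT x|?M. \<phi> x \<bullet> Q x)\<bar> \<le>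
      (\<Sum>z\<in>?Z. \<bar>LINT x:grid r z|?M. \<phi> x \<bullet> D x\<bar>) + \<bar>LINT x:rest r \<Omega>|?M. \<phi> x \<bullet> D x\<bar>"
    unfolding eq by (intro order.trans[OF abs_triangle_ineq] add_right_mono sum_abs)
  also have "(\<Sum>z\<in>?Z. \<bar>LINT x:grid r z|?M. \<phi> x \<bullet> D x\<bar>) \<le>
      (\<Sum>z\<in>?Z. 2 * (LINT x:grid r z|?M. norm (\<phi> x - grid_avg \<Omega> r \<phi> z)) + \<kappa> * (LINT x:grid r z|?M. norm (\<phi> x)))"
    by (intro sum_mono cube)
  also have "\<dots> = 2 * (\<Sum>z\<in>?Z. LINT x:grid r z|?M. norm (\<phi> x - grid_avg \<Omega> r \<phi> z))
      + \<kappa> * (\<Sum>z\<in>?Z. LINT x:grid r z|?M. norm (\<phi> x))"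
    by (simp add: sum.distrib sum_distrib_left)
  also have "\<kappa> * (\<Sum>z\<in>?Z. LINT x:grid r z|?M. norm (\<phi> x)) \<le> \<kappa> * (LINT x|?M. norm (\<phi> x))"
    using \<phi> by (intro mult_left_mono \<kappa> sum_set_integral_grid_le[OF bdd lm r]) auto
  also have "\<bar>LINT x:rest r \<Omega>|?M. \<phi> x \<bullet> D x\<bar> \<le> 2 * (LINT x:rest r \<Omega>|?M. norm (\<phi> x))"
    by (intro bound rest_sets[OF bdd lm r] \<phi>)
  finally show ?thesis by simp
qed

text \<open>Countably many linear inequalities describe \<open>K_set\<close>, so one of them fails
  for \<open>Q\<close> on a set \<open>P\<close> of positive measure. Integrating that inequality
  over \<open>P\<close> gives a weak-star open half-space that contains \<open>Q\<close> but no
  tensor-valued function.\<close>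

lemma weak_star_separates_K_set:
  assumes Q: "Q \<in> Linf \<Omega> sym_matrices" "Q \<notin> Linf \<Omega> K_set"
  shows "\<exists>U. openin (weak_star \<Omega>) U \<and> Q \<in> U \<and> (\<forall>y\<in>U. \<not> (AE x in lebesgue_on \<Omega>. y x \<in> sphere_tensor))"
proof -
  let ?M = "lebesgue_on \<Omega>"
  interpret finite_measure ?M using lm by (rule finite_measure_lebesgue_on_lmeasurable)
  obtain D :: "(real^'n) set" where D: "countable D" "UNIV \<subseteq> closure D"
    using separable[of "UNIV :: (real^'n) set"] by metis
  have Qi: "integrable ?M Q" by (rule Linf_integrable[OF Q(1)])
  have sym: "AE x in ?M. Q x \<in> sym_matrices" using Q(1) by (simp add: Linf_def)
  \<comment> \<open>A pair (A, b) stands for the inequality A . Q <= b. The trace condition is split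
    into two inequalities, and the positivity of the form is required for the directions in
    \<open>D\<close> only.\<close>
  define \<F> :: "((real^'n^'n) \<times> real) set" where "\<F> = insert (mat 1, 1) (insert (- mat 1, - 1) ((\<lambda>v. (- tensor v v, 0)) ` D))"
  have tsym: "tensor v v \<in> sym_matrices" for v :: "real^'n"
    by (simp add: sym_matrices_def tensor_def transpose_def vec_eq_iff mult.commute)
  have msym: "(mat 1 :: real^'n^'n) \<in> sym_matrices" by (simp add: sym_matrices_def transpose_mat)
  have neg: "- A \<in> sym_matrices" if "A \<in> sym_matrices" for A :: "real^'n^'n"
    using that by (auto simp: sym_matrices_def transpose_def vec_eq_iff)
  have "\<exists>(A, b)\<in>\<F>. \<not> (AE x in ?M. A \<bullet> Q x \<le> b)"
  proof (rule ccontr)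
    assume "\<not> ?thesis"
    then have all: "\<forall>p\<in>\<F>. AE x in ?M. fst p \<bullet> Q x \<le> snd p" by (auto simp: case_prod_unfold)
    have "countable \<F>" using D(1) by (simp add: \<F>_def)
    then have "AE x in ?M. \<forall>p\<in>\<F>. fst p \<bullet> Q x \<le> snd p" using all by (simp add: AE_ball_countable)
    then have "AE x in ?M. Q x \<in> K_set" using sym
    proof eventually_elim
      case (elim x)
      have "\<forall>v\<in>D. 0 \<le> Q x \<bullet> tensor v v" "Q x \<bullet> mat 1 \<le> 1" "1 \<le> Q x \<bullet> mat 1"
        using elim(1) by (auto simp: \<F>_def inner_commute)
      then show ?case using sym_in_K_set_iff_dense[OF D(2) elim(2)] by auto
    qed
    then show False using Q by (simp add: Linf_def)
  qed
  then obtain A b where Ab: "(A, b) \<in> \<F>" "\<not> (AE x in ?M. A \<bullet> Q x \<le> b)" by blast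
  have Asym: "A \<in> sym_matrices" using Ab(1) tsym msym neg by (auto simp: \<F>_def)
  have AS: "A \<bullet> s \<le> b" if "s \<in> sphere_tensor" for s
    using subsetD[OF sphere_tensor_subset_K_set that] Ab(1) by (auto simp: \<F>_def K_set_eq_halfspaces inner_commute)
  define P where "P = {x \<in> space ?M. b < A \<bullet> Q x}"
  have AQ: "integrable ?M (\<lambda>x. A \<bullet> Q x)" using Qi by simp
  have P: "P \<in> sets ?M" unfolding P_def using borel_measurable_integrable[OF AQ] by measurable
  have Pi: "integrable ?M (indicat_real P)" using P by (intro integrable_real_indicator) (simp_all add: less_top[symmetric])
  define \<phi> where "\<phi> x = indicator P x *\<^sub>R A" for x
  have \<phi>i: "integrable ?M \<phi>" unfolding \<phi>_def by (intro integrable_mult_indicator P) simp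
  have \<phi>L1: "\<phi> \<in> L1 \<Omega> sym_matrices"
  proof -
    have "\<phi> x \<in> sym_matrices" for x
      using Asym by (cases "x \<in> P") (auto simp: \<phi>_def sym_matrices_def transpose_def vec_eq_iff)
    then show ?thesis using \<phi>i by (simp add: L1_def)
  qed
  have test: "(LINT x|?M. \<phi> x \<bullet> y x) - b * measure ?M P = (LINT x|?M. indicator P x * (A \<bullet> y x - b))"
    if y: "y \<in> Linf \<Omega> S" for y S
  proof -
    have "(LINT x|?M. indicator P x * (A \<bullet> y x - b)) = (LINT x|?M. \<phi> x \<bullet> y x - b * indicator P x)"
      by (intro Bochner_Integration.integral_cong) (auto simp: \<phi>_def algebra_simps)
    also have "\<dots> = (LINT x|?M. \<phi> x \<bullet> y x) - (LINT x|?M. b * indicator P x)"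
      using Pi by (intro Bochner_Integration.integral_diff integrable_inner_Linf[OF \<phi>i y]) simp
    finally show ?thesis using P sets.sets_into_space[OF P] by (simp add: Int_absorb2)
  qed
  define U where "U = {y \<in> Linf \<Omega> sym_matrices. (LINT x|?M. \<phi> x \<bullet> y x) \<in> {b * measure ?M P<..}}"
  have "openin (weak_star \<Omega>) U" unfolding U_def by (intro openin_weak_star_test \<phi>L1) simp
  moreover have "Q \<in> U"
  proof -
    let ?g = "\<lambda>x. indicator P x * (A \<bullet> Q x - b)"
    have gi: "integrable ?M ?g"
      using integrable_mult_indicator[OF P, of "\<lambda>x. A \<bullet> Q x - b"] AQ by simp
    have g0: "?g x \<ge> 0" for x by (auto simp: indicator_def P_def)
    have "(LINT x|?M. ?g x) \<noteq> 0"
    proof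
      assume "(LINT x|?M. ?g x) = 0"
      then have "AE x in ?M. ?g x = 0" using integral_nonneg_eq_0_iff_AE[OF gi] g0 by simp
      then have "AE x in ?M. A \<bullet> Q x \<le> b" using AE_space
        by eventually_elim (auto simp: indicator_def P_def split: if_splits)
      then show False using Ab(2) by simp
    qed
    moreover have "(LINT x|?M. ?g x) \<ge> 0" by (intro Bochner_Integration.integral_nonneg g0)
    ultimately show ?thesis using test[OF Q(1)] Q(1) by (simp add: U_def)
  qed
  moreover have "\<not> (AE x in ?M. y x \<in> sphere_tensor)" if "y \<in> U" for y
  proof
    assume ae: "AE x in ?M. y x \<in> sphere_tensor"
    have y: "y \<in> Linf \<Omega> sym_matrices" using that by (simp add: U_def)
    have "AE x in ?M. 0 \<le> - (indicator P x * (A \<bullet> y x - b))"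
      using ae by eventually_elim (use AS in \<open>auto simp: indicator_def\<close>)
    then have "0 \<le> (LINT x|?M. - (indicator P x * (A \<bullet> y x - b)))"
      by (rule integral_nonneg_AE)
    then show False using test[OF y] that by (simp add: U_def)
  qed
  ultimately show ?thesis by blast
qed

end

section \<open>Gamma-convergence\<close>

context periodic_interaction
begin

text \<open>Unlike \<open>cell_density \<rho>\<close>, the following regularisation is lower semicontinuous on \<open>K_set\<close>,
  hence Borel; it increases to \<open>hom_density\<close> as \<open>\<rho>\<close> decreases to \<open>0\<close>.\<close>

definition density_env :: "real \<Rightarrow> real^'a^'a \<Rightarrow> real" where
  "density_env \<rho> P = (if P \<in> K_set then (SUP \<rho>'\<in>{\<rho><..}. cell_density \<rho>' P) else 0)"

lemma cell_density_le_env: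
  assumes "P \<in> K_set" "0 \<le> \<rho>" "\<rho> < \<rho>'"
  shows "cell_density \<rho>' P \<le> density_env \<rho> P"
proof -
  have "{\<rho><..} \<subseteq> {0<..}" using assms(2) by auto
  then show ?thesis
    using assms(1,3) unfolding density_env_def by (auto intro!: cSUP_upper bdd_above_density)
qed

lemma density_env_le:
  assumes "P \<in> K_set" "\<And>\<rho>'. \<rho> < \<rho>' \<Longrightarrow> cell_density \<rho>' P \<le> c"
  shows "density_env \<rho> P \<le> c"
  using assms unfolding density_env_def by (auto intro!: cSUP_least)

lemma less_density_env_iff:
  assumes "P \<in> K_set" "0 \<le> \<rho>"
  shows "c < density_env \<rho> P \<longleftrightarrow> (\<exists>\<rho>'>\<rho>. c < cell_density \<rho>' P)"
proof -
  have "{\<rho><..} \<subseteq> {0<..}" using assms(2) by auto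
  then show ?thesis
    using less_cSUP_iff[OF _ bdd_above_density[OF assms(1)], of "{\<rho><..}" c] assms(1)
    by (auto simp: density_env_def)
qed

lemma density_env_abs_le: "0 \<le> \<rho> \<Longrightarrow> \<bar>density_env \<rho> P\<bar> \<le> M"
proof (cases "P \<in> K_set")
  case True
  assume "0 \<le> \<rho>"
  then have "\<bar>SUP \<rho>'\<in>{\<rho><..}. cell_density \<rho>' P\<bar> \<le> M"
    using cell_density_abs_le[OF True] by (intro cSup_abs_le) auto
  then show ?thesis using True by (simp add: density_env_def)
next
  case False
  then show ?thesis using M_pos by (simp add: density_env_def)
qed

lemma density_env_0: "P \<in> K_set \<Longrightarrow> density_env 0 P = f_hom f P"
  by (simp add: density_env_def f_hom_eq hom_density_def)

text \<open>Superlevel sets are relatively open in \<open>K_set\<close>: the supremum runs over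
  radii strictly above \<rho>, so a radius that witnesses the inequality can be lowered halfway to
  \<rho>, and the radius gained absorbs a small move of the matrix.\<close>

lemma borel_measurable_density_env:
  assumes \<rho>: "0 \<le> \<rho>"
  shows "density_env \<rho> \<in> borel_measurable borel"
proof (rule borel_measurableI_greater)
  fix c
  define S where "S = {P \<in> K_set. c < density_env \<rho> P}"
  have "openin (top_of_set K_set) S"
    unfolding openin_euclidean_subtopology_iff
  proof (intro conjI ballI)
    show "S \<subseteq> K_set" by (auto simp: S_def)
    fix P assume "P \<in> S"
    then have P: "P \<in> K_set" "c < density_env \<rho> P" by (auto simp: S_def)
    then obtain \<rho>' where \<rho>': "\<rho> < \<rho>'" "c < cell_density \<rho>' P" using less_density_env_iff[OF P(1) \<rho>] by blast
    show "\<exists>e>0. \<forall>P'\<in>K_set. dist P' P < e \<longrightarrow> P' \<in> S"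
    proof (intro exI[of _ "(\<rho>' - \<rho>) / 2"] conjI ballI impI)
      show "(\<rho>' - \<rho>) / 2 > 0" using \<rho>'(1) by simp
      fix P' assume P': "P' \<in> K_set" "dist P' P < (\<rho>' - \<rho>) / 2"
      have "cell_density \<rho>' P \<le> cell_density ((\<rho>' + \<rho>) / 2) P'"
        using P' \<rho>' \<rho> by (intro cell_density_mono P P') (auto simp: dist_norm field_simps)
      then have "c < cell_density ((\<rho>' + \<rho>) / 2) P'" using \<rho>'(2) by simp
      moreover have "\<rho> < (\<rho>' + \<rho>) / 2" using \<rho>'(1) by simp
      ultimately have "c < density_env \<rho> P'" using less_density_env_iff[OF P'(1) \<rho>] by blast
      then show "P' \<in> S" using P'(1) by (simp add: S_def)
    qed
  qed
  then obtain T where T: "open T" "S = K_set \<inter> T" by (auto simp: openin_open)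
  have "S \<in> sets borel" unfolding T(2) using T(1) closed_K_set by (intro sets.Int borel_open borel_closed)
  moreover have "{P. c < density_env \<rho> P} = S \<union> (if c < 0 then - K_set else {})"
    by (auto simp: S_def density_env_def)
  moreover have "- K_set \<in> sets borel" using closed_K_set by (intro borel_open) auto
  ultimately show "{x \<in> space borel. c < density_env \<rho> x} \<in> sets borel" by (cases "c < 0") auto
qed

lemma density_env_tendsto: "(\<lambda>j. density_env (1 / real (Suc j)) P) \<longlonglongrightarrow> density_env 0 P"
proof (cases "P \<in> K_set")
  case True
  show ?thesis
  proof (rule order_tendstoI)
    fix c assume "c < density_env 0 P"
    then obtain \<rho>' where \<rho>': "0 < \<rho>'" "c < cell_density \<rho>' P" using less_density_env_iff[OF True] by auto
    have "(\<lambda>j. 1 / real (Suc j)) \<longlonglongrightarrow> 0"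
      using LIMSEQ_inverse_real_of_nat by (simp add: inverse_eq_divide)
    then have "\<forall>\<^sub>F j in sequentially. 1 / real (Suc j) < \<rho>'" using \<rho>'(1) by (rule order_tendstoD(2))
    then show "\<forall>\<^sub>F j in sequentially. c < density_env (1 / real (Suc j)) P"
    proof eventually_elim
      case (elim j)
      then have "cell_density \<rho>' P \<le> density_env (1 / real (Suc j)) P"
        by (intro cell_density_le_env True) auto
      then show ?case using \<rho>'(2) by simp
    qed
  next
    fix c assume c: "density_env 0 P < c"
    have "density_env (1 / real (Suc j)) P \<le> density_env 0 P" for j
    proof (intro density_env_le cell_density_le_env True)
      fix \<rho>' :: real assume "1 / real (Suc j) < \<rho>'"
      moreover have "0 < 1 / real (Suc j)" by simp
      ultimately show "0 < \<rho>'" by linarith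
    qed simp
    then show "\<forall>\<^sub>F j in sequentially. density_env (1 / real (Suc j)) P < c"
      using c by (intro always_eventually allI) (metis order_le_less_trans)
  qed
qed (simp add: density_env_def)

text \<open>For matrices at distance at most \<rho> the radii absorb the distance, as 3 \<rho> +
  \<rho> = 4 \<rho>. At a larger distance the penalty exceeds \<open>2 * M\<close>, the greatest
  possible difference of the two densities.\<close>

lemma cell_density_ge_env:
  assumes P: "P \<in> K_set" and s: "s \<in> K_set" and \<rho>: "\<rho> > 0"
  shows "density_env (4 * \<rho>) P - 2 * M / \<rho> * norm (P - s) \<le> cell_density (3 * \<rho>) s"
proof (cases "norm (P - s) \<le> \<rho>")
  case True
  have "density_env (4 * \<rho>) P \<le> cell_density (3 * \<rho>) s"
  proof (rule density_env_le[OF P])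
    fix \<rho>' assume "4 * \<rho> < \<rho>'"
    then show "cell_density \<rho>' P \<le> cell_density (3 * \<rho>) s"
      using True \<rho> by (intro cell_density_mono s P) (auto simp: norm_minus_commute)
  qed
  moreover have "0 \<le> 2 * M / \<rho> * norm (P - s)" using M_pos \<rho> by simp
  ultimately show ?thesis by linarith
next
  case False
  have "2 * M / \<rho> * \<rho> \<le> 2 * M / \<rho> * norm (P - s)"
    using False M_pos \<rho> by (intro mult_left_mono) auto
  then have "2 * M \<le> 2 * M / \<rho> * norm (P - s)" using \<rho> by simp
  moreover have "density_env (4 * \<rho>) P \<le> M" "- M \<le> cell_density (3 * \<rho>) s"
    using density_env_abs_le[of "4 * \<rho>" P] cell_density_abs_le[OF s, of "3 * \<rho>"] \<rho> by (auto simp: abs_le_iff)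
  ultimately show ?thesis by linarith
qed

text \<open>The same dichotomy with distance \<rho> / 2, which leaves the positive radius \<rho> / 2
  at \<open>P\<close>; this is why the penalty has the factor 4.\<close>

lemma cell_density_le_hom:
  assumes P: "P \<in> K_set" and s: "s \<in> K_set" and \<rho>: "\<rho> > 0"
  shows "cell_density \<rho> s \<le> density_env 0 P + 4 * M / \<rho> * norm (P - s)"
proof (cases "norm (P - s) \<le> \<rho> / 2")
  case True
  have "cell_density \<rho> s \<le> cell_density (\<rho> / 2) P"
    using True \<rho> by (intro cell_density_mono s P) auto
  also have "\<dots> \<le> density_env 0 P" using \<rho> by (intro cell_density_le_env P) auto
  finally have "cell_density \<rho> s \<le> density_env 0 P" .
  moreover have "0 \<le> 4 * M / \<rho> * norm (P - s)" using M_pos \<rho> by simp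
  ultimately show ?thesis by linarith
next
  case False
  have "4 * M / \<rho> * (\<rho> / 2) \<le> 4 * M / \<rho> * norm (P - s)"
    using False M_pos \<rho> by (intro mult_left_mono) auto
  then have "2 * M \<le> 4 * M / \<rho> * norm (P - s)" using \<rho> by simp
  moreover have "- M \<le> density_env 0 P" "cell_density \<rho> s \<le> M"
    using density_env_abs_le[of 0 P] cell_density_abs_le[OF s \<rho>] by (auto simp: abs_le_iff)
  ultimately show ?thesis by linarith
qed

end

section \<open>Energies on the domain and their comparison with integrals\<close>

locale periodic_interaction_domain = periodic_interaction f k C
  for f :: "'a::finite interaction" and k C +
  fixes \<Omega> :: "(real^'a) set"
  assumes bdd: "bounded \<Omega>" and open_\<Omega>: "open \<Omega>" and neg: "negligible (frontier \<Omega>)"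
begin

lemma lm: "\<Omega> \<in> lmeasurable"
  using bdd open_\<Omega> by (rule lmeasurable_open)

sublocale finite_measure "lebesgue_on \<Omega>"
  using lm by (rule finite_measure_lebesgue_on_lmeasurable)

lemma integrable_density_env:
  assumes "Q \<in> Linf \<Omega> K_set" "0 \<le> \<rho>"
  shows "integrable (lebesgue_on \<Omega>) (\<lambda>x. density_env \<rho> (Q x))"
proof (rule integrable_const_bound[of _ M])
  have "Q \<in> borel_measurable (lebesgue_on \<Omega>)" using assms(1) by (simp add: Linf_def)
  then show "(\<lambda>x. density_env \<rho> (Q x)) \<in> borel_measurable (lebesgue_on \<Omega>)"
    using borel_measurable_density_env[OF assms(2)] by (rule measurable_compose)
qed (use density_env_abs_le[OF assms(2)] in auto)

text \<open>Measurability cannot be obtained from \<open>f_hom\<close> directly, whose values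
  outside \<open>K_set\<close> are those of an uncontrolled definite description. It is transferred
  from \<open>density_env 0\<close>, which agrees with it wherever \<open>Q\<close> takes values in
  \<open>K_set\<close>, that is almost everywhere.\<close>

lemma
  assumes Q: "Q \<in> Linf \<Omega> K_set"
  shows integrable_f_hom: "integrable (lebesgue_on \<Omega>) (\<lambda>x. f_hom f (Q x))"
    and integral_f_hom: "(LINT x|lebesgue_on \<Omega>. f_hom f (Q x)) = (LINT x|lebesgue_on \<Omega>. density_env 0 (Q x))"
proof -
  let ?M = "lebesgue_on \<Omega>"
  note i0 = integrable_density_env[OF Q, of 0, simplified]
  have "AE x in ?M. Q x \<in> K_set" using Q by (simp add: Linf_def)
  then have ae: "AE x in ?M. density_env 0 (Q x) = f_hom f (Q x)"
    by eventually_elim (rule density_env_0)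
  have m: "(\<lambda>x. f_hom f (Q x)) \<in> borel_measurable ?M"
    by (rule borel_measurable_lebesgue_on_AE[OF fmeasurableD[OF lm] borel_measurable_integrable[OF i0] ae])
  show "integrable ?M (\<lambda>x. f_hom f (Q x))"
    using integrable_cong_AE[OF borel_measurable_integrable[OF i0] m ae] i0 by simp
  show "(LINT x|?M. f_hom f (Q x)) = (LINT x|?M. density_env 0 (Q x))"
    using integral_cong_AE[OF borel_measurable_integrable[OF i0] m ae] by simp
qed

text \<open>For fixed \<open>r\<close> the sides of the boxes tend to infinity as \<epsilon> tends
  to 0, so the decomposition applies eventually, and uniformly in \<open>u\<close>: the same
  \<epsilon> must work for all functions of a neighbourhood.\<close>

lemma eventually_energy_cubes:
  assumes r: "r > 0" and \<delta>: "\<delta> > 0"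
  shows "\<forall>\<^sub>F \<epsilon> in at_right 0. \<forall>u. (\<forall>i\<in>Z_eps \<epsilon> \<Omega>. u i \<in> sphere_tensor) \<longrightarrow>
    \<bar>\<epsilon> ^ CARD('a) * energy f (Z_eps \<epsilon> \<Omega>) u - \<epsilon> ^ CARD('a) * (\<Sum>z\<in>inner_cubes r \<Omega>. energy f (lbox r \<epsilon> z) u)\<bar>
      \<le> 2 * M * leftover r \<Omega> \<epsilon> + \<delta> * real (card (inner_cubes r \<Omega>)) * (\<epsilon> * lside r \<epsilon>) ^ CARD('a)"
proof -
  from energy_decomposition[OF \<delta>, where 't = "int^'a"] obtain L0 where
    "\<forall>L\<ge>L0. \<forall>A (T :: (int^'a) set) a u. finite A \<longrightarrow> finite T \<longrightarrow> (\<forall>t\<in>T. ibox (a t) L \<subseteq> A) \<longrightarrow>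
    disjoint_family_on (\<lambda>t. ibox (a t) L) T \<longrightarrow> (\<forall>i\<in>A. u i \<in> sphere_tensor) \<longrightarrow>
    \<bar>energy f A u - (\<Sum>t\<in>T. energy f (ibox (a t) L) u)\<bar> \<le>
      2 * M * (real (card A) - real (card T) * real L ^ CARD('a)) + \<delta> * real (card T) * real L ^ CARD('a)" ..
  note L0 = this[rule_format]
  have "\<forall>\<^sub>F \<epsilon> in at_right (0 :: real). \<epsilon> > 0" by (simp add: eventually_at_right_less)
  with eventually_lside_ge[OF r, of L0] show ?thesis
  proof eventually_elim
    case (elim \<epsilon>)
    show ?case
    proof (intro allI impI)
      fix u :: "int^'a \<Rightarrow> real^'a^'a" assume u: "\<forall>i\<in>Z_eps \<epsilon> \<Omega>. u i \<in> sphere_tensor"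
      let ?Z = "inner_cubes r \<Omega>" and ?E = "energy f (Z_eps \<epsilon> \<Omega>) u" and ?S = "\<Sum>z\<in>inner_cubes r \<Omega>. energy f (lbox r \<epsilon> z) u"
      have "\<bar>?E - ?S\<bar> \<le> 2 * M * (real (card (Z_eps \<epsilon> \<Omega>)) - real (card ?Z) * real (lside r \<epsilon>) ^ CARD('a))
          + \<delta> * real (card ?Z) * real (lside r \<epsilon>) ^ CARD('a)"
      proof (rule L0[OF elim(1)])
        show "finite (Z_eps \<epsilon> \<Omega>)" by (rule finite_Z_eps[OF bdd elim(2)])
        show "finite ?Z" by (rule finite_inner_cubes[OF bdd r])
        show "lbox r \<epsilon> z \<subseteq> Z_eps \<epsilon> \<Omega>" if "z \<in> ?Z" for z by (rule lbox_subset_Z_eps[OF r elim(2) that])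
        show "disjoint_family_on (lbox r \<epsilon>) ?Z"
          unfolding disjoint_family_on_def by (intro ballI impI lbox_disjoint[OF r elim(2)])
        show "u i \<in> sphere_tensor" if "i \<in> Z_eps \<epsilon> \<Omega>" for i using u that by blast
      qed
      then have "\<epsilon> ^ CARD('a) * \<bar>?E - ?S\<bar> \<le> \<epsilon> ^ CARD('a) * (2 * M * (real (card (Z_eps \<epsilon> \<Omega>)) - real (card ?Z) * real (lside r \<epsilon>) ^ CARD('a))
          + \<delta> * real (card ?Z) * real (lside r \<epsilon>) ^ CARD('a))"
        using elim(2) by (intro mult_left_mono) auto
      moreover have "\<epsilon> ^ CARD('a) * \<bar>?E - ?S\<bar> = \<bar>\<epsilon> ^ CARD('a) * ?E - \<epsilon> ^ CARD('a) * ?S\<bar>"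
        using elim(2) by (simp add: abs_mult right_diff_distrib[symmetric])
      ultimately show "\<bar>\<epsilon> ^ CARD('a) * ?E - \<epsilon> ^ CARD('a) * ?S\<bar>
        \<le> 2 * M * leftover r \<Omega> \<epsilon> + \<delta> * real (card ?Z) * (\<epsilon> * lside r \<epsilon>) ^ CARD('a)"
        by (simp add: leftover_def power_mult_distrib algebra_simps)
    qed
  qed
qed

lemma volume_inner_cubes_le:
  assumes r: "r > 0"
  shows "r ^ CARD('a) * card (inner_cubes r \<Omega>) \<le> measure lebesgue \<Omega>"
proof -
  have "measure lebesgue (\<Union>z\<in>inner_cubes r \<Omega>. grid r z) = (\<Sum>z\<in>inner_cubes r \<Omega>. measure lebesgue (grid r z))"
    using finite_inner_cubes[OF bdd r] grid_lmeasurable[OF r] grid_disjoint[OF r]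
    by (intro measure_UNION') (auto simp: pairwise_def disjnt_def)
  moreover have "measure lebesgue (\<Union>z\<in>inner_cubes r \<Omega>. grid r z) \<le> measure lebesgue \<Omega>"
    using finite_inner_cubes[OF bdd r] grid_lmeasurable[OF r] lm
    by (intro measure_mono_fmeasurable) (auto simp: inner_cubes_def intro: fmeasurableD)
  ultimately show ?thesis by (simp add: measure_grid[OF r] mult.commute)
qed

lemma grid_avg_in_K_set:
  assumes "Q \<in> Linf \<Omega> K_set" "r > 0" "z \<in> inner_cubes r \<Omega>"
  shows "grid_avg \<Omega> r Q z \<in> K_set"
proof (rule grid_avg_mem_convex[OF bdd lm convex_K_set closed_K_set _ _ assms(2,3)])
  show "integrable (lebesgue_on \<Omega>) Q" by (rule Linf_integrable[OF bdd lm assms(1)])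
  show "AE x in lebesgue_on \<Omega>. Q x \<in> K_set" using assms(1) by (simp add: Linf_def)
qed

lemma Linf_K_set_norm_le:
  assumes "Q \<in> Linf \<Omega> K_set"
  shows "AE x in lebesgue_on \<Omega>. norm (Q x) \<le> 1"
proof -
  have "AE x in lebesgue_on \<Omega>. Q x \<in> K_set" using assms by (simp add: Linf_def)
  then show ?thesis by eventually_elim (rule norm_K_set_le)
qed

lemma Linf_K_set_sym: "Q \<in> Linf \<Omega> K_set \<Longrightarrow> Q \<in> Linf \<Omega> sym_matrices"
  by (auto simp: Linf_def K_set_def)

lemma disc_energy_C_eps:
  assumes \<epsilon>: "\<epsilon> > 0" and y: "y \<in> C_eps \<epsilon> \<Omega>"
  shows "disc_energy f \<epsilon> \<Omega> y = ereal (\<epsilon> ^ CARD('a) * energy f (Z_eps \<epsilon> \<Omega>) (\<lambda>i. y (\<epsilon> *\<^sub>R lat i)))"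
    and "\<And>i. i \<in> Z_eps \<epsilon> \<Omega> \<Longrightarrow> y (\<epsilon> *\<^sub>R lat i) \<in> sphere_tensor"
proof -
  show S: "y (\<epsilon> *\<^sub>R lat i) \<in> sphere_tensor" if "i \<in> Z_eps \<epsilon> \<Omega>" for i
    using y that by (simp add: C_eps_def Z_eps_def)
  show "disc_energy f \<epsilon> \<Omega> y = ereal (\<epsilon> ^ CARD('a) * energy f (Z_eps \<epsilon> \<Omega>) (\<lambda>i. y (\<epsilon> *\<^sub>R lat i)))"
    using S by (intro disc_energy_eq_energy finite_Z_eps[OF bdd \<epsilon>])
qed

text \<open>Both bounds integrate a pointwise comparison of \<open>Q x\<close> with the average of
  its cube; the penalties add up to the oscillation \<open>osc\<close>. The part of the domain off
  the inner cubes contributes at most \<open>M\<close> times the volume of the boundary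
  cubes.\<close>

lemma
  fixes r \<rho> :: real
  assumes Q: "Q \<in> Linf \<Omega> K_set" and r: "r > 0" and \<rho>: "\<rho> > 0"
  defines "osc \<equiv> \<Sum>z\<in>inner_cubes r \<Omega>. LINT x:grid r z|lebesgue_on \<Omega>. norm (Q x - grid_avg \<Omega> r Q z)"
  shows sum_cell_density_ge: "(LINT x|lebesgue_on \<Omega>. density_env (4 * \<rho>) (Q x))
      - M * (r ^ CARD('a) * card (boundary_cubes r \<Omega>)) - 2 * M / \<rho> * osc
      \<le> r ^ CARD('a) * (\<Sum>z\<in>inner_cubes r \<Omega>. cell_density (3 * \<rho>) (grid_avg \<Omega> r Q z))"
    and sum_cell_density_le: "r ^ CARD('a) * (\<Sum>z\<in>inner_cubes r \<Omega>. cell_density \<rho> (grid_avg \<Omega> r Q z))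
      \<le> (LINT x|lebesgue_on \<Omega>. density_env 0 (Q x))
      + M * (r ^ CARD('a) * card (boundary_cubes r \<Omega>)) + 4 * M / \<rho> * osc"
proof -
  let ?M = "lebesgue_on \<Omega>" and ?Z = "inner_cubes r \<Omega>" and ?N = "CARD('a)"
  let ?K = "grid_avg \<Omega> r Q" and ?B = "r ^ CARD('a) * card (boundary_cubes r \<Omega>)"
  have Qi: "integrable ?M Q" by (rule Linf_integrable[OF bdd lm Q])
  have QK: "AE x in ?M. Q x \<in> K_set" using Q by (simp add: Linf_def)
  have di: "integrable ?M (\<lambda>x. norm (Q x - ?K z))" for z using Qi by simp
  have rest: "\<bar>LINT x:rest r \<Omega>|?M. density_env \<sigma> (Q x)\<bar> \<le> M * ?B" if "0 \<le> \<sigma>" for \<sigma>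
  proof -
    have "norm (LINT x:rest r \<Omega>|?M. density_env \<sigma> (Q x)) \<le> measure ?M (rest r \<Omega>) * M"
      using density_env_abs_le[OF that]
      by (intro norm_set_integral_le_measure set_integrableI_integrable integrable_density_env[OF Q that]
          rest_sets[OF bdd lm r]) auto
    also have "\<dots> \<le> ?B * M" using measure_rest_le[OF bdd lm r] M_pos by (intro mult_right_mono) auto
    finally show ?thesis by (simp add: mult.commute)
  qed
  have cst: "r ^ ?N * c = (LINT x:grid r z|?M. c)" if "z \<in> ?Z" for z and c :: real
    using set_integral_const[OF grid_sets(1,3)[OF bdd lm r that], of c] grid_sets(2)[OF bdd lm r that] by simp
  show "(LINT x|?M. density_env (4 * \<rho>) (Q x)) - M * ?B - 2 * M / \<rho> * osc
      \<le> r ^ ?N * (\<Sum>z\<in>?Z. cell_density (3 * \<rho>) (?K z))"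
  proof -
    have \<rho>4: "0 \<le> 4 * \<rho>" using \<rho> by simp
    note ei = integrable_density_env[OF Q \<rho>4]
    have "(LINT x:grid r z|?M. density_env (4 * \<rho>) (Q x)) - 2 * M / \<rho> * (LINT x:grid r z|?M. norm (Q x - ?K z))
        \<le> r ^ ?N * cell_density (3 * \<rho>) (?K z)" if z: "z \<in> ?Z" for z
    proof -
      note si = set_integrableI_integrable[OF _ grid_sets(1)[OF bdd lm r z]]
      have "(LINT x:grid r z|?M. density_env (4 * \<rho>) (Q x)) - 2 * M / \<rho> * (LINT x:grid r z|?M. norm (Q x - ?K z))
          = (LINT x:grid r z|?M. density_env (4 * \<rho>) (Q x) - 2 * M / \<rho> * norm (Q x - ?K z))"
        using ei di[of z] by (subst set_integral_diff(2)) (auto intro!: si)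
      also have "\<dots> \<le> (LINT x:grid r z|?M. cell_density (3 * \<rho>) (?K z))"
      proof (rule set_integral_mono_AE)
        show "AE x \<in> grid r z in ?M. density_env (4 * \<rho>) (Q x) - 2 * M / \<rho> * norm (Q x - ?K z) \<le> cell_density (3 * \<rho>) (?K z)"
          using QK by eventually_elim (use cell_density_ge_env[OF _ grid_avg_in_K_set[OF Q r z] \<rho>] in blast)
      qed (use ei di[of z] in \<open>auto intro!: si\<close>)
      finally show ?thesis using cst[OF z] by simp
    qed
    then have "(\<Sum>z\<in>?Z. (LINT x:grid r z|?M. density_env (4 * \<rho>) (Q x)) - 2 * M / \<rho> * (LINT x:grid r z|?M. norm (Q x - ?K z)))
        \<le> (\<Sum>z\<in>?Z. r ^ ?N * cell_density (3 * \<rho>) (?K z))" by (intro sum_mono)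
    then have "(\<Sum>z\<in>?Z. LINT x:grid r z|?M. density_env (4 * \<rho>) (Q x)) - 2 * M / \<rho> * osc
        \<le> r ^ ?N * (\<Sum>z\<in>?Z. cell_density (3 * \<rho>) (?K z))"
      by (simp add: osc_def sum_subtractf sum_distrib_left)
    then show ?thesis using integral_grid_decomposition[OF bdd lm r ei] rest[OF \<rho>4] by linarith
  qed
  show "r ^ ?N * (\<Sum>z\<in>?Z. cell_density \<rho> (?K z))
      \<le> (LINT x|?M. density_env 0 (Q x)) + M * ?B + 4 * M / \<rho> * osc"
  proof -
    note ei = integrable_density_env[OF Q order.refl]
    have "r ^ ?N * cell_density \<rho> (?K z) \<le> (LINT x:grid r z|?M. density_env 0 (Q x))
        + 4 * M / \<rho> * (LINT x:grid r z|?M. norm (Q x - ?K z))" if z: "z \<in> ?Z" for z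
    proof -
      note si = set_integrableI_integrable[OF _ grid_sets(1)[OF bdd lm r z]]
      have "(LINT x:grid r z|?M. cell_density \<rho> (?K z))
          \<le> (LINT x:grid r z|?M. density_env 0 (Q x) + 4 * M / \<rho> * norm (Q x - ?K z))"
      proof (rule set_integral_mono_AE)
        show "AE x \<in> grid r z in ?M. cell_density \<rho> (?K z) \<le> density_env 0 (Q x) + 4 * M / \<rho> * norm (Q x - ?K z)"
          using QK by eventually_elim (use cell_density_le_hom[OF _ grid_avg_in_K_set[OF Q r z] \<rho>] in blast)
      qed (use ei di[of z] in \<open>auto intro!: si\<close>)
      also have "\<dots> = (LINT x:grid r z|?M. density_env 0 (Q x))
          + 4 * M / \<rho> * (LINT x:grid r z|?M. norm (Q x - ?K z))"
        using ei di[of z] by (subst set_integral_add(2)) (auto intro!: si)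
      finally show ?thesis using cst[OF z] by simp
    qed
    then have "(\<Sum>z\<in>?Z. r ^ ?N * cell_density \<rho> (?K z)) \<le> (\<Sum>z\<in>?Z. (LINT x:grid r z|?M. density_env 0 (Q x))
        + 4 * M / \<rho> * (LINT x:grid r z|?M. norm (Q x - ?K z)))" by (intro sum_mono)
    then have "r ^ ?N * (\<Sum>z\<in>?Z. cell_density \<rho> (?K z))
        \<le> (\<Sum>z\<in>?Z. LINT x:grid r z|?M. density_env 0 (Q x)) + 4 * M / \<rho> * osc"
      by (simp add: osc_def sum.distrib sum_distrib_left)
    then show ?thesis using integral_grid_decomposition[OF bdd lm r ei] rest[of 0] by linarith
  qed
qed

lemma lside_power_tendsto: "r > 0 \<Longrightarrow> ((\<lambda>\<epsilon>. (\<epsilon> * lside r \<epsilon>) ^ m) \<longlongrightarrow> r ^ m) (at_right 0)"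
  by (intro tendsto_power lside_tendsto)

text \<open>The density tolerance is paid once per unit of volume, and the inner cubes have total
  volume at most that of the domain; the added 1 keeps the divisor positive.\<close>

lemma error_budget:
  assumes "r > 0" "\<delta> > 0" "\<epsilon> > 0"
  shows "\<delta> / (2 * (measure lebesgue \<Omega> + 1)) * real (card (inner_cubes r \<Omega>)) * (\<epsilon> * lside r \<epsilon>) ^ CARD('a) \<le> \<delta> / 2"
proof -
  let ?V = "measure lebesgue \<Omega>"
  have "(\<epsilon> * lside r \<epsilon>) ^ CARD('a) \<le> r ^ CARD('a)"
    using lside_le[OF assms(1,3)] assms(3) by (intro power_mono) auto
  then have "real (card (inner_cubes r \<Omega>)) * (\<epsilon> * lside r \<epsilon>) ^ CARD('a) \<le> real (card (inner_cubes r \<Omega>)) * r ^ CARD('a)"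
    by (intro mult_left_mono) auto
  also have "\<dots> \<le> ?V" using volume_inner_cubes_le[OF assms(1)] by (simp add: mult.commute)
  finally have "\<delta> / (2 * (?V + 1)) * (real (card (inner_cubes r \<Omega>)) * (\<epsilon> * lside r \<epsilon>) ^ CARD('a)) \<le> \<delta> / (2 * (?V + 1)) * ?V"
    using assms(2) by (intro mult_left_mono) auto
  also have "\<dots> \<le> \<delta> / 2"
  proof -
    have "?V + 1 > 0" using measure_nonneg[of lebesgue \<Omega>] by linarith
    then show ?thesis using assms(2) by (simp add: field_simps)
  qed
  finally show ?thesis by (simp add: mult.assoc)
qed

text \<open>The choices are made in the order \<rho>, \<open>r\<close>, \<open>U\<close>,
  \<epsilon>. The neighbourhood \<open>U\<close> fixes the averages on the cubes of size
  \<open>r\<close> and is independent of \<epsilon>. Of the six \<delta>, three go into the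
  comparison of \<open>S\<close> with the integral; the other three are used for the boxes being
  smaller than the grid cubes, for the leftover points, and twice one half for the tolerance
  \<open>\<delta>1\<close>.\<close>

lemma liminf_estimate:
  assumes Q: "Q \<in> Linf \<Omega> K_set" and \<delta>: "\<delta> > 0"
  shows "\<exists>U. openin (weak_star \<Omega>) U \<and> Q \<in> U \<and> (\<forall>\<^sub>F \<epsilon> in at_right 0. \<forall>y\<in>U.
    ereal ((LINT x|lebesgue_on \<Omega>. density_env 0 (Q x)) - 6 * \<delta>) \<le> F_eps f \<Omega> \<epsilon> y)"
proof -
  let ?M = "lebesgue_on \<Omega>" and ?N = "CARD('a)"
  have Qi: "integrable ?M Q" by (rule Linf_integrable[OF bdd lm Q])
  have "(\<lambda>j. LINT x|?M. density_env (1 / real (Suc j)) (Q x)) \<longlonglongrightarrow> (LINT x|?M. density_env 0 (Q x))"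
  proof (rule integral_dominated_convergence[where w = "\<lambda>x. M"])
    show "(\<lambda>x. density_env 0 (Q x)) \<in> borel_measurable ?M"
      using integrable_density_env[OF Q order.refl] by (rule borel_measurable_integrable)
    show "(\<lambda>x. density_env (1 / real (Suc j)) (Q x)) \<in> borel_measurable ?M" for j
      by (intro borel_measurable_integrable integrable_density_env[OF Q]) simp
    show "AE x in ?M. (\<lambda>j. density_env (1 / real (Suc j)) (Q x)) \<longlonglongrightarrow> density_env 0 (Q x)"
      by (intro AE_I2 density_env_tendsto)
    show "AE x in ?M. norm (density_env (1 / real (Suc j)) (Q x)) \<le> M" for j
      using density_env_abs_le[of "1 / real (Suc j)"] by (intro AE_I2) simp
  qed simp
  then have "\<forall>\<^sub>F j in sequentially. (LINT x|?M. density_env 0 (Q x)) - \<delta> < (LINT x|?M. density_env (1 / real (Suc j)) (Q x))"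
    by (rule order_tendstoD(1)) (use \<delta> in simp)
  then obtain j where j: "(LINT x|?M. density_env 0 (Q x)) - \<delta> < (LINT x|?M. density_env (1 / real (Suc j)) (Q x))"
    unfolding eventually_sequentially by blast
  \<comment> \<open>The radius found by dominated convergence is divided into four parts: one for
    the distance of \<open>Q x\<close> from its average, and three for the admissibility of
    \<open>u\<close> below.\<close>
  define \<rho> where "\<rho> = 1 / real (Suc j) / 4"
  have \<rho>: "\<rho> > 0" and \<rho>4: "4 * \<rho> = 1 / real (Suc j)" by (simp_all add: \<rho>_def del: of_nat_Suc)
  \<comment> \<open>Chosen so that the oscillation penalty of \<open>sum_cell_density_ge\<close>
    amounts to \<delta>.\<close>
  define \<eta> where "\<eta> = \<delta> * \<rho> / (2 * M)"
  have \<eta>: "\<eta> > 0" using \<delta> \<rho> M_pos by (simp add: \<eta>_def)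
  have "\<forall>\<^sub>F r in at_right 0. r > 0 \<and>
      (\<Sum>z\<in>inner_cubes r \<Omega>. LINT x:grid r z|?M. norm (Q x - grid_avg \<Omega> r Q z)) < \<eta> \<and>
      r ^ ?N * card (boundary_cubes r \<Omega>) < \<delta> / (2 * M)"
    using \<delta> M_pos
    by (intro eventually_conj eventually_grid_oscillation_less[OF bdd lm Qi \<eta>]
        order_tendstoD(2)[OF boundary_cubes_volume_tendsto[OF bdd neg]]) (auto simp: eventually_at_right_less)
  then obtain r where r: "r > 0" and osc: "(\<Sum>z\<in>inner_cubes r \<Omega>. LINT x:grid r z|?M. norm (Q x - grid_avg \<Omega> r Q z)) < \<eta>"
    and bdry: "r ^ ?N * card (boundary_cubes r \<Omega>) < \<delta> / (2 * M)"
    using eventually_happens'[OF trivial_limit_at_right_real] by blast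
  let ?Z = "inner_cubes r \<Omega>"
  define \<kappa> where "\<kappa> = grid_avg \<Omega> r Q"
  define S where "S = (\<Sum>z\<in>?Z. cell_density (3 * \<rho>) (\<kappa> z))"
  have finZ: "finite ?Z" by (rule finite_inner_cubes[OF bdd r])
  have \<kappa>K: "\<kappa> z \<in> K_set" if "z \<in> ?Z" for z unfolding \<kappa>_def by (rule grid_avg_in_K_set[OF Q r that])
  have S: "r ^ ?N * S \<ge> (LINT x|?M. density_env 0 (Q x)) - 3 * \<delta>"
  proof -
    have "2 * M / \<rho> * (\<Sum>z\<in>?Z. LINT x:grid r z|?M. norm (Q x - grid_avg \<Omega> r Q z)) \<le> 2 * M / \<rho> * \<eta>"
      using osc M_pos \<rho> by (intro mult_left_mono) auto
    also have "2 * M / \<rho> * \<eta> = \<delta>" using M_pos \<rho> by (simp add: \<eta>_def)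
    finally have a: "2 * M / \<rho> * (\<Sum>z\<in>?Z. LINT x:grid r z|?M. norm (Q x - grid_avg \<Omega> r Q z)) \<le> \<delta>" .
    have "M * (r ^ ?N * card (boundary_cubes r \<Omega>)) \<le> M * (\<delta> / (2 * M))"
      using bdry M_pos by (intro mult_left_mono) auto
    also have "M * (\<delta> / (2 * M)) = \<delta> / 2" using M_pos by simp
    finally have b: "M * (r ^ ?N * card (boundary_cubes r \<Omega>)) \<le> \<delta> / 2" .
    note diff_mono[OF diff_mono[OF order.refl b] a]
    also note sum_cell_density_ge[OF Q r \<rho>, unfolded \<rho>4]
    finally show ?thesis using j \<delta> unfolding S_def \<kappa>_def by linarith
  qed
  define \<delta>1 where "\<delta>1 = \<delta> / (2 * (measure lebesgue \<Omega> + 1))"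
  have \<delta>1: "\<delta>1 > 0" using \<delta> measure_nonneg[of lebesgue \<Omega>] by (simp add: \<delta>1_def add_nonneg_pos)
  have rN: "r ^ ?N > 0" using r by simp
  have "\<exists>U. openin (weak_star \<Omega>) U \<and> Q \<in> U \<and>
      (\<forall>y\<in>U. \<forall>A\<in>grid r ` ?Z. norm ((LINT x:A|?M. y x) - (LINT x:A|?M. Q x)) < \<rho> * r ^ ?N)"
    using finZ grid_sets(1)[OF bdd lm r] \<rho> rN
    by (intro weak_star_cubes_neighbourhood[OF bdd lm Linf_K_set_sym[OF Q]]) auto
  then obtain U where U: "openin (weak_star \<Omega>) U" "Q \<in> U"
    and Uc: "\<And>y z. y \<in> U \<Longrightarrow> z \<in> ?Z \<Longrightarrow> norm ((LINT x:grid r z|?M. y x) - (LINT x:grid r z|?M. Q x)) < \<rho> * r ^ ?N"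
    by blast
  let ?g = "\<lambda>\<epsilon>. (\<epsilon> * lside r \<epsilon>) ^ ?N"
  note glim = lside_power_tendsto[OF r, of ?N]
  have "\<forall>\<^sub>F \<epsilon> in at_right 0. \<forall>z\<in>?Z. \<forall>a v. admissible (\<kappa> z) (3 * \<rho>) (ibox a (lside r \<epsilon>)) v \<longrightarrow>
      real (lside r \<epsilon>) ^ ?N * (cell_density (3 * \<rho>) (\<kappa> z) - \<delta>1) \<le> energy f (ibox a (lside r \<epsilon>)) v"
  proof (rule eventually_ball_finite[OF finZ], rule ballI)
    fix z assume z: "z \<in> ?Z"
    have "3 * \<rho> > 0" using \<rho> by simp
    from cell_density_lower[OF \<kappa>K[OF z] this \<delta>1] obtain n0 where n0: "\<forall>n\<ge>n0. \<forall>a v. admissible (\<kappa> z) (3 * \<rho>) (ibox a n) v \<longrightarrow>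
      real n ^ ?N * (cell_density (3 * \<rho>) (\<kappa> z) - \<delta>1) \<le> energy f (ibox a n) v" ..
    show "\<forall>\<^sub>F \<epsilon> in at_right 0. \<forall>a v. admissible (\<kappa> z) (3 * \<rho>) (ibox a (lside r \<epsilon>)) v \<longrightarrow>
      real (lside r \<epsilon>) ^ ?N * (cell_density (3 * \<rho>) (\<kappa> z) - \<delta>1) \<le> energy f (ibox a (lside r \<epsilon>)) v"
      using eventually_lside_ge[OF r, of n0] by eventually_elim (rule n0[THEN spec, THEN mp])
  qed
  \<comment> \<open>The neighbourhood uses one \<rho> of the radius 3 \<rho>. The other two absorb
    the mismatch between grid cube and box, which enters twice, through the integral of
    \<open>y'\<close> and through that of \<open>Q\<close>, and vanishes with \<epsilon>.\<close>
  moreover have "\<forall>\<^sub>F \<epsilon> in at_right 0. 0 < 3 * \<rho> * ?g \<epsilon> - 2 * (r ^ ?N - ?g \<epsilon>) - \<rho> * r ^ ?N"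
  proof (rule order_tendstoD(1))
    show "((\<lambda>\<epsilon>. 3 * \<rho> * ?g \<epsilon> - 2 * (r ^ ?N - ?g \<epsilon>) - \<rho> * r ^ ?N) \<longlongrightarrow>
        3 * \<rho> * r ^ ?N - 2 * (r ^ ?N - r ^ ?N) - \<rho> * r ^ ?N) (at_right 0)"
      by (intro tendsto_intros glim)
    show "0 < 3 * \<rho> * r ^ ?N - 2 * (r ^ ?N - r ^ ?N) - \<rho> * r ^ ?N" using \<rho> rN by simp
  qed
  moreover have "\<forall>\<^sub>F \<epsilon> in at_right 0. leftover r \<Omega> \<epsilon> < \<delta> / (2 * M)"
    by (rule eventually_leftover_less[OF bdd r bdry])
  moreover have "\<forall>\<^sub>F \<epsilon> in at_right 0. r ^ ?N * S - \<delta> < ?g \<epsilon> * S"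
    using \<delta> by (intro order_tendstoD(1)[OF tendsto_mult_right[OF glim]]) simp
  moreover have "\<forall>\<^sub>F \<epsilon> in at_right (0 :: real). \<epsilon> > 0" by (simp add: eventually_at_right_less)
  moreover note eventually_energy_cubes[OF r \<delta>1]
  ultimately have "\<forall>\<^sub>F \<epsilon> in at_right 0. \<forall>y\<in>U.
      ereal ((LINT x|?M. density_env 0 (Q x)) - 6 * \<delta>) \<le> F_eps f \<Omega> \<epsilon> y"
  proof eventually_elim
    case (elim \<epsilon>)
    note lower = elim(1) and gap = elim(2) and left = elim(3) and gS = elim(4) and \<epsilon> = elim(5) and decomp = elim(6)
    have \<epsilon>N: "\<epsilon> ^ ?N > 0" using \<epsilon> by simp
    have gle: "?g \<epsilon> \<le> r ^ ?N" using lside_le[OF r \<epsilon>] \<epsilon> by (intro power_mono) auto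
    show ?case
      unfolding F_eps_def
    proof (intro ballI INF_greatest)
      fix y y' assume y: "y \<in> U" and "y' \<in> {y' \<in> C_eps \<epsilon> \<Omega>. AE x in ?M. y' x = y x}"
      then have y': "y' \<in> C_eps \<epsilon> \<Omega>" "AE x in ?M. y' x = y x" by auto
      have yL: "y \<in> Linf \<Omega> sym_matrices" using y openin_subset[OF U(1)] topspace_weak_star by blast
      then have ym: "y \<in> borel_measurable ?M" by (simp add: Linf_def)
      have ae: "AE x in ?M. y x = y' x" using y'(2) by eventually_elim simp
      have y'm: "y' \<in> borel_measurable ?M"
        by (rule borel_measurable_lebesgue_on_AE[OF fmeasurableD[OF lm] ym ae])
      have y'i: "integrable ?M y'"
      proof (rule integrable_const_bound[OF AE_I2 y'm])
        fix x assume "x \<in> space ?M"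
        then have "y' x \<in> sphere_tensor" using y'(1) by (simp add: space_restrict_space C_eps_def)
        then show "norm (y' x) \<le> 1" by (simp add: norm_sphere_tensor)
      qed
      define u where "u i = y' (\<epsilon> *\<^sub>R lat i)" for i
      have uS: "u i \<in> sphere_tensor" if "i \<in> Z_eps \<epsilon> \<Omega>" for i
        unfolding u_def by (rule disc_energy_C_eps(2)[OF \<epsilon> y'(1) that])
      have adm: "admissible (\<kappa> z) (3 * \<rho>) (lbox r \<epsilon> z) u" if z: "z \<in> ?Z" for z
      proof -
        let ?I = "LINT x:grid r z|?M. y' x" and ?J = "LINT x:grid r z|?M. Q x"
        let ?s = "\<Sum>i\<in>lbox r \<epsilon> z. u i"
        have "?I = (LINT x:grid r z|?M. y x)"
          unfolding set_lebesgue_integral_def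
        proof (rule integral_cong_AE)
          show "AE x in ?M. indicator (grid r z) x *\<^sub>R y' x = indicator (grid r z) x *\<^sub>R y x"
            using y'(2) by eventually_elim simp
        qed (use y'm ym grid_sets(1)[OF bdd lm r z] in measurable)
        then have 1: "norm (?I - ?J) \<le> \<rho> * r ^ ?N" using Uc[OF y z] by simp
        have 2: "norm (?I - \<epsilon> ^ ?N *\<^sub>R ?s) \<le> r ^ ?N - ?g \<epsilon>"
          unfolding u_def by (rule set_integral_grid_approx[OF fmeasurableD[OF lm] y'(1) y'i r \<epsilon> z])
        have 3: "?J = r ^ ?N *\<^sub>R \<kappa> z" using r by (simp add: \<kappa>_def grid_avg_def)
        have "norm ((r ^ ?N - ?g \<epsilon>) *\<^sub>R \<kappa> z) \<le> (r ^ ?N - ?g \<epsilon>) * 1"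
          unfolding norm_scaleR using gle norm_K_set_le[OF \<kappa>K[OF z]] by (intro mult_mono) auto
        then have 4: "norm ((r ^ ?N - ?g \<epsilon>) *\<^sub>R \<kappa> z) \<le> r ^ ?N - ?g \<epsilon>" by simp
        \<comment> \<open>The weighted sum over the box is compared with the integral of
          \<open>y'\<close>, then with that of \<open>Q\<close>, which is the average times the
          volume of the cube; the last term replaces that volume by the volume of the box.\<close>
        have "\<epsilon> ^ ?N *\<^sub>R (?s - real (card (lbox r \<epsilon> z)) *\<^sub>R \<kappa> z)
            = (?I - ?J) - (?I - \<epsilon> ^ ?N *\<^sub>R ?s) + (r ^ ?N - ?g \<epsilon>) *\<^sub>R \<kappa> z"
          unfolding 3 by (simp add: algebra_simps power_mult_distrib)
        also have "norm \<dots> \<le> \<rho> * r ^ ?N + (r ^ ?N - ?g \<epsilon>) + (r ^ ?N - ?g \<epsilon>)"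
          by (intro order.trans[OF norm_triangle_ineq] add_mono order.trans[OF norm_triangle_ineq4] 1 2 4)
        also have "\<dots> \<le> 3 * \<rho> * ?g \<epsilon>"
        proof -
          have "\<rho> * R + (R - g) + (R - g) \<le> 3 * \<rho> * g" if "0 < 3 * \<rho> * g - 2 * (R - g) - \<rho> * R" for R g
            using that by (simp add: algebra_simps)
          then show ?thesis using gap by blast
        qed
        also have "\<dots> = \<epsilon> ^ ?N * (3 * \<rho> * real (card (lbox r \<epsilon> z)))" by (simp add: power_mult_distrib)
        finally have "\<epsilon> ^ ?N * norm (?s - real (card (lbox r \<epsilon> z)) *\<^sub>R \<kappa> z) \<le> \<epsilon> ^ ?N * (3 * \<rho> * real (card (lbox r \<epsilon> z)))"
          using \<epsilon>N by simp
        then have "norm (?s - real (card (lbox r \<epsilon> z)) *\<^sub>R \<kappa> z) \<le> 3 * \<rho> * real (card (lbox r \<epsilon> z))"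
          using \<epsilon>N by (rule mult_left_le_imp_le)
        then show ?thesis
          unfolding admissible_def using uS lbox_subset_Z_eps[OF r \<epsilon> z] by blast
      qed
      have "(\<Sum>z\<in>?Z. real (lside r \<epsilon>) ^ ?N * (cell_density (3 * \<rho>) (\<kappa> z) - \<delta>1)) \<le> (\<Sum>z\<in>?Z. energy f (lbox r \<epsilon> z) u)"
        using lower adm by (intro sum_mono) blast
      then have "\<epsilon> ^ ?N * (\<Sum>z\<in>?Z. real (lside r \<epsilon>) ^ ?N * (cell_density (3 * \<rho>) (\<kappa> z) - \<delta>1))
          \<le> \<epsilon> ^ ?N * (\<Sum>z\<in>?Z. energy f (lbox r \<epsilon> z) u)"
        using \<epsilon>N by (intro mult_left_mono) auto
      moreover have "\<epsilon> ^ ?N * (\<Sum>z\<in>?Z. real (lside r \<epsilon>) ^ ?N * (cell_density (3 * \<rho>) (\<kappa> z) - \<delta>1))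
          = ?g \<epsilon> * S - \<delta>1 * real (card ?Z) * ?g \<epsilon>"
        by (simp add: S_def sum_distrib_left[symmetric] sum_subtractf power_mult_distrib algebra_simps)
      moreover have "\<bar>\<epsilon> ^ ?N * energy f (Z_eps \<epsilon> \<Omega>) u - \<epsilon> ^ ?N * (\<Sum>z\<in>?Z. energy f (lbox r \<epsilon> z) u)\<bar>
          \<le> 2 * M * leftover r \<Omega> \<epsilon> + \<delta>1 * real (card ?Z) * ?g \<epsilon>"
        using decomp uS by blast
      moreover have "2 * M * leftover r \<Omega> \<epsilon> \<le> \<delta>" using left M_pos by (simp add: field_simps)
      moreover have "\<delta>1 * real (card ?Z) * ?g \<epsilon> \<le> \<delta> / 2"
        unfolding \<delta>1_def by (rule error_budget[OF r \<delta> \<epsilon>])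
      ultimately have "(LINT x|?M. density_env 0 (Q x)) - 6 * \<delta> \<le> \<epsilon> ^ ?N * energy f (Z_eps \<epsilon> \<Omega>) u"
        using S gS by linarith
      then show "ereal ((LINT x|?M. density_env 0 (Q x)) - 6 * \<delta>) \<le> disc_energy f \<epsilon> \<Omega> y'"
        unfolding disc_energy_C_eps(1)[OF \<epsilon> y'(1)] u_def by simp
    qed
  qed
  then show ?thesis using U by blast
qed

text \<open>The index is x / \<epsilon> rounded to the nearest lattice point, that is the index of
  the cell containing \<open>x\<close>. The formula makes sense on the whole space, so cells that
  cut the boundary need no special treatment.\<close>

definition cellwise :: "real \<Rightarrow> (int^'a \<Rightarrow> real^'a^'a) \<Rightarrow> real^'a \<Rightarrow> real^'a^'a" where
  "cellwise \<epsilon> u x = u (\<chi> j. \<lfloor>x $ j / \<epsilon> + 1 / 2\<rfloor>)"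

lemma cellwise_eq: "\<epsilon> > 0 \<Longrightarrow> x \<in> cell \<epsilon> i \<Longrightarrow> cellwise \<epsilon> u x = u i"
  by (simp add: cellwise_def mem_cell_iff)

lemma cellwise_lat: "\<epsilon> > 0 \<Longrightarrow> cellwise \<epsilon> u (\<epsilon> *\<^sub>R lat i) = u i"
  by (rule cellwise_eq[OF _ center_in_cell])

lemma
  assumes \<epsilon>: "\<epsilon> > 0" and u: "\<And>i. u i \<in> sphere_tensor"
  shows cellwise_C_eps: "cellwise \<epsilon> u \<in> C_eps \<epsilon> \<Omega>"
    and cellwise_Linf: "cellwise \<epsilon> u \<in> Linf \<Omega> sym_matrices"
proof -
  have S: "cellwise \<epsilon> u x \<in> sphere_tensor" for x by (simp add: cellwise_def u)
  show "cellwise \<epsilon> u \<in> C_eps \<epsilon> \<Omega>"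
    unfolding C_eps_def cell_eq_W_cube[OF \<epsilon>, symmetric] using S
    by (auto simp: cellwise_eq[OF \<epsilon>] cellwise_lat[OF \<epsilon>])
  have "cellwise \<epsilon> u \<in> borel_measurable lebesgue"
  proof (rule measurableI)
    fix B :: "(real^'a^'a) set" assume "B \<in> sets borel"
    \<comment> \<open>The lattice is countable, so any preimage is a countable union of measurable
      cells.\<close>
    have "cellwise \<epsilon> u -` B = (\<Union>i\<in>u -` B. cell \<epsilon> i)"
      using \<epsilon> by (auto simp: mem_cell_iff cellwise_def)
    moreover have "(\<Union>i\<in>u -` B. cell \<epsilon> i) \<in> sets lebesgue"
      using cell_lmeasurable[OF \<epsilon>] by (intro sets.countable_UN') (auto intro: fmeasurableD)
    ultimately show "cellwise \<epsilon> u -` B \<inter> space lebesgue \<in> sets lebesgue" by simp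
  qed simp
  then have "cellwise \<epsilon> u \<in> borel_measurable (lebesgue_on \<Omega>)" by (rule measurable_restrict_space1)
  moreover have "norm (cellwise \<epsilon> u x) \<le> 1" for x using norm_sphere_tensor[OF S] by simp
  moreover have "cellwise \<epsilon> u x \<in> sym_matrices" for x
    using subsetD[OF sphere_tensor_subset_K_set S] by (simp add: K_set_def)
  ultimately show "cellwise \<epsilon> u \<in> Linf \<Omega> sym_matrices" unfolding Linf_def by auto
qed

text \<open>The recovery function carries, on the box of every inner cube, a near-optimal labelling
  whose average is close to that of \<open>Q\<close>, and a fixed tensor at all other points.
  Closeness of the cube averages puts it into the given neighbourhood.\<close>

lemma limsup_estimate:
  assumes Q: "Q \<in> Linf \<Omega> K_set" and U: "openin (weak_star \<Omega>) U" "Q \<in> U" and \<delta>: "\<delta> > 0"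
  shows "\<forall>\<^sub>F \<epsilon> in at_right 0. \<exists>y\<in>U.
    F_eps f \<Omega> \<epsilon> y \<le> ereal ((LINT x|lebesgue_on \<Omega>. density_env 0 (Q x)) + 6 * \<delta>)"
proof -
  let ?M = "lebesgue_on \<Omega>" and ?N = "CARD('a)"
  have Qi: "integrable ?M Q" by (rule Linf_integrable[OF bdd lm Q])
  from weak_star_basic_neighbourhood[OF U] obtain \<Phi> \<tau> where \<Phi>: "finite \<Phi>" "\<Phi> \<subseteq> L1 \<Omega> sym_matrices" and \<tau>: "\<tau> > 0"
    and sub: "{y \<in> Linf \<Omega> sym_matrices. \<forall>\<phi>\<in>\<Phi>. \<bar>(LINT x|?M. \<phi> x \<bullet> y x) - (LINT x|?M. \<phi> x \<bullet> Q x)\<bar> < \<tau>} \<subseteq> U"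
    by (elim exE conjE) (rule that)
  have \<phi>i: "integrable ?M \<phi>" if "\<phi> \<in> \<Phi>" for \<phi> using \<Phi>(2) that by (auto simp: L1_def)
  \<comment> \<open>A common bound for the integral norms of the test functions; the added 1 makes
    it positive even if there are none.\<close>
  define A where "A = (\<Sum>\<phi>\<in>\<Phi>. LINT x|?M. norm (\<phi> x)) + 1"
  have A0: "0 \<le> (LINT x|?M. norm (\<phi> x))" for \<phi> :: "real^'a \<Rightarrow> real^'a^'a"
    by (intro Bochner_Integration.integral_nonneg) simp
  have A: "A > 0" unfolding A_def by (intro add_nonneg_pos sum_nonneg A0) simp
  have A\<phi>: "(LINT x|?M. norm (\<phi> x)) \<le> A" if "\<phi> \<in> \<Phi>" for \<phi>
    using member_le_sum[OF that, of "\<lambda>\<phi>. LINT x|?M. norm (\<phi> x)"] A0 \<Phi>(1) unfolding A_def by fastforce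
  \<comment> \<open>The averages will differ by at most 2 \<rho>, which contributes at most
    \<open>\<tau> / 4\<close> to a test. Oscillation and rest of the test function contribute less
    than \<open>\<tau> / 4\<close> each, so the total stays below \<tau>.\<close>
  define \<rho> where "\<rho> = \<tau> / (8 * A)"
  have \<rho>: "\<rho> > 0" using \<tau> A by (simp add: \<rho>_def)
  define \<eta> where "\<eta> = \<delta> * \<rho> / (4 * M)"
  have \<eta>: "\<eta> > 0" using \<delta> \<rho> M_pos by (simp add: \<eta>_def)
  have \<tau>8: "\<tau> / 8 > 0" using \<tau> by simp
  have "\<forall>\<^sub>F r in at_right 0. r > 0 \<and>
      (\<Sum>z\<in>inner_cubes r \<Omega>. LINT x:grid r z|?M. norm (Q x - grid_avg \<Omega> r Q z)) < \<eta> \<and>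
      r ^ ?N * card (boundary_cubes r \<Omega>) < \<delta> / (2 * M) \<and>
      (\<forall>\<phi>\<in>\<Phi>. (\<Sum>z\<in>inner_cubes r \<Omega>. LINT x:grid r z|?M. norm (\<phi> x - grid_avg \<Omega> r \<phi> z)) < \<tau> / 8) \<and>
      (\<forall>\<phi>\<in>\<Phi>. (LINT x:rest r \<Omega>|?M. norm (\<phi> x)) < \<tau> / 8)"
    using \<delta> M_pos
    by (intro eventually_conj eventually_grid_oscillation_less[OF bdd lm Qi \<eta>]
        order_tendstoD(2)[OF boundary_cubes_volume_tendsto[OF bdd neg]]
        eventually_ball_finite[OF \<Phi>(1)] ballI eventually_grid_oscillation_less[OF bdd lm \<phi>i \<tau>8]
        eventually_rest_integral_less[OF bdd lm \<phi>i neg \<tau>8]) (auto simp: eventually_at_right_less)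
  then obtain r where r: "r > 0" and osc: "(\<Sum>z\<in>inner_cubes r \<Omega>. LINT x:grid r z|?M. norm (Q x - grid_avg \<Omega> r Q z)) < \<eta>"
    and bdry: "r ^ ?N * card (boundary_cubes r \<Omega>) < \<delta> / (2 * M)"
    and osc\<phi>: "\<And>\<phi>. \<phi> \<in> \<Phi> \<Longrightarrow> (\<Sum>z\<in>inner_cubes r \<Omega>. LINT x:grid r z|?M. norm (\<phi> x - grid_avg \<Omega> r \<phi> z)) < \<tau> / 8"
    and rest\<phi>: "\<And>\<phi>. \<phi> \<in> \<Phi> \<Longrightarrow> (LINT x:rest r \<Omega>|?M. norm (\<phi> x)) < \<tau> / 8"
    using eventually_happens'[OF trivial_limit_at_right_real] by blast
  let ?Z = "inner_cubes r \<Omega>"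
  define \<kappa> where "\<kappa> = grid_avg \<Omega> r Q"
  define S where "S = (\<Sum>z\<in>?Z. cell_density \<rho> (\<kappa> z))"
  have finZ: "finite ?Z" by (rule finite_inner_cubes[OF bdd r])
  have \<kappa>K: "\<kappa> z \<in> K_set" if "z \<in> ?Z" for z unfolding \<kappa>_def by (rule grid_avg_in_K_set[OF Q r that])
  have S: "r ^ ?N * S \<le> (LINT x|?M. density_env 0 (Q x)) + 2 * \<delta>"
  proof -
    have "4 * M / \<rho> * (\<Sum>z\<in>?Z. LINT x:grid r z|?M. norm (Q x - grid_avg \<Omega> r Q z)) \<le> 4 * M / \<rho> * \<eta>"
      using osc M_pos \<rho> by (intro mult_left_mono) auto
    also have "4 * M / \<rho> * \<eta> = \<delta>" using M_pos \<rho> by (simp add: \<eta>_def)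
    finally have a: "4 * M / \<rho> * (\<Sum>z\<in>?Z. LINT x:grid r z|?M. norm (Q x - grid_avg \<Omega> r Q z)) \<le> \<delta>" .
    have "M * (r ^ ?N * card (boundary_cubes r \<Omega>)) \<le> M * (\<delta> / (2 * M))"
      using bdry M_pos by (intro mult_left_mono) auto
    also have "M * (\<delta> / (2 * M)) = \<delta> / 2" using M_pos by simp
    finally have b: "M * (r ^ ?N * card (boundary_cubes r \<Omega>)) \<le> \<delta> / 2" .
    note sum_cell_density_le[OF Q r \<rho>]
    also note add_mono[OF add_mono[OF order.refl b] a]
    finally show ?thesis using \<delta> unfolding S_def \<kappa>_def by linarith
  qed
  define \<delta>1 where "\<delta>1 = \<delta> / (2 * (measure lebesgue \<Omega> + 1))"
  have \<delta>1: "\<delta>1 > 0" using \<delta> measure_nonneg[of lebesgue \<Omega>] by (simp add: \<delta>1_def add_nonneg_pos)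
  have rN: "r ^ ?N > 0" using r by simp
  obtain s0 :: "real^'a^'a" where s0: "s0 \<in> sphere_tensor" using sphere_tensor_nonempty by blast
  let ?g = "\<lambda>\<epsilon>. (\<epsilon> * lside r \<epsilon>) ^ ?N"
  note glim = lside_power_tendsto[OF r, of ?N]
  have "\<forall>\<^sub>F \<epsilon> in at_right 0. \<forall>z\<in>?Z. \<forall>b. \<exists>u. admissible (\<kappa> z) \<rho> (ibox b (lside r \<epsilon>)) u \<and>
      energy f (ibox b (lside r \<epsilon>)) u \<le> real (lside r \<epsilon>) ^ ?N * (cell_density \<rho> (\<kappa> z) + \<delta>1)"
  proof (rule eventually_ball_finite[OF finZ], rule ballI)
    fix z assume z: "z \<in> ?Z"
    from cell_density_upper[OF \<kappa>K[OF z] \<rho> \<delta>1] obtain n0 where n0: "\<forall>n\<ge>n0. \<forall>b. \<exists>u. admissible (\<kappa> z) \<rho> (ibox b n) u \<and>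
      energy f (ibox b n) u \<le> real n ^ ?N * (cell_density \<rho> (\<kappa> z) + \<delta>1)" ..
    show "\<forall>\<^sub>F \<epsilon> in at_right 0. \<forall>b. \<exists>u. admissible (\<kappa> z) \<rho> (ibox b (lside r \<epsilon>)) u \<and>
      energy f (ibox b (lside r \<epsilon>)) u \<le> real (lside r \<epsilon>) ^ ?N * (cell_density \<rho> (\<kappa> z) + \<delta>1)"
      using eventually_lside_ge[OF r, of n0] by eventually_elim (rule n0[THEN spec, THEN mp])
  qed
  moreover have "\<forall>\<^sub>F \<epsilon> in at_right 0. 2 * (r ^ ?N - ?g \<epsilon>) + \<rho> * ?g \<epsilon> < 2 * \<rho> * r ^ ?N"
  proof (rule order_tendstoD(2))
    show "((\<lambda>\<epsilon>. 2 * (r ^ ?N - ?g \<epsilon>) + \<rho> * ?g \<epsilon>) \<longlongrightarrow> 2 * (r ^ ?N - r ^ ?N) + \<rho> * r ^ ?N) (at_right 0)"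
      by (intro tendsto_intros glim)
    show "2 * (r ^ ?N - r ^ ?N) + \<rho> * r ^ ?N < 2 * \<rho> * r ^ ?N" using \<rho> rN by simp
  qed
  moreover have "\<forall>\<^sub>F \<epsilon> in at_right 0. leftover r \<Omega> \<epsilon> < \<delta> / (2 * M)"
    by (rule eventually_leftover_less[OF bdd r bdry])
  moreover have "\<forall>\<^sub>F \<epsilon> in at_right 0. ?g \<epsilon> * S < r ^ ?N * S + \<delta>"
    using \<delta> by (intro order_tendstoD(2)[OF tendsto_mult_right[OF glim]]) simp
  moreover have "\<forall>\<^sub>F \<epsilon> in at_right (0 :: real). \<epsilon> > 0" by (simp add: eventually_at_right_less)
  moreover note eventually_energy_cubes[OF r \<delta>1]
  ultimately show ?thesis
  proof eventually_elim
    case (elim \<epsilon>)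
    note upper = elim(1) and gap = elim(2) and left = elim(3) and gS = elim(4) and \<epsilon> = elim(5) and decomp = elim(6)
    have \<epsilon>N: "\<epsilon> ^ ?N > 0" using \<epsilon> by simp
    have gle: "?g \<epsilon> \<le> r ^ ?N" using lside_le[OF r \<epsilon>] \<epsilon> by (intro power_mono) auto
    have "\<forall>z\<in>?Z. \<exists>u. admissible (\<kappa> z) \<rho> (lbox r \<epsilon> z) u \<and>
      energy f (lbox r \<epsilon> z) u \<le> real (lside r \<epsilon>) ^ ?N * (cell_density \<rho> (\<kappa> z) + \<delta>1)"
      using upper by blast
    from bchoice[OF this] obtain v where v: "\<forall>z\<in>?Z. admissible (\<kappa> z) \<rho> (lbox r \<epsilon> z) (v z) \<and>
      energy f (lbox r \<epsilon> z) (v z) \<le> real (lside r \<epsilon>) ^ ?N * (cell_density \<rho> (\<kappa> z) + \<delta>1)" ..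
    \<comment> \<open>The index of the grid cube is read off from the lattice point. This glues the
      labellings of the disjoint boxes into one globally defined \<open>u\<close>.\<close>
    define cube where "cube i = (\<chi> j. \<lfloor>(\<epsilon> *\<^sub>R lat i) $ j / r\<rfloor>)" for i :: "int^'a"
    define u where "u i = (if cube i \<in> ?Z \<and> i \<in> lbox r \<epsilon> (cube i) then v (cube i) i else s0)" for i
    have cube: "cube i = z" if "i \<in> lbox r \<epsilon> z" for i z
    proof -
      have "\<epsilon> *\<^sub>R lat i \<in> grid r z" using cell_subset_grid[OF r \<epsilon> that] center_in_cell[OF \<epsilon>] by blast
      then show ?thesis unfolding cube_def mem_grid_iff[OF r] by simp
    qed
    have uv: "u i = v z i" if "z \<in> ?Z" "i \<in> lbox r \<epsilon> z" for z i
      using cube[OF that(2)] that by (simp add: u_def)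
    have uS: "u i \<in> sphere_tensor" for i
      using v s0 unfolding u_def admissible_def by auto
    define y where "y = cellwise \<epsilon> u"
    have yC: "y \<in> C_eps \<epsilon> \<Omega>" and yL: "y \<in> Linf \<Omega> sym_matrices"
      unfolding y_def by (rule cellwise_C_eps[OF \<epsilon> uS], rule cellwise_Linf[OF \<epsilon> uS])
    have ylat: "y (\<epsilon> *\<^sub>R lat i) = u i" for i unfolding y_def by (rule cellwise_lat[OF \<epsilon>])
    have yi: "integrable ?M y" by (rule Linf_integrable[OF bdd lm yL])
    have y1: "AE x in ?M. norm (y x) \<le> 1"
      by (intro AE_I2) (simp add: y_def cellwise_def norm_sphere_tensor[OF uS])
    have close: "norm ((LINT x:grid r z|?M. y x) - (LINT x:grid r z|?M. Q x)) \<le> 2 * \<rho> * r ^ ?N" if z: "z \<in> ?Z" for z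
    proof -
      let ?I = "LINT x:grid r z|?M. y x" and ?J = "LINT x:grid r z|?M. Q x"
      let ?s = "\<Sum>i\<in>lbox r \<epsilon> z. u i"
      have 1: "norm (?I - \<epsilon> ^ ?N *\<^sub>R ?s) \<le> r ^ ?N - ?g \<epsilon>"
        using set_integral_grid_approx[OF fmeasurableD[OF lm] yC yi r \<epsilon> z] by (simp add: ylat)
      have "?s = (\<Sum>i\<in>lbox r \<epsilon> z. v z i)" by (intro sum.cong uv z) auto
      then have "norm (?s - real (card (lbox r \<epsilon> z)) *\<^sub>R \<kappa> z) \<le> \<rho> * card (lbox r \<epsilon> z)"
        using v z by (simp add: admissible_def)
      then have "\<epsilon> ^ ?N * norm (?s - real (card (lbox r \<epsilon> z)) *\<^sub>R \<kappa> z) \<le> \<epsilon> ^ ?N * (\<rho> * card (lbox r \<epsilon> z))"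
        using \<epsilon>N by (intro mult_left_mono) auto
      then have 2: "norm (\<epsilon> ^ ?N *\<^sub>R (?s - real (card (lbox r \<epsilon> z)) *\<^sub>R \<kappa> z)) \<le> \<rho> * ?g \<epsilon>"
        using \<epsilon>N by (simp add: power_mult_distrib mult_ac)
      have 3: "?J = r ^ ?N *\<^sub>R \<kappa> z" using r by (simp add: \<kappa>_def grid_avg_def)
      have "norm ((r ^ ?N - ?g \<epsilon>) *\<^sub>R \<kappa> z) \<le> (r ^ ?N - ?g \<epsilon>) * 1"
        unfolding norm_scaleR using gle norm_K_set_le[OF \<kappa>K[OF z]] by (intro mult_mono) auto
      then have 4: "norm ((r ^ ?N - ?g \<epsilon>) *\<^sub>R \<kappa> z) \<le> r ^ ?N - ?g \<epsilon>" by simp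
      have "?I - ?J = (?I - \<epsilon> ^ ?N *\<^sub>R ?s) + \<epsilon> ^ ?N *\<^sub>R (?s - real (card (lbox r \<epsilon> z)) *\<^sub>R \<kappa> z)
          - (r ^ ?N - ?g \<epsilon>) *\<^sub>R \<kappa> z"
        unfolding 3 by (simp add: algebra_simps power_mult_distrib)
      also have "norm \<dots> \<le> (r ^ ?N - ?g \<epsilon>) + \<rho> * ?g \<epsilon> + (r ^ ?N - ?g \<epsilon>)"
        by (intro order.trans[OF norm_triangle_ineq4] add_mono order.trans[OF norm_triangle_ineq] 1 2 4)
      also have "\<dots> \<le> 2 * \<rho> * r ^ ?N"
      proof -
        have "(R - g) + \<rho> * g + (R - g) \<le> 2 * \<rho> * R" if "2 * (R - g) + \<rho> * g < 2 * \<rho> * R" for R g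
          using that by (simp add: algebra_simps)
        then show ?thesis using gap by blast
      qed
      finally show ?thesis .
    qed
    have "\<bar>(LINT x|?M. \<phi> x \<bullet> y x) - (LINT x|?M. \<phi> x \<bullet> Q x)\<bar> < \<tau>" if \<phi>: "\<phi> \<in> \<Phi>" for \<phi>
    proof -
      have "0 \<le> 2 * \<rho>" using \<rho> by simp
      from weak_test_difference_le[OF bdd lm \<phi>i[OF \<phi>] yL y1 Q Linf_K_set_norm_le[OF Q] r close this]
      have "\<bar>(LINT x|?M. \<phi> x \<bullet> y x) - (LINT x|?M. \<phi> x \<bullet> Q x)\<bar> \<le>
        2 * (\<Sum>z\<in>?Z. LINT x:grid r z|?M. norm (\<phi> x - grid_avg \<Omega> r \<phi> z))
        + 2 * \<rho> * (LINT x|?M. norm (\<phi> x)) + 2 * (LINT x:rest r \<Omega>|?M. norm (\<phi> x))" .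
      moreover have "2 * \<rho> * (LINT x|?M. norm (\<phi> x)) \<le> 2 * \<rho> * A"
        using A\<phi>[OF \<phi>] \<rho> by (intro mult_left_mono) auto
      moreover have "2 * \<rho> * A = \<tau> / 4" using A by (simp add: \<rho>_def)
      ultimately show ?thesis using osc\<phi>[OF \<phi>] rest\<phi>[OF \<phi>] \<tau> by linarith
    qed
    then have yU: "y \<in> U" using sub yL by blast
    have "(\<Sum>z\<in>?Z. energy f (lbox r \<epsilon> z) u) = (\<Sum>z\<in>?Z. energy f (lbox r \<epsilon> z) (v z))"
      by (intro sum.cong refl energy_cong uv)
    also have "\<dots> \<le> (\<Sum>z\<in>?Z. real (lside r \<epsilon>) ^ ?N * (cell_density \<rho> (\<kappa> z) + \<delta>1))"
      using v by (intro sum_mono) blast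
    finally have "\<epsilon> ^ ?N * (\<Sum>z\<in>?Z. energy f (lbox r \<epsilon> z) u)
        \<le> \<epsilon> ^ ?N * (\<Sum>z\<in>?Z. real (lside r \<epsilon>) ^ ?N * (cell_density \<rho> (\<kappa> z) + \<delta>1))"
      using \<epsilon>N by (intro mult_left_mono) auto
    moreover have "\<epsilon> ^ ?N * (\<Sum>z\<in>?Z. real (lside r \<epsilon>) ^ ?N * (cell_density \<rho> (\<kappa> z) + \<delta>1))
        = ?g \<epsilon> * S + \<delta>1 * real (card ?Z) * ?g \<epsilon>"
    proof -
      have "(\<Sum>z\<in>?Z. real (lside r \<epsilon>) ^ ?N * (cell_density \<rho> (\<kappa> z) + \<delta>1))
          = real (lside r \<epsilon>) ^ ?N * (S + real (card ?Z) * \<delta>1)"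
        by (simp add: S_def sum_distrib_left[symmetric] sum.distrib)
      then show ?thesis by (simp add: power_mult_distrib algebra_simps)
    qed
    moreover have "\<bar>\<epsilon> ^ ?N * energy f (Z_eps \<epsilon> \<Omega>) u - \<epsilon> ^ ?N * (\<Sum>z\<in>?Z. energy f (lbox r \<epsilon> z) u)\<bar>
        \<le> 2 * M * leftover r \<Omega> \<epsilon> + \<delta>1 * real (card ?Z) * ?g \<epsilon>"
      using decomp uS by blast
    moreover have "2 * M * leftover r \<Omega> \<epsilon> \<le> \<delta>" using left M_pos by (simp add: field_simps)
    moreover have "\<delta>1 * real (card ?Z) * ?g \<epsilon> \<le> \<delta> / 2"
      unfolding \<delta>1_def by (rule error_budget[OF r \<delta> \<epsilon>])
    ultimately have "\<epsilon> ^ ?N * energy f (Z_eps \<epsilon> \<Omega>) u \<le> (LINT x|?M. density_env 0 (Q x)) + 6 * \<delta>"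
      using S gS \<delta> by linarith
    moreover have "F_eps f \<Omega> \<epsilon> y = ereal (\<epsilon> ^ ?N * energy f (Z_eps \<epsilon> \<Omega>) u)"
      unfolding F_eps_eq[OF open_\<Omega> \<epsilon> yC] disc_energy_C_eps(1)[OF \<epsilon> yC] ylat ..
    ultimately show ?case using yU by (intro bexI[of _ y]) simp_all
  qed
qed

text \<open>A representative in \<open>C_eps\<close> would force tensor values almost everywhere, so
  the infimum runs over the empty set.\<close>

lemma F_eps_infinite:
  assumes "\<not> (AE x in lebesgue_on \<Omega>. y x \<in> sphere_tensor)"
  shows "F_eps f \<Omega> \<epsilon> y = \<infinity>"
proof -
  have "AE x in lebesgue_on \<Omega>. y x \<in> sphere_tensor"
    if "y' \<in> C_eps \<epsilon> \<Omega>" "AE x in lebesgue_on \<Omega>. y' x = y x" for y'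
    using that(2) AE_space
  proof eventually_elim
    case (elim x)
    then show ?case using that(1) by (auto simp: space_restrict_space C_eps_def)
  qed
  then have empty: "{y' \<in> C_eps \<epsilon> \<Omega>. AE x in lebesgue_on \<Omega>. y' x = y x} = {}" using assms by blast
  show ?thesis unfolding F_eps_def empty by (simp add: top_ereal_def)
qed

lemma Gamma_convergence: "Gamma_converges (weak_star \<Omega>) (F_eps f \<Omega>) (F_hom f \<Omega>) (at_right 0)"
  unfolding Gamma_converges_def
proof
  fix Q assume "Q \<in> topspace (weak_star \<Omega>)"
  then have Q: "Q \<in> Linf \<Omega> sym_matrices" by (simp add: topspace_weak_star)
  let ?inf = "Gamma_liminf (weak_star \<Omega>) (F_eps f \<Omega>) (at_right 0) Q"
  let ?sup = "Gamma_limsup (weak_star \<Omega>) (F_eps f \<Omega>) (at_right 0) Q"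
  have inf_sup: "?inf \<le> ?sup"
    unfolding Gamma_liminf_def Gamma_limsup_def
    by (intro SUP_mono' Liminf_le_Limsup trivial_limit_at_right_real)
  have lower: "?inf \<ge> c" if "openin (weak_star \<Omega>) U" "Q \<in> U" "\<forall>\<^sub>F \<epsilon> in at_right 0. \<forall>y\<in>U. c \<le> F_eps f \<Omega> \<epsilon> y" for U c
  proof -
    have "c \<le> Liminf (at_right 0) (\<lambda>\<epsilon>. INF y\<in>U. F_eps f \<Omega> \<epsilon> y)"
      using that(3) by (intro Liminf_bounded) (auto elim!: eventually_mono intro: INF_greatest)
    also have "\<dots> \<le> ?inf" unfolding Gamma_liminf_def using that(1,2) by (intro SUP_upper) auto
    finally show ?thesis .
  qed
  show "?inf = F_hom f \<Omega> Q \<and> ?sup = F_hom f \<Omega> Q"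
  proof (cases "Q \<in> Linf \<Omega> K_set")
    case True
    define I where "I = (LINT x|lebesgue_on \<Omega>. density_env 0 (Q x))"
    have F: "F_hom f \<Omega> Q = ereal I" using True by (simp add: F_hom_def integral_f_hom[OF True] I_def)
    have "ereal I \<le> ?inf"
    proof (rule ereal_le_epsilon2)
      fix e :: real assume "0 < e"
      then have "e / 6 > 0" by simp
      from liminf_estimate[OF True this] obtain U where "openin (weak_star \<Omega>) U" "Q \<in> U"
        "\<forall>\<^sub>F \<epsilon> in at_right 0. \<forall>y\<in>U. ereal (I - 6 * (e / 6)) \<le> F_eps f \<Omega> \<epsilon> y" unfolding I_def by blast
      from lower[OF this] have "ereal (I - e) \<le> ?inf" by simp
      then have "ereal (I - e) + ereal e \<le> ?inf + ereal e" by (rule add_right_mono)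
      then show "ereal I \<le> ?inf + ereal e" by simp
    qed
    moreover have "?sup \<le> ereal I"
      unfolding Gamma_limsup_def
    proof (rule SUP_least)
      fix U assume "U \<in> {U. openin (weak_star \<Omega>) U \<and> Q \<in> U}"
      then have U: "openin (weak_star \<Omega>) U" "Q \<in> U" by auto
      show "Limsup (at_right 0) (\<lambda>\<epsilon>. INF y\<in>U. F_eps f \<Omega> \<epsilon> y) \<le> ereal I"
      proof (rule ereal_le_epsilon2)
        fix e :: real assume "0 < e"
        then have "e / 6 > 0" by simp
        from limsup_estimate[OF True U this] have "\<forall>\<^sub>F \<epsilon> in at_right 0. (INF y\<in>U. F_eps f \<Omega> \<epsilon> y) \<le> ereal (I + e)"
          unfolding I_def by eventually_elim (auto intro: INF_lower2)
        then show "Limsup (at_right 0) (\<lambda>\<epsilon>. INF y\<in>U. F_eps f \<Omega> \<epsilon> y) \<le> ereal I + ereal e"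
          by (intro Limsup_bounded) simp
      qed
    qed
    ultimately show ?thesis using inf_sup unfolding F by (meson order.antisym order.trans)
  next
    case False
    \<comment> \<open>Off \<open>K_set\<close> a single neighbourhood suffices: every energy on it
      is infinite, hence so is the lower limit, and with it the upper one.\<close>
    from weak_star_separates_K_set[OF bdd lm Q False] obtain U where U: "openin (weak_star \<Omega>) U" "Q \<in> U"
      "\<forall>y\<in>U. \<not> (AE x in lebesgue_on \<Omega>. y x \<in> sphere_tensor)" by blast
    have "\<infinity> \<le> ?inf"
      using U(3) F_eps_infinite by (intro lower[OF U(1,2)] always_eventually) simp
    then have "?inf = \<infinity>" "?sup = \<infinity>" using inf_sup by auto
    then show ?thesis using False by (simp add: F_hom_def)
  qed
qed

end

theorem theorem3p5:
  fixes \<Omega> :: "(real^'n) set" and k :: nat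
    and f :: "int^'n \<Rightarrow> int^'n \<Rightarrow> real^'n^'n \<Rightarrow> real^'n^'n \<Rightarrow> real"
  assumes "bounded \<Omega>" and "open \<Omega>" and "lipschitz_boundary \<Omega>"
    and "k \<ge> 1"
    and periodic: "\<And>\<xi> \<alpha> j Q1 Q2. Q1 \<in> sphere_tensor \<Longrightarrow> Q2 \<in> sphere_tensor \<Longrightarrow>
           f \<xi> (\<alpha> + axis j (int k)) Q1 Q2 = f \<xi> \<alpha> Q1 Q2"
    and symmetric: "\<And>\<xi> \<alpha> Q1 Q2. Q1 \<in> sphere_tensor \<Longrightarrow> Q2 \<in> sphere_tensor \<Longrightarrow>
           f \<xi> \<alpha> Q1 Q2 = f (- \<xi>) (\<alpha> + \<xi>) Q2 Q1"
    and bound: "\<exists>C :: int^'n \<Rightarrow> real.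
           (\<forall>\<xi>. C \<xi> \<ge> 0 \<and>
             (\<forall>\<alpha>. \<forall>Q1\<in>sphere_tensor. \<forall>Q2\<in>sphere_tensor. \<bar>f \<xi> \<alpha> Q1 Q2\<bar> \<le> C \<xi>)) \<and>
           C summable_on UNIV"
  shows "(\<forall>Qbar\<in>K_set. has_hom_limit f Qbar (f_hom f Qbar)) \<and>
         (\<forall>Q\<in>Linf \<Omega> K_set. integrable (lebesgue_on \<Omega>) (\<lambda>x. f_hom f (Q x))) \<and>
         Gamma_converges (weak_star \<Omega>) (F_eps f \<Omega>) (F_hom f \<Omega>) (at_right 0)"
proof -
  from bound obtain C :: "int^'n \<Rightarrow> real" where C: "\<forall>\<xi>. C \<xi> \<ge> 0 \<and>
      (\<forall>\<alpha>. \<forall>Q1\<in>sphere_tensor. \<forall>Q2\<in>sphere_tensor. \<bar>f \<xi> \<alpha> Q1 Q2\<bar> \<le> C \<xi>)" "C summable_on UNIV"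
    by (elim exE conjE) (rule that)
  interpret periodic_interaction_domain f k C \<Omega>
  proof unfold_locales
    show "negligible (frontier \<Omega>)" by (rule negligible_frontier_lipschitz[OF assms(3,2)])
  qed (use assms(1,2,4) periodic C in blast)+
  show ?thesis
    using has_hom_limit_hom_density f_hom_eq integrable_f_hom Gamma_convergence by simp
qed

end
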